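(* Let $\mu$ be a bounded Borel measure on $E$, $\nu$ a positive smooth measure on $E$ and $\{\nu_n\}$ a sequence of positive strictly smooth measures on $E$ such that $\nu_n\nearrow\nu$. Let $u$ be a duality solution to $-Au+u\cdot\nu=\mu$ and $u_n$ be a duality solution to $-Au_n+u_n\cdot\nu_n=\mu$. Then, for every $\rho\in\mathcal B^+(E)$ such that $R\rho$ is bounded, $u_n\to u$ in $L^1(E;\rho\cdot m)$.
   Context: Setting. $E$ is a locally compact separable metric space, $m$ a Radon measure on $E$ with full support, $A$ a non-positive self-adjoint operator on $L^2(E;m)$ generating a strongly continuous Markov semigroup of contractions $(T_t)_{t\ge0}$, and $(\mathcal E,D(\mathcal E))$ the associated symmetric Dirichlet form ($\mathcal E(u,v)=(-Au,v)$ for $u\in D(A)\subset D(\mathcal E)$, $v\in D(\mathcal E)$), assumed regular and transient. $\mathbb X=((X_t),(P_x)_{x\in E\cup\{\Delta\}},(\mathcal F_t))$ is a Hunt process with cemetery $\Delta$ and lifetime $\zeta$ such that $T_tf(x)=E_xf(X_t)$ for $m$-a.e. $x$, $f\in\mathcal B(E)\cap L^2(E;m)$ (functions are extended by $f(\Delta)=0$). $\mathcal B(E)$, $\mathcal B^+(E)$ are the Borel, resp. non-negative Borel, functions on $E$. $P_tf(x)=E_xf(X_t)$, $R_\alpha f(x)=E_x\int_0^\zeta e^{-\alpha t}f(X_t)\,dt$ for $\alpha\ge0$, $R=R_0$. Absolute continuity condition (assumed): for bounded $f\in\mathcal B^+(E)$ with $\int f\,dm=0$ one has $P_tf(x)=0$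 for all $t>0$, $x\in E$. A function $f\in\mathcal B^+(E)$ is excessive if $\sup_{\alpha>0}\alpha R_\alpha f=f$ on $E$. $G\ge0$ (the Green function) is the Borel function on $E\times E$ with $G(x,\cdot),G(\cdot,y)$ excessive and $Rf(x)=\int_E G(x,y)f(y)\,m(dy)$ for all $x\in E$, $f\in\mathcal B^+(E)$; $R\mu(x)=\int_EG(x,y)\,\mu(dy)$ for positive Borel measures $\mu$. The fine topology is the smallest topology on $E$ making all excessive functions continuous. Capacity and smooth measures. $\mathrm{Cap}(U)=\inf\{\mathcal E(u,u):u\in D(\mathcal E),\ u\ge \mathbf 1_U\ m\text{-a.e.}\}$ for open $U$, $\mathrm{Cap}(B)=\inf\{\mathrm{Cap}(U):U\supset B\text{ open}\}$. A positive Borel measure $\nu$ is smooth if it charges no set of zero capacity and there is an increasing sequence of closed sets $F_n$ with $\nu(F_n)<\infty$ and $\mathrm{Cap}(K\setminus F_n)\to0$ for every compact $K\subset E$. It is strictly smooth if moreover there are Borel $B_n\nearrow E$ with $R(\mathbf 1_{B_n}\cdot\nu)$ bounded for each $n$. $\nu_n\nearrow\nu$ means $\nu_n(B)$ increases to $\nu(B)$ for each Borel $B$. A bounded Borel measure is a (signed) Borel measure of finite total variation. Objects attached to a positive smooth $\nu$. $E_\nu$ is the set of $x\in E$ having a finely open neighborhood $V_x$ with $\int_{V_x}G(x,y)\,\nu(dy)<\infty$; $N_\nu=E\setminus E_\nu$ (a polar set). $A^\nu_t=\sup_nA^n_t$, where $A^n$ is the strict positive continuous additive functional (no exceptional set)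 of $\mathbb X$ with $E_x\int_0^\zeta f(X_t)\,dA^n_t=\int_EG(x,y)f(y)\,\beta_n(dy)$, $x\in E$, $f\in\mathcal B^+(E)$, for a sequence $\{\beta_n\}$ of positive strictly smooth measures increasing to $\nu$; $A^\nu$ is a PCAF of $\mathbb X$ with exceptional set $N_\nu$, does not depend (a.s.) on the choice of $\{\beta_n\}$, and $P_x(A^\nu_t=\infty,\ t>0)=1$ for $x\in N_\nu$. $\check R^\nu f(x)=E_x\int_0^\zeta e^{-A^\nu_t}f(X_t)\,dt$, $x\in E$, for $f\in\mathcal B^+(E)$, extended linearly to signed $f$ with $R|f|$ finite. Duality solution. $u\in\mathcal B(E)$ is a duality solution to $-Au+u\cdot\nu=\mu$ if $\int_Eu\eta\,dm=\int_E\check R^\nu\eta\,d\mu$ for every $\eta\in\mathcal B(E)$ such that $R|\eta|$ is bounded. (It exists and is unique up to $m$-a.e. equality.) *)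

theory Defs
  imports "HOL-Probability.Probability"
begin

section \<open>Operators and symmetric Dirichlet forms on \<open>L\<^sup>2(E;m)\<close>\<close>

text \<open>
  Elements of \<open>L\<^sup>2(E;m)\<close> are represented by Borel functions. Operators and forms act on
  representatives; the predicates below make them independent of the choice of representative.
\<close>

definition L2 :: "'e measure \<Rightarrow> ('e \<Rightarrow> real) set" where
  "L2 m = {u \<in> borel_measurable m. integrable m (\<lambda>x. (u x)\<^sup>2)}"

definition L2_inner :: "'e measure \<Rightarrow> ('e \<Rightarrow> real) \<Rightarrow> ('e \<Rightarrow> real) \<Rightarrow> real" where
  "L2_inner m u v = (\<integral>x. u x * v x \<partial>m)"

definition L2_norm :: "'e measure \<Rightarrow> ('e \<Rightarrow> real) \<Rightarrow> real" where
  "L2_norm m u = sqrt (L2_inner m u u)"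

definition L2_tendsto ::
    "'e measure \<Rightarrow> ('i \<Rightarrow> 'e \<Rightarrow> real) \<Rightarrow> ('e \<Rightarrow> real) \<Rightarrow> 'i filter \<Rightarrow> bool" where
  "L2_tendsto m f u F \<longleftrightarrow> ((\<lambda>i. L2_norm m (\<lambda>x. f i x - u x)) \<longlongrightarrow> 0) F"

definition L2_subspace :: "'e measure \<Rightarrow> ('e \<Rightarrow> real) set \<Rightarrow> bool" where
  "L2_subspace m D \<longleftrightarrow>
     D \<subseteq> L2 m \<and> (\<lambda>x. 0) \<in> D \<and>
     (\<forall>u\<in>D. \<forall>v\<in>D. (\<lambda>x. u x + v x) \<in> D) \<and>
     (\<forall>c. \<forall>u\<in>D. (\<lambda>x. c * u x) \<in> D) \<and>
     (\<forall>u\<in>D. \<forall>v\<in>borel_measurable m. (AE x in m. u x = v x) \<longrightarrow> v \<in> D)"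

definition L2_dense :: "'e measure \<Rightarrow> ('e \<Rightarrow> real) set \<Rightarrow> bool" where
  "L2_dense m D \<longleftrightarrow> (\<forall>u\<in>L2 m. \<forall>\<epsilon>>0. \<exists>v\<in>D. L2_norm m (\<lambda>x. u x - v x) < \<epsilon>)"

definition L2_operator ::
    "'e measure \<Rightarrow> ('e \<Rightarrow> real) set \<Rightarrow> (('e \<Rightarrow> real) \<Rightarrow> 'e \<Rightarrow> real) \<Rightarrow> bool" where
  "L2_operator m D A \<longleftrightarrow>
     L2_subspace m D \<and> (\<forall>u\<in>D. A u \<in> L2 m) \<and>
     (\<forall>u\<in>D. \<forall>v\<in>D. (AE x in m. u x = v x) \<longrightarrow> (AE x in m. A u x = A v x)) \<and>
     (\<forall>u\<in>D. \<forall>v\<in>D. AE x in m. A (\<lambda>y. u y + v y) x = A u x + A v x) \<and>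
     (\<forall>c. \<forall>u\<in>D. AE x in m. A (\<lambda>y. c * u y) x = c * A u x)"

text \<open>The last clause says that the graph of \<open>A\<close> is the graph of its adjoint.\<close>

definition self_adjoint ::
    "'e measure \<Rightarrow> ('e \<Rightarrow> real) set \<Rightarrow> (('e \<Rightarrow> real) \<Rightarrow> 'e \<Rightarrow> real) \<Rightarrow> bool" where
  "self_adjoint m D A \<longleftrightarrow>
     L2_operator m D A \<and> L2_dense m D \<and>
     (\<forall>v\<in>L2 m. \<forall>w\<in>L2 m.
        (\<forall>u\<in>D. L2_inner m (A u) v = L2_inner m u w) \<longleftrightarrow> (v \<in> D \<and> (AE x in m. A v x = w x)))"

definition nonpositive ::
    "'e measure \<Rightarrow> ('e \<Rightarrow> real) set \<Rightarrow> (('e \<Rightarrow> real) \<Rightarrow> 'e \<Rightarrow> real) \<Rightarrow> bool" where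
  "nonpositive m D A \<longleftrightarrow> (\<forall>u\<in>D. L2_inner m (A u) u \<le> 0)"

definition markov_contraction_semigroup ::
    "'e measure \<Rightarrow> (real \<Rightarrow> ('e \<Rightarrow> real) \<Rightarrow> 'e \<Rightarrow> real) \<Rightarrow> bool" where
  "markov_contraction_semigroup m T \<longleftrightarrow>
     (\<forall>t\<ge>0. L2_operator m (L2 m) (T t)) \<and>
     (\<forall>u\<in>L2 m. AE x in m. T 0 u x = u x) \<and>
     (\<forall>s\<ge>0. \<forall>t\<ge>0. \<forall>u\<in>L2 m. AE x in m. T (s + t) u x = T s (T t u) x) \<and>
     (\<forall>t\<ge>0. \<forall>u\<in>L2 m. L2_norm m (T t u) \<le> L2_norm m u) \<and>
     (\<forall>u\<in>L2 m. L2_tendsto m (\<lambda>t. T t u) u (at_right 0)) \<and>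
     (\<forall>t\<ge>0. \<forall>u\<in>L2 m. (AE x in m. 0 \<le> u x \<and> u x \<le> 1) \<longrightarrow>
        (AE x in m. 0 \<le> T t u x \<and> T t u x \<le> 1))"

definition generator ::
    "'e measure \<Rightarrow> (real \<Rightarrow> ('e \<Rightarrow> real) \<Rightarrow> 'e \<Rightarrow> real) \<Rightarrow>
     ('e \<Rightarrow> real) set \<Rightarrow> (('e \<Rightarrow> real) \<Rightarrow> 'e \<Rightarrow> real) \<Rightarrow> bool" where
  "generator m T D A \<longleftrightarrow>
     (\<forall>u\<in>L2 m. \<forall>w\<in>L2 m.
        (u \<in> D \<and> (AE x in m. A u x = w x)) \<longleftrightarrow>
        L2_tendsto m (\<lambda>t x. (T t u x - u x) / t) w (at_right 0))"

definition form_1 ::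
    "'e measure \<Rightarrow> (('e \<Rightarrow> real) \<Rightarrow> ('e \<Rightarrow> real) \<Rightarrow> real) \<Rightarrow> ('e \<Rightarrow> real) \<Rightarrow> real" where
  "form_1 m \<E> u = \<E> u u + L2_inner m u u"

definition symmetric_dirichlet_form ::
    "'e measure \<Rightarrow> ('e \<Rightarrow> real) set \<Rightarrow> (('e \<Rightarrow> real) \<Rightarrow> ('e \<Rightarrow> real) \<Rightarrow> real) \<Rightarrow> bool" where
  "symmetric_dirichlet_form m D \<E> \<longleftrightarrow>
     L2_subspace m D \<and> L2_dense m D \<and>
     (\<forall>u\<in>D. \<forall>u'\<in>D. \<forall>v\<in>D. (AE x in m. u x = u' x) \<longrightarrow> \<E> u v = \<E> u' v) \<and>
     (\<forall>u\<in>D. \<forall>v\<in>D. \<E> u v = \<E> v u) \<and>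
     (\<forall>u\<in>D. \<forall>u'\<in>D. \<forall>v\<in>D. \<E> (\<lambda>x. u x + u' x) v = \<E> u v + \<E> u' v) \<and>
     (\<forall>c. \<forall>u\<in>D. \<forall>v\<in>D. \<E> (\<lambda>x. c * u x) v = c * \<E> u v) \<and>
     (\<forall>u\<in>D. 0 \<le> \<E> u u) \<and>
     \<comment> \<open>closedness\<close>
     (\<forall>u::nat \<Rightarrow> 'e \<Rightarrow> real. (\<forall>n. u n \<in> D) \<and>
        (\<forall>\<epsilon>>0. \<exists>N. \<forall>k\<ge>N. \<forall>l\<ge>N. form_1 m \<E> (\<lambda>x. u k x - u l x) < \<epsilon>) \<longrightarrow>
        (\<exists>v\<in>D. (\<lambda>n. form_1 m \<E> (\<lambda>x. u n x - v x)) \<longlonglongrightarrow> 0)) \<and>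
     \<comment> \<open>the unit contraction operates\<close>
     (\<forall>u\<in>D. (\<lambda>x. min (max (u x) 0) 1) \<in> D \<and>
        \<E> (\<lambda>x. min (max (u x) 0) 1) (\<lambda>x. min (max (u x) 0) 1) \<le> \<E> u u)"

definition continuous_compact_support :: "('e::topological_space \<Rightarrow> real) set" where
  "continuous_compact_support = {\<phi>. continuous_on UNIV \<phi> \<and> compact (closure {x. \<phi> x \<noteq> 0})}"

definition regular_form ::
    "'e::topological_space measure \<Rightarrow> ('e \<Rightarrow> real) set \<Rightarrow>
     (('e \<Rightarrow> real) \<Rightarrow> ('e \<Rightarrow> real) \<Rightarrow> real) \<Rightarrow> bool" where
  "regular_form m D \<E> \<longleftrightarrow>
     (\<forall>u\<in>D. \<forall>\<epsilon>>0. \<exists>\<phi>\<in>D \<inter> continuous_compact_support. form_1 m \<E> (\<lambda>x. u x - \<phi> x) < \<epsilon>) \<and>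
     (\<forall>\<psi>\<in>continuous_compact_support. \<forall>\<epsilon>>0. \<exists>\<phi>\<in>D \<inter> continuous_compact_support.
        \<forall>x. \<bar>\<psi> x - \<phi> x\<bar> < \<epsilon>)"

text \<open>Transience in the sense of Fukushima--Oshima--Takeda: existence of a reference function.\<close>

definition transient_form ::
    "'e measure \<Rightarrow> ('e \<Rightarrow> real) set \<Rightarrow> (('e \<Rightarrow> real) \<Rightarrow> ('e \<Rightarrow> real) \<Rightarrow> real) \<Rightarrow> bool" where
  "transient_form m D \<E> \<longleftrightarrow>
     (\<exists>g. integrable m g \<and> (\<exists>C. \<forall>x. \<bar>g x\<bar> \<le> C) \<and> (AE x in m. 0 < g x) \<and>
        (\<forall>u\<in>D. (\<integral>\<^sup>+x. ennreal (\<bar>u x\<bar> * g x) \<partial>m) \<le> ennreal (sqrt (\<E> u u))))"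

locale transient_regular_dirichlet_form =
  fixes m :: "'e::{metric_space, second_countable_topology} measure"
    and DA :: "('e \<Rightarrow> real) set" and A :: "('e \<Rightarrow> real) \<Rightarrow> 'e \<Rightarrow> real"
    and T :: "real \<Rightarrow> ('e \<Rightarrow> real) \<Rightarrow> 'e \<Rightarrow> real"
    and DE :: "('e \<Rightarrow> real) set" and \<E> :: "('e \<Rightarrow> real) \<Rightarrow> ('e \<Rightarrow> real) \<Rightarrow> real"
  assumes locally_compact: "locally compact (UNIV :: 'e set)"
    and sets_m: "sets m = sets borel"
    and radon: "compact K \<Longrightarrow> emeasure m K < \<infinity>"
    and full_support: "open U \<Longrightarrow> U \<noteq> {} \<Longrightarrow> 0 < emeasure m U"
    and self_adjoint_A: "self_adjoint m DA A"
    and nonpositive_A: "nonpositive m DA A"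
    and semigroup: "markov_contraction_semigroup m T"
    and generator_A: "generator m T DA A"
    and dirichlet_form: "symmetric_dirichlet_form m DE \<E>"
    and DA_subset: "DA \<subseteq> DE"
    and form_eq: "u \<in> DA \<Longrightarrow> v \<in> DE \<Longrightarrow> \<E> u v = - L2_inner m (A u) v"
    and regular: "regular_form m DE \<E>"
    and transient: "transient_form m DE \<E>"


section \<open>Capacity and smooth measures\<close>

definition cap_open ::
    "'e measure \<Rightarrow> ('e \<Rightarrow> real) set \<Rightarrow> (('e \<Rightarrow> real) \<Rightarrow> ('e \<Rightarrow> real) \<Rightarrow> real) \<Rightarrow> 'e set \<Rightarrow> ennreal" where
  "cap_open m D \<E> U = (INF u\<in>{u \<in> D. AE x in m. indicator U x \<le> u x}. ennreal (\<E> u u))"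

definition capacity ::
    "'e::topological_space measure \<Rightarrow> ('e \<Rightarrow> real) set \<Rightarrow> (('e \<Rightarrow> real) \<Rightarrow> ('e \<Rightarrow> real) \<Rightarrow> real) \<Rightarrow>
     'e set \<Rightarrow> ennreal" where
  "capacity m D \<E> B = (INF U\<in>{U. open U \<and> B \<subseteq> U}. cap_open m D \<E> U)"

definition smooth_measure ::
    "'e::topological_space measure \<Rightarrow> ('e \<Rightarrow> real) set \<Rightarrow> (('e \<Rightarrow> real) \<Rightarrow> ('e \<Rightarrow> real) \<Rightarrow> real) \<Rightarrow>
     'e measure \<Rightarrow> bool" where
  "smooth_measure m D \<E> \<nu> \<longleftrightarrow>
     sets \<nu> = sets borel \<and>
     (\<forall>B\<in>sets borel. capacity m D \<E> B = 0 \<longrightarrow> emeasure \<nu> B = 0) \<and>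
     (\<exists>F::nat \<Rightarrow> 'e set. (\<forall>n. closed (F n)) \<and> incseq F \<and> (\<forall>n. emeasure \<nu> (F n) < \<infinity>) \<and>
        (\<forall>K. compact K \<longrightarrow> (\<lambda>n. capacity m D \<E> (K - F n)) \<longlonglongrightarrow> 0))"

definition green_potential :: "('e \<Rightarrow> 'e \<Rightarrow> ennreal) \<Rightarrow> 'e measure \<Rightarrow> 'e \<Rightarrow> ennreal" where
  "green_potential G \<nu> x = (\<integral>\<^sup>+y. G x y \<partial>\<nu>)"

definition strictly_smooth_measure ::
    "'e::topological_space measure \<Rightarrow> ('e \<Rightarrow> real) set \<Rightarrow> (('e \<Rightarrow> real) \<Rightarrow> ('e \<Rightarrow> real) \<Rightarrow> real) \<Rightarrow>
     ('e \<Rightarrow> 'e \<Rightarrow> ennreal) \<Rightarrow> 'e measure \<Rightarrow> bool" where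
  "strictly_smooth_measure m D \<E> G \<nu> \<longleftrightarrow>
     smooth_measure m D \<E> \<nu> \<and>
     (\<exists>B::nat \<Rightarrow> 'e set. (\<forall>n. B n \<in> sets borel) \<and> incseq B \<and> (\<Union>n. B n) = UNIV \<and>
        (\<forall>n. (SUP x. green_potential G (density \<nu> (indicator (B n))) x) < \<infinity>))"

definition measures_increase_to :: "(nat \<Rightarrow> 'e::topological_space measure) \<Rightarrow> 'e measure \<Rightarrow> bool" where
  "measures_increase_to \<nu>s \<nu> \<longleftrightarrow>
     (\<forall>B\<in>sets borel. incseq (\<lambda>n. emeasure (\<nu>s n) B) \<and>
        (\<lambda>n. emeasure (\<nu>s n) B) \<longlonglongrightarrow> emeasure \<nu> B)"

text \<open>
  A bounded (signed) Borel measure is a real-valued countably additive set function on the Borel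
  sets (values off the Borel sets are irrelevant) of finite total variation; integration against
  it uses its Jordan decomposition \<open>\<mu> = \<mu>\<^sup>+ - \<mu>\<^sup>-\<close>.
\<close>

definition bounded_borel_measure :: "('e::topological_space set \<Rightarrow> real) \<Rightarrow> bool" where
  "bounded_borel_measure \<mu> \<longleftrightarrow>
     (\<forall>B::nat \<Rightarrow> 'e set. range B \<subseteq> sets borel \<and> disjoint_family B \<longrightarrow>
        (\<lambda>n. \<mu> (B n)) sums \<mu> (\<Union>n. B n)) \<and>
     (\<exists>C. \<forall>\<A>. finite \<A> \<and> \<A> \<subseteq> sets borel \<and> disjoint \<A> \<longrightarrow> (\<Sum>B\<in>\<A>. \<bar>\<mu> B\<bar>) \<le> C)"

definition positive_variation :: "('e::topological_space set \<Rightarrow> real) \<Rightarrow> 'e measure" where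
  "positive_variation \<mu> =
     measure_of UNIV (sets borel) (\<lambda>B. SUP C\<in>{C \<in> sets borel. C \<subseteq> B}. ennreal (\<mu> C))"

text \<open>
  Integrals are taken with respect to the completed measures, so that universally measurable
  integrands (such as expectations of functionals of a process adapted to a completed filtration)
  are covered; for Borel integrands the completion makes no difference.
\<close>

definition signed_integral :: "('e::topological_space set \<Rightarrow> real) \<Rightarrow> ('e \<Rightarrow> real) \<Rightarrow> real" where
  "signed_integral \<mu> f =
     (\<integral>x. f x \<partial>completion (positive_variation \<mu>)) -
     (\<integral>x. f x \<partial>completion (positive_variation (\<lambda>B. - \<mu> B)))"


section \<open>Hunt processes\<close>

text \<open>
  The state space is \<open>E\<^sub>\<Delta> = 'e option\<close>, the one-point compactification of \<open>E\<close> (\<open>\<Delta> = None\<close>, isolated if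
  \<open>E\<close> is compact). The time set is \<open>[0,\<infinity>] = ennreal\<close>. A function \<open>f\<close> on \<open>E\<close> is extended by
  \<open>f(\<Delta>) = 0\<close> as \<open>case_option 0 f\<close>. The laws \<open>P\<^sub>x\<close> live on the \<open>\<sigma>\<close>-algebra generated by the process.
  As nn_integral does not distinguish a measure from its completion, expectations of functions
  measurable with respect to the completed \<open>\<sigma>\<close>-algebras can be taken under \<open>P\<^sub>x\<close> itself.
\<close>

record ('w, 'e) markov_process =
  coord :: "ennreal \<Rightarrow> 'w \<Rightarrow> 'e option"
  translate :: "ennreal \<Rightarrow> 'w \<Rightarrow> 'w"
  law :: "'e option \<Rightarrow> 'w measure"

abbreviation cemetery_topology :: "'e::topological_space option topology" where
  "cemetery_topology \<equiv> Alexandroff_compactification euclidean"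

definition borel_cemetery :: "'e::topological_space option measure" where
  "borel_cemetery = sigma UNIV {B. Some -` B \<in> sets borel}"

definition lifetime :: "('w, 'e) markov_process \<Rightarrow> 'w \<Rightarrow> ennreal" where
  "lifetime X \<omega> = Inf {t. coord X t \<omega> = None}"

definition natural_filtration ::
    "('w, 'e::topological_space) markov_process \<Rightarrow> ennreal \<Rightarrow> 'w measure" where
  "natural_filtration X t =
     sigma UNIV {coord X s -` B | s B. s \<le> t \<and> B \<in> sets borel_cemetery}"

text \<open>\<open>P\<^sub>\<mu> = \<integral> P\<^sub>x \<mu>(dx)\<close> for an initial distribution \<open>\<mu>\<close> on \<open>E\<^sub>\<Delta>\<close>.\<close>

definition law_from ::
    "('w, 'e) markov_process \<Rightarrow> 'e option measure \<Rightarrow> 'w measure" where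
  "law_from X \<mu> = \<mu> \<bind> law X"

text \<open>The minimum completed admissible filtration \<open>\<F>\<^sub>t = \<Inter>\<^sub>\<mu> \<F>\<^sub>t\<^sup>\<mu>\<close>.\<close>

definition completed_filtration ::
    "('w, 'e::topological_space) markov_process \<Rightarrow> ennreal \<Rightarrow> 'w measure" where
  "completed_filtration X t =
     sigma UNIV {\<Lambda>. \<forall>\<mu>\<in>space (prob_algebra borel_cemetery). \<exists>\<Gamma>\<in>sets (natural_filtration X t).
       (\<Lambda> - \<Gamma>) \<union> (\<Gamma> - \<Lambda>) \<in> null_sets (completion (law_from X \<mu>))}"

locale hunt_process =
  fixes X :: "('w, 'e::{metric_space, second_countable_topology}) markov_process"
  assumes kernel: "law X \<in> borel_cemetery \<rightarrow>\<^sub>M prob_algebra (natural_filtration X \<infinity>)"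
    and normal: "AE \<omega> in law X x. coord X 0 \<omega> = x"
    and cemetery: "AE \<omega> in law X None. coord X t \<omega> = None"
    and at_infinity: "coord X \<infinity> \<omega> = None"
    and after_lifetime: "lifetime X \<omega> \<le> t \<Longrightarrow> coord X t \<omega> = None"
    and translate: "coord X s (translate X t \<omega>) = coord X (s + t) \<omega>"
    and right_continuous:
      "t < \<infinity> \<Longrightarrow> limitin cemetery_topology (\<lambda>s. coord X s \<omega>) (coord X t \<omega>) (at_right t)"
    and left_limits:
      "0 < t \<Longrightarrow> t < \<infinity> \<Longrightarrow> \<exists>l. limitin cemetery_topology (\<lambda>s. coord X s \<omega>) l (at_left t)"
    and right_continuous_filtration:
      "t < \<infinity> \<Longrightarrow>
       sets (completed_filtration X t) = (\<Inter>s\<in>{t<..}. sets (completed_filtration X s))"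
    and strong_markov:
      "\<mu> \<in> space (prob_algebra borel_cemetery) \<Longrightarrow> stopping_time (completed_filtration X) \<sigma> \<Longrightarrow>
       B \<in> sets borel_cemetery \<Longrightarrow>
       AE \<omega> in completion (law_from X \<mu>).
         real_cond_exp (completion (law_from X \<mu>))
           (filtration.pre_sigma UNIV (completed_filtration X) \<sigma>)
           (indicator {\<omega>'. coord X (\<sigma> \<omega>' + s) \<omega>' \<in> B}) \<omega>
         = measure (law X (coord X (\<sigma> \<omega>) \<omega>)) {\<omega>'. coord X s \<omega>' \<in> B}"
    and quasi_left_continuous:
      "\<mu> \<in> space (prob_algebra borel_cemetery) \<Longrightarrow>
       (\<And>n::nat. stopping_time (completed_filtration X) (\<sigma>s n)) \<Longrightarrow> incseq \<sigma>s \<Longrightarrow>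
       AE \<omega> in completion (law_from X \<mu>). (SUP n. \<sigma>s n \<omega>) < \<infinity> \<longrightarrow>
         limitin cemetery_topology (\<lambda>n. coord X (\<sigma>s n \<omega>) \<omega>)
           (coord X (SUP n. \<sigma>s n \<omega>) \<omega>) sequentially"

definition transition ::
    "('w, 'e) markov_process \<Rightarrow> real \<Rightarrow> ('e \<Rightarrow> ennreal) \<Rightarrow> 'e \<Rightarrow> ennreal" where
  "transition X t f x = (\<integral>\<^sup>+\<omega>. case_option 0 f (coord X (ennreal t) \<omega>) \<partial>law X (Some x))"

definition alive :: "('w, 'e) markov_process \<Rightarrow> 'w \<Rightarrow> real set" where
  "alive X \<omega> = {t. 0 \<le> t \<and> ennreal t < lifetime X \<omega>}"

definition resolvent ::
    "('w, 'e) markov_process \<Rightarrow> real \<Rightarrow> ('e \<Rightarrow> ennreal) \<Rightarrow> 'e \<Rightarrow> ennreal" where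
  "resolvent X \<alpha> f x =
     (\<integral>\<^sup>+\<omega>. (\<integral>\<^sup>+t\<in>alive X \<omega>. ennreal (exp (- \<alpha> * t)) * case_option 0 f (coord X (ennreal t) \<omega>) \<partial>lborel)
        \<partial>law X (Some x))"

definition excessive ::
    "('w, 'e::topological_space) markov_process \<Rightarrow> ('e \<Rightarrow> ennreal) \<Rightarrow> bool" where
  "excessive X f \<longleftrightarrow>
     f \<in> borel_measurable borel \<and> (\<forall>x. (SUP \<alpha>\<in>{0<..}. ennreal \<alpha> * resolvent X \<alpha> f x) = f x)"

locale green_setting =
  transient_regular_dirichlet_form m DA A T DE \<E> + hunt_process X
  for m :: "'e::{metric_space, second_countable_topology} measure" and DA A T DE \<E>
    and X :: "('w, 'e) markov_process" +
  fixes G :: "'e \<Rightarrow> 'e \<Rightarrow> ennreal"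
  assumes semigroup_process:
      "t \<ge> 0 \<Longrightarrow> f \<in> borel_measurable borel \<Longrightarrow> f \<in> L2 m \<Longrightarrow>
       AE x in m. T t f x = (\<integral>\<omega>. case_option 0 f (coord X (ennreal t) \<omega>) \<partial>law X (Some x))"
    and absolute_continuity:
      "f \<in> borel_measurable borel \<Longrightarrow> (SUP x. f x) < \<infinity> \<Longrightarrow> (\<integral>\<^sup>+x. f x \<partial>m) = 0 \<Longrightarrow> t > 0 \<Longrightarrow>
       transition X t f x = 0"
    and green_measurable: "case_prod G \<in> borel_measurable borel"
    and green_excessive_right: "excessive X (\<lambda>y. G x y)"
    and green_excessive_left: "excessive X (\<lambda>x. G x y)"
    and green_resolvent:
      "f \<in> borel_measurable borel \<Longrightarrow> resolvent X 0 f x = (\<integral>\<^sup>+y. G x y * f y \<partial>m)"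


section \<open>Additive functionals and duality solutions\<close>

text \<open>Strict positive continuous additive functionals: no exceptional set in the defining set \<open>\<Lambda>\<close>.\<close>

definition strict_pcaf ::
    "('w, 'e::topological_space) markov_process \<Rightarrow> (ennreal \<Rightarrow> 'w \<Rightarrow> ennreal) \<Rightarrow> bool" where
  "strict_pcaf X A \<longleftrightarrow>
     (\<forall>t<\<infinity>. A t \<in> borel_measurable (completed_filtration X t)) \<and>
     (\<exists>\<Lambda>\<in>sets (completed_filtration X \<infinity>).
        (\<forall>x. emeasure (completion (law X (Some x))) \<Lambda> = 1) \<and>
        (\<forall>t. 0 < t \<and> t < \<infinity> \<longrightarrow> translate X t ` \<Lambda> \<subseteq> \<Lambda>) \<and>
        (\<forall>\<omega>\<in>\<Lambda>.
           A 0 \<omega> = 0 \<and>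
           continuous_on {..<\<infinity>} (\<lambda>t. A t \<omega>) \<and>
           (\<forall>t<lifetime X \<omega>. A t \<omega> < \<infinity>) \<and>
           (\<forall>t<\<infinity>. lifetime X \<omega> \<le> t \<longrightarrow> A t \<omega> = A (lifetime X \<omega>) \<omega>) \<and>
           (\<forall>s<\<infinity>. \<forall>t<\<infinity>. A (s + t) \<omega> = A s \<omega> + A t (translate X s \<omega>))))"

text \<open>
  The Stieltjes integral \<open>\<integral>\<^sub>0\<^sup>\<zeta> g(t) dA\<^sub>t(\<omega>)\<close>. Since \<open>A\<^sub>t\<close> is finite only for \<open>t < \<zeta>\<close>, it is the increasing
  limit of the integrals over \<open>[0,r]\<close>, \<open>r < \<zeta>\<close>, with respect to the path stopped at \<open>r\<close>. The integrator
  vanishes on the negative half-line because ennreal truncates negative reals to 0.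
\<close>

definition functional_integral ::
    "('w, 'e) markov_process \<Rightarrow> (ennreal \<Rightarrow> 'w \<Rightarrow> ennreal) \<Rightarrow> 'w \<Rightarrow> (real \<Rightarrow> ennreal) \<Rightarrow> ennreal" where
  "functional_integral X A \<omega> g =
     (SUP r\<in>alive X \<omega>.
        \<integral>\<^sup>+t\<in>{0..r}. g t \<partial>interval_measure (\<lambda>t. enn2real (A (ennreal (min t r)) \<omega>)))"

definition revuz_correspondence ::
    "('w, 'e::topological_space) markov_process \<Rightarrow> ('e \<Rightarrow> 'e \<Rightarrow> ennreal) \<Rightarrow>
     (ennreal \<Rightarrow> 'w \<Rightarrow> ennreal) \<Rightarrow> 'e measure \<Rightarrow> bool" where
  "revuz_correspondence X G A \<beta> \<longleftrightarrow>
     (\<forall>f\<in>borel_measurable borel. \<forall>x.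
        (\<integral>\<^sup>+\<omega>. functional_integral X A \<omega> (\<lambda>t. case_option 0 f (coord X (ennreal t) \<omega>)) \<partial>law X (Some x))
        = (\<integral>\<^sup>+y. G x y * f y \<partial>\<beta>))"

text \<open>
  \<open>A\<close> is a version of \<open>A\<^sup>\<nu>\<close>. Since \<open>A\<^sup>\<nu>\<close> is determined only almost surely, it is given by a predicate
  rather than by a chosen functional. \<open>A\<close> may take the value \<open>\<infinity>\<close> immediately for starting points in the
  exceptional set \<open>N\<^sub>\<nu>\<close>.
\<close>

definition smooth_functional ::
    "'e::topological_space measure \<Rightarrow> ('e \<Rightarrow> real) set \<Rightarrow> (('e \<Rightarrow> real) \<Rightarrow> ('e \<Rightarrow> real) \<Rightarrow> real) \<Rightarrow>
     ('w, 'e) markov_process \<Rightarrow> ('e \<Rightarrow> 'e \<Rightarrow> ennreal) \<Rightarrow> 'e measure \<Rightarrow>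
     (ennreal \<Rightarrow> 'w \<Rightarrow> ennreal) \<Rightarrow> bool" where
  "smooth_functional m D \<E> X G \<nu> A \<longleftrightarrow>
     (\<exists>\<beta> An. (\<forall>n. strictly_smooth_measure m D \<E> G (\<beta> n)) \<and> measures_increase_to \<beta> \<nu> \<and>
        (\<forall>n. strict_pcaf X (An n) \<and> revuz_correspondence X G (An n) (\<beta> n)) \<and>
        A = (\<lambda>t \<omega>. SUP n. An n t \<omega>))"

definition exp_minus :: "ennreal \<Rightarrow> ennreal" where
  "exp_minus a = (if a = \<infinity> then 0 else ennreal (exp (- enn2real a)))"

definition killed_potential ::
    "('w, 'e) markov_process \<Rightarrow> (ennreal \<Rightarrow> 'w \<Rightarrow> ennreal) \<Rightarrow> ('e \<Rightarrow> ennreal) \<Rightarrow> 'e \<Rightarrow> ennreal" where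
  "killed_potential X A f x =
     (\<integral>\<^sup>+\<omega>. (\<integral>\<^sup>+t\<in>alive X \<omega>.
          exp_minus (A (ennreal t) \<omega>) * case_option 0 f (coord X (ennreal t) \<omega>) \<partial>lborel)
        \<partial>law X (Some x))"

definition killed_potential_signed ::
    "('w, 'e) markov_process \<Rightarrow> (ennreal \<Rightarrow> 'w \<Rightarrow> ennreal) \<Rightarrow> ('e \<Rightarrow> real) \<Rightarrow> 'e \<Rightarrow> real" where
  "killed_potential_signed X A f x =
     enn2real (killed_potential X A (\<lambda>y. ennreal (f y)) x) -
     enn2real (killed_potential X A (\<lambda>y. ennreal (- f y)) x)"

text \<open>
  Duality solutions of \<open>-Au + u\<cdot>\<nu> = \<mu>\<close>. Integrability of \<open>u\<eta>\<close> is part of the requirement that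
  \<open>\<integral> u \<eta> dm\<close> makes sense (the Bochner integral of a non-integrable function is 0 by convention).
\<close>

definition duality_solution ::
    "'e::topological_space measure \<Rightarrow> ('e \<Rightarrow> real) set \<Rightarrow> (('e \<Rightarrow> real) \<Rightarrow> ('e \<Rightarrow> real) \<Rightarrow> real) \<Rightarrow>
     ('w, 'e) markov_process \<Rightarrow> ('e \<Rightarrow> 'e \<Rightarrow> ennreal) \<Rightarrow> 'e measure \<Rightarrow> ('e set \<Rightarrow> real) \<Rightarrow>
     ('e \<Rightarrow> real) \<Rightarrow> bool" where
  "duality_solution m D \<E> X G \<nu> \<mu> u \<longleftrightarrow>
     u \<in> borel_measurable borel \<and>
     (\<exists>A. smooth_functional m D \<E> X G \<nu> A \<and>
        (\<forall>\<eta>\<in>borel_measurable borel. (SUP x. resolvent X 0 (\<lambda>y. ennreal \<bar>\<eta> y\<bar>) x) < \<infinity> \<longrightarrow>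
           integrable m (\<lambda>x. u x * \<eta> x) \<and>
           (\<integral>x. u x * \<eta> x \<partial>m) = signed_integral \<mu> (killed_potential_signed X A \<eta>)))"

end

theory Submission
  imports Defs
begin

text \<open>
  Write \<open>A\<close> and \<open>A\<^sub>n\<close> for the functionals behind \<open>u\<close> and \<open>u\<^sub>n\<close>. Testing both duality equations with
  \<open>\<eta> = sgn (u\<^sub>n - u) \<rho>\<close> bounds the distance of \<open>u\<^sub>n\<close> and \<open>u\<close> in \<open>L\<^sup>1(\<rho> m)\<close> by the integral of
  \<open>E\<^sub>x \<integral> (exp (- A\<^sub>n(t)) - exp (- A(t))) \<rho>(X\<^sub>t) dt \<le> R\<rho>(x)\<close> against \<open>\<bar>\<mu>\<bar>\<close>, which tends to 0 by dominated
  convergence as soon as \<open>A\<^sub>n\<close> increases to \<open>A\<close> almost surely for every starting point.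

  Since each functional is only given by some approximating sequence, this requires uniqueness: two
  continuous additive functionals with the same bounded potential coincide, because the Markov
  property makes the expected square of their difference vanish. Strictly smooth measures reduce to
  this case by restriction to an exhausting sequence of sets, and comparing Radon--Nikodym densities
  turns inequalities between Revuz measures into inequalities between functionals.
\<close>

section \<open>Natural and completed filtrations\<close>

text \<open>The exceptional set of \<open>\<nu>\<close> never appears: functionals of strictly
  smooth measures are compared from every point, and only then are suprema taken in the extended
  half-line. A path on which \<open>A\<close> is infinite at once contributes
  \<open>exp_minus \<infinity> = 0\<close>.

  The square-mean argument needs finite second moments, hence bounded potentials, which a strictly
  smooth measure has only on the sets of an exhaustion. This is why \<open>f . A\<close>, the
  integral of \<open>f\<close> along the path against \<open>A\<close>, is built for
  \<open>f \<le> 1\<close>: it allows restriction to such sets and to Radon-Nikodym densities. As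
  \<open>A\<close> may explode at the lifetime, \<open>f . A\<close> is a supremum of integrals up
  to alive times, and additivity, continuity and adaptedness have to be recovered from these.

  The strong Markov property is given for a single later time, whereas path functionals measurable
  for a completed filtration are shifted; it is extended to them beforehand. Finally
  \<open>\<rho>\<close> may be infinite on a set of positive measure. The duality equation forces
  the solutions to vanish there, so that real-valued test functions control the norm.\<close>

lemma space_natural_filtration [simp]: "space (natural_filtration X t) = UNIV"
  unfolding natural_filtration_def by (rule space_measure_of) auto

lemma sets_natural_filtration:
  "sets (natural_filtration X t) =
     sigma_sets UNIV {coord X s -` B | s B. s \<le> t \<and> B \<in> sets borel_cemetery}"
  unfolding natural_filtration_def by (rule sets_measure_of) auto

lemma space_borel_cemetery [simp]: "space borel_cemetery = UNIV"
  unfolding borel_cemetery_def by (rule space_measure_of) auto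

lemma sets_borel_cemetery: "sets borel_cemetery = {B. Some -` B \<in> sets borel}"
proof -
  have "sigma_algebra UNIV {B. Some -` B \<in> sets (borel :: 'a measure)}"
  proof (rule sigma_algebra_iff2[THEN iffD2], intro conjI ballI allI impI)
    fix B assume "B \<in> {B. Some -` B \<in> sets (borel :: 'a measure)}"
    then show "UNIV - B \<in> {B. Some -` B \<in> sets (borel :: 'a measure)}"
      by (auto simp: vimage_Diff)
  qed (auto simp: vimage_Union)
  then show ?thesis
    unfolding borel_cemetery_def by (rule sigma_algebra.sets_measure_of_eq)
qed

lemma natural_filtration_mono:
  "s \<le> t \<Longrightarrow> sets (natural_filtration X s) \<subseteq> sets (natural_filtration X t)"
  unfolding sets_natural_filtration by (rule sigma_sets_mono') (use order_trans in blast)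

lemma measurable_coord:
  "s \<le> t \<Longrightarrow> coord X s \<in> natural_filtration X t \<rightarrow>\<^sub>M borel_cemetery"
  by (rule measurableI) (auto simp: sets_natural_filtration intro!: sigma_sets.Basic)

lemma None_in_borel_cemetery: "{None} \<in> sets borel_cemetery"
  by (simp add: sets_borel_cemetery vimage_def)

lemma measurable_Some [measurable]: "Some \<in> borel \<rightarrow>\<^sub>M borel_cemetery"
  by (rule measurableI) (auto simp: sets_borel_cemetery)

lemma measurable_case_option_zero [measurable]:
  fixes f :: "'e::topological_space \<Rightarrow> 'b::{zero, topological_space}"
  assumes [measurable]: "f \<in> borel_measurable borel"
  shows "case_option 0 f \<in> borel_measurable borel_cemetery"
proof (rule measurableI)
  fix B :: "'b set" assume "B \<in> sets borel"
  then have "f -` B \<in> sets borel" using measurable_sets[OF assms] by simp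
  moreover have "Some -` (case_option 0 f -` B) = f -` B" by auto
  ultimately show "case_option 0 f -` B \<inter> space borel_cemetery \<in> sets borel_cemetery"
    by (simp add: sets_borel_cemetery)
qed simp

text \<open>A measurable set of the extended space is a Borel set of \<open>E\<close>, possibly with
  the cemetery added, and the preimage of the cemetery is the complement of the preimage of all of
  \<open>E\<close>.\<close>

lemma measurable_option_cases:
  fixes f :: "'w \<Rightarrow> 'e::topological_space option"
  assumes "\<And>B. B \<in> sets borel \<Longrightarrow> f -` (Some ` B) \<inter> space M \<in> sets M"
  shows "f \<in> M \<rightarrow>\<^sub>M borel_cemetery"
proof (rule measurableI)
  fix B :: "'e option set" assume "B \<in> sets borel_cemetery"
  then have B: "Some -` B \<in> sets borel" by (simp add: sets_borel_cemetery)
  have *: "f -` (Some ` (Some -` B)) \<inter> space M \<in> sets M" "f -` (Some ` UNIV) \<inter> space M \<in> sets M"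
    using assms[OF B] assms[of UNIV] by auto
  show "f -` B \<inter> space M \<in> sets M"
  proof (cases "None \<in> B")
    case True
    then have "f -` B \<inter> space M =
      (space M - f -` (Some ` UNIV) \<inter> space M) \<union> f -` (Some ` (Some -` B)) \<inter> space M"
      by (auto simp: image_iff)
    then show ?thesis using * by auto
  next
    case False
    then have "f -` B \<inter> space M = f -` (Some ` (Some -` B)) \<inter> space M"
      by (auto simp: image_iff) (metis not_Some_eq option.exhaust)
    then show ?thesis using * by auto
  qed
qed simp

section \<open>Path laws and modification by null sets\<close>

context hunt_process
begin

lemma measurable_law: "law X \<in> borel_cemetery \<rightarrow>\<^sub>M subprob_algebra (natural_filtration X \<infinity>)"
  using kernel by (rule measurable_prob_algebraD)

lemma law_in: "law X x \<in> space (prob_algebra (natural_filtration X \<infinity>))"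
  using measurable_space[OF kernel, of x] by simp

lemma sets_law [simp, measurable_cong]: "sets (law X x) = sets (natural_filtration X \<infinity>)"
  using law_in[of x] by (simp add: space_prob_algebra)

lemma space_law [simp]: "space (law X x) = UNIV"
  using sets_eq_imp_space_eq[OF sets_law[of x]] by simp

lemma prob_space_law: "prob_space (law X x)"
  using law_in[of x] by (simp add: space_prob_algebra)

lemma emeasure_law_UNIV [simp]: "emeasure (law X x) UNIV = 1"
  using prob_space.emeasure_space_1[OF prob_space_law[of x]] by simp

lemma
  assumes "\<mu> \<in> space (prob_algebra borel_cemetery)"
  shows sets_law_from: "sets (law_from X \<mu>) = sets (natural_filtration X \<infinity>)"
    and space_law_from: "space (law_from X \<mu>) = UNIV"
    and prob_space_law_from: "prob_space (law_from X \<mu>)"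
proof -
  show *: "sets (law_from X \<mu>) = sets (natural_filtration X \<infinity>)"
    unfolding law_from_def using sets_bind'[OF assms kernel] by simp
  show "space (law_from X \<mu>) = UNIV" using sets_eq_imp_space_eq[OF *] by simp
  show "prob_space (law_from X \<mu>)"
    unfolding law_from_def by (rule prob_space_bind'[OF assms kernel])
qed

lemma return_in: "return borel_cemetery x \<in> space (prob_algebra borel_cemetery)"
  by (auto simp: space_prob_algebra intro!: prob_space_return)

lemma law_from_return: "law_from X (return borel_cemetery x) = law X x"
  unfolding law_from_def by (rule bind_return[OF measurable_law]) simp

text \<open>The generating family in the definition is already a sigma-algebra, so generation adds
  nothing: complements and countable unions of the approximating sets \<open>\<Gamma>\<close> serve
  again. Null sets of the completion are traded for statements almost everywhere under
  \<open>law_from X \<mu>\<close>.\<close>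

lemma sets_completed_filtration:
  "sets (completed_filtration X t) = {\<Lambda>. \<forall>\<mu>\<in>space (prob_algebra borel_cemetery).
     \<exists>\<Gamma>\<in>sets (natural_filtration X t). AE \<omega> in law_from X \<mu>. \<omega> \<in> \<Lambda> \<longleftrightarrow> \<omega> \<in> \<Gamma>}" (is "_ = ?S")
proof -
  have null: "(\<Lambda> - \<Gamma>) \<union> (\<Gamma> - \<Lambda>) \<in> null_sets (completion (law_from X \<mu>)) \<longleftrightarrow>
      (AE \<omega> in law_from X \<mu>. \<omega> \<in> \<Lambda> \<longleftrightarrow> \<omega> \<in> \<Gamma>)"
    if "\<mu> \<in> space (prob_algebra borel_cemetery)" for \<mu> \<Lambda> \<Gamma>
  proof -
    have "{\<omega>. \<not> (\<omega> \<in> \<Lambda> \<longleftrightarrow> \<omega> \<in> \<Gamma>)} = (\<Lambda> - \<Gamma>) \<union> (\<Gamma> - \<Lambda>)" by auto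
    then show ?thesis
      unfolding null_sets_completion_iff2 eventually_ae_filter space_law_from[OF that] by auto
  qed
  have eq: "{\<Lambda>. \<forall>\<mu>\<in>space (prob_algebra borel_cemetery). \<exists>\<Gamma>\<in>sets (natural_filtration X t).
       (\<Lambda> - \<Gamma>) \<union> (\<Gamma> - \<Lambda>) \<in> null_sets (completion (law_from X \<mu>))} = ?S"
    using null by auto
  have "sigma_algebra UNIV ?S"
  proof (rule sigma_algebra_iff2[THEN iffD2], intro conjI ballI allI impI)
    fix \<Lambda> assume \<Lambda>: "\<Lambda> \<in> ?S"
    show "UNIV - \<Lambda> \<in> ?S"
    proof (intro CollectI ballI)
      fix \<mu> :: "'e option measure" assume "\<mu> \<in> space (prob_algebra borel_cemetery)"
      then obtain \<Gamma> where "\<Gamma> \<in> sets (natural_filtration X t)" "AE \<omega> in law_from X \<mu>. \<omega> \<in> \<Lambda> \<longleftrightarrow> \<omega> \<in> \<Gamma>"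
        using \<Lambda> by blast
      then show "\<exists>\<Gamma>\<in>sets (natural_filtration X t). AE \<omega> in law_from X \<mu>. (\<omega> \<in> UNIV - \<Lambda>) = (\<omega> \<in> \<Gamma>)"
        using sets.compl_sets[of \<Gamma> "natural_filtration X t"]
        by (intro bexI[of _ "UNIV - \<Gamma>"]) auto
    qed
  next
    fix L :: "nat \<Rightarrow> 'w set" assume L: "range L \<subseteq> ?S"
    show "(\<Union>i. L i) \<in> ?S"
    proof (intro CollectI ballI)
      fix \<mu> :: "'e option measure" assume "\<mu> \<in> space (prob_algebra borel_cemetery)"
      then have "\<forall>i. \<exists>\<Gamma>\<in>sets (natural_filtration X t). AE \<omega> in law_from X \<mu>. \<omega> \<in> L i \<longleftrightarrow> \<omega> \<in> \<Gamma>"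
        using L by blast
      then obtain \<Gamma> where *: "\<And>i. \<Gamma> i \<in> sets (natural_filtration X t)"
          "\<And>i. AE \<omega> in law_from X \<mu>. \<omega> \<in> L i \<longleftrightarrow> \<omega> \<in> \<Gamma> i"
        by metis
      have "AE \<omega> in law_from X \<mu>. \<forall>i. \<omega> \<in> L i \<longleftrightarrow> \<omega> \<in> \<Gamma> i"
        using *(2) by (simp add: AE_all_countable)
      then show "\<exists>\<Gamma>\<in>sets (natural_filtration X t). AE \<omega> in law_from X \<mu>. (\<omega> \<in> (\<Union>i. L i)) = (\<omega> \<in> \<Gamma>)"
        using *(1) by (intro bexI[of _ "\<Union>i. \<Gamma> i"]) auto
    qed
  qed auto
  then show ?thesis
    unfolding completed_filtration_def eq by (rule sigma_algebra.sets_measure_of_eq)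
qed

lemma space_completed_filtration [simp]: "space (completed_filtration X t) = UNIV"
  unfolding completed_filtration_def by (rule space_measure_of) auto

lemma natural_subset_completed: "sets (natural_filtration X t) \<subseteq> sets (completed_filtration X t)"
  unfolding sets_completed_filtration by auto

lemma completed_filtration_mono:
  "s \<le> t \<Longrightarrow> sets (completed_filtration X s) \<subseteq> sets (completed_filtration X t)"
  unfolding sets_completed_filtration using natural_filtration_mono[of s t X] by fast

lemma completed_subset_completion:
  assumes "\<mu> \<in> space (prob_algebra borel_cemetery)"
  shows "sets (completed_filtration X t) \<subseteq> sets (completion (law_from X \<mu>))"
proof
  fix \<Lambda> assume "\<Lambda> \<in> sets (completed_filtration X t)"
  then obtain \<Gamma> where \<Gamma>: "\<Gamma> \<in> sets (natural_filtration X t)" "AE \<omega> in law_from X \<mu>. \<omega> \<in> \<Lambda> \<longleftrightarrow> \<omega> \<in> \<Gamma>"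
    using assms unfolding sets_completed_filtration by blast
  have "\<Gamma> \<in> sets (completion (law_from X \<mu>))"
    using \<Gamma>(1) natural_filtration_mono[of t \<infinity> X] by (auto simp: sets_law_from[OF assms])
  moreover have "AE \<omega> in completion (law_from X \<mu>). \<omega> \<in> \<Gamma> \<longleftrightarrow> \<omega> \<in> \<Lambda>"
    using \<Gamma>(2) by (auto simp: AE_completion_iff)
  ultimately show "\<Lambda> \<in> sets (completion (law_from X \<mu>))"
    using \<Gamma>(1)
    by (rule_tac completion.in_sets_AE) (auto simp: space_law_from[OF assms])
qed

text \<open>A Dirac initial law turns \<open>law_from\<close> into \<open>law X x\<close>, so the
  completed filtration lies inside the completion of each single path law.\<close>

lemma measurable_completion_law:
  "f \<in> completed_filtration X t \<rightarrow>\<^sub>M N \<Longrightarrow> f \<in> completion (law X x) \<rightarrow>\<^sub>M N"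
  using completed_subset_completion[OF return_in, of t x]
  by (auto simp: measurable_def law_from_return)

lemma measurable_completed_mono:
  "f \<in> completed_filtration X s \<rightarrow>\<^sub>M N \<Longrightarrow> s \<le> t \<Longrightarrow> f \<in> completed_filtration X t \<rightarrow>\<^sub>M N"
  using completed_filtration_mono[of s t] by (auto simp: measurable_def)

lemma completed_version:
  fixes f :: "'w \<Rightarrow> ennreal"
  assumes "f \<in> borel_measurable (completed_filtration X t)" "\<mu> \<in> space (prob_algebra borel_cemetery)"
  shows "\<exists>f'\<in>borel_measurable (natural_filtration X \<infinity>). AE \<omega> in law_from X \<mu>. f \<omega> = f' \<omega>"
proof -
  have "f \<in> borel_measurable (completion (law_from X \<mu>))"
    using assms(1) completed_subset_completion[OF assms(2), of t]
    by (auto simp: measurable_def space_law_from[OF assms(2)])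
  from completion_ex_borel_measurable[OF this] show ?thesis
    by (simp add: sets_law_from[OF assms(2)] cong: measurable_cong_sets)
qed

text \<open>\<open>\<Lambda>\<close> itself need not be measurable for the natural filtration, so
  the disintegration \<open>AE_bind\<close> is applied to a natural version \<open>\<Gamma>\<close>
  and to a natural null set \<open>N\<close> that contains the difference.\<close>

lemma AE_law_from:
  assumes \<Lambda>: "\<Lambda> \<in> sets (completed_filtration X \<infinity>)" and AE: "\<And>x. AE \<omega> in law X x. \<omega> \<in> \<Lambda>"
    and \<mu>: "\<mu> \<in> space (prob_algebra borel_cemetery)"
  shows "AE \<omega> in law_from X \<mu>. \<omega> \<in> \<Lambda>"
proof -
  have \<mu>': "sets \<mu> = sets borel_cemetery" using \<mu> by (simp add: space_prob_algebra)
  have k: "law X \<in> \<mu> \<rightarrow>\<^sub>M subprob_algebra (natural_filtration X \<infinity>)"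
    using measurable_law by (simp add: measurable_cong_sets[OF \<mu>' refl])
  obtain \<Gamma> where \<Gamma>: "\<Gamma> \<in> sets (natural_filtration X \<infinity>)" "AE \<omega> in law_from X \<mu>. \<omega> \<in> \<Lambda> \<longleftrightarrow> \<omega> \<in> \<Gamma>"
    using \<Lambda> \<mu> unfolding sets_completed_filtration by blast
  then obtain N where N: "N \<in> null_sets (law_from X \<mu>)" "{\<omega>. \<not> (\<omega> \<in> \<Lambda> \<longleftrightarrow> \<omega> \<in> \<Gamma>)} \<subseteq> N"
    unfolding eventually_ae_filter by (auto simp: space_law_from[OF \<mu>])
  have NS: "N \<in> sets (natural_filtration X \<infinity>)"
    using null_setsD2[OF N(1)] by (simp only: sets_law_from[OF \<mu>])
  have pN: "Measurable.pred (natural_filtration X \<infinity>) (\<lambda>\<omega>. \<omega> \<notin> N)"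
    using NS by measurable
  have p\<Gamma>: "Measurable.pred (natural_filtration X \<infinity>) (\<lambda>\<omega>. \<omega> \<in> \<Gamma>)"
    using \<Gamma>(1) by measurable
  have "AE \<omega> in law_from X \<mu>. \<omega> \<notin> N" using AE_not_in[OF N(1)] .
  then have "AE x in \<mu>. AE \<omega> in law X x. \<omega> \<notin> N"
    unfolding law_from_def using AE_bind[OF k pN] by simp
  then have "AE x in \<mu>. AE \<omega> in law X x. \<omega> \<in> \<Gamma>"
  proof eventually_elim
    case (elim x)
    with AE[of x] show ?case by eventually_elim (use N(2) in auto)
  qed
  then have "AE \<omega> in law_from X \<mu>. \<omega> \<in> \<Gamma>"
    unfolding law_from_def using AE_bind[OF k p\<Gamma>] by simp
  with \<Gamma>(2) show ?thesis by eventually_elim simp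
qed

text \<open>An event certain under every initial law differs from \<open>UNIV\<close> by null sets
  and is therefore known at every time. Thus the good set of an additive functional, given only at
  time \<open>\<infinity>\<close>, may be used in adaptedness proofs at time
  \<open>t\<close>.\<close>

lemma full_set_in_completed:
  assumes "\<And>\<mu>. \<mu> \<in> space (prob_algebra borel_cemetery) \<Longrightarrow> AE \<omega> in law_from X \<mu>. \<omega> \<in> \<Lambda>"
  shows "\<Lambda> \<in> sets (completed_filtration X t)"
proof -
  have "UNIV \<in> sets (natural_filtration X t)"
    using sets.top[of "natural_filtration X t"] by simp
  then show ?thesis
    unfolding sets_completed_filtration using assms by (auto intro!: bexI[of _ UNIV])
qed

text \<open>A set null under \<open>law_from X \<mu>\<close> is null under \<open>law X x\<close>
  for \<open>\<mu>\<close>-almost every \<open>x\<close>, so replacing \<open>F\<close> by a natural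
  version changes the expectation only for a \<open>\<mu>\<close>-null set of starting points.
  Expectations of completed functions are thereby universally measurable.\<close>

lemma measurable_expectation_version:
  fixes F :: "'w \<Rightarrow> ennreal"
  assumes "F \<in> borel_measurable (completed_filtration X \<infinity>)" "\<mu> \<in> space (prob_algebra borel_cemetery)"
  obtains F' where "F' \<in> borel_measurable (natural_filtration X \<infinity>)"
    "AE \<omega> in law_from X \<mu>. F \<omega> = F' \<omega>"
    "AE x in \<mu>. (\<integral>\<^sup>+\<omega>. F \<omega> \<partial>law X x) = (\<integral>\<^sup>+\<omega>. F' \<omega> \<partial>law X x)"
    "(\<lambda>x. \<integral>\<^sup>+\<omega>. F' \<omega> \<partial>law X x) \<in> borel_measurable borel_cemetery"
proof -
  obtain F' where F': "F' \<in> borel_measurable (natural_filtration X \<infinity>)" "AE \<omega> in law_from X \<mu>. F \<omega> = F' \<omega>"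
    using completed_version[OF assms] by blast
  have \<mu>': "sets \<mu> = sets borel_cemetery" using assms(2) by (simp add: space_prob_algebra)
  have k: "law X \<in> \<mu> \<rightarrow>\<^sub>M subprob_algebra (natural_filtration X \<infinity>)"
    using measurable_law by (simp add: measurable_cong_sets[OF \<mu>' refl])
  from F'(2) obtain N where N: "N \<in> null_sets (law_from X \<mu>)" "{\<omega>. F \<omega> \<noteq> F' \<omega>} \<subseteq> N"
    unfolding eventually_ae_filter by (auto simp: space_law_from[OF assms(2)])
  have NS: "N \<in> sets (natural_filtration X \<infinity>)"
    using null_setsD2[OF N(1)] by (simp only: sets_law_from[OF assms(2)])
  have pN: "Measurable.pred (natural_filtration X \<infinity>) (\<lambda>\<omega>. \<omega> \<notin> N)"
    using NS by measurable
  have "AE \<omega> in law_from X \<mu>. \<omega> \<notin> N" using AE_not_in[OF N(1)] .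
  then have "AE x in \<mu>. AE \<omega> in law X x. \<omega> \<notin> N"
    unfolding law_from_def using AE_bind[OF k pN] by simp
  then have "AE x in \<mu>. (\<integral>\<^sup>+\<omega>. F \<omega> \<partial>law X x) = (\<integral>\<^sup>+\<omega>. F' \<omega> \<partial>law X x)"
  proof eventually_elim
    case (elim x)
    then have "AE \<omega> in law X x. F \<omega> = F' \<omega>" by eventually_elim (use N(2) in auto)
    then show ?case by (rule nn_integral_cong_AE)
  qed
  moreover have "(\<lambda>x. \<integral>\<^sup>+\<omega>. F' \<omega> \<partial>law X x) \<in> borel_measurable borel_cemetery"
    by (rule measurable_compose[OF measurable_law nn_integral_measurable_subprob_algebra[OF F'(1)]])
  ultimately show thesis using that F' by blast
qed

end

section \<open>The Markov property\<close>

text \<open>The completion contains all subsets of null sets, so changing a measurable function on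
  such a set is harmless.\<close>

lemma measurable_completion_AE:
  assumes g: "g \<in> completion M \<rightarrow>\<^sub>M N" and eq: "AE x in M. f x = g x"
    and f: "f \<in> space M \<rightarrow> space N"
  shows "f \<in> completion M \<rightarrow>\<^sub>M N"
proof (rule measurableI)
  fix A assume "A \<in> sets N"
  then have 1: "g -` A \<inter> space M \<in> sets (completion M)" using measurable_sets[OF g] by simp
  have "AE x in completion M. x \<in> g -` A \<inter> space M \<longleftrightarrow> x \<in> f -` A \<inter> space M"
    using eq unfolding AE_completion_iff by eventually_elim simp
  from completion.in_sets_AE[OF this 1] have "f -` A \<inter> space M \<in> sets (completion M)"
    by simp
  then show "f -` A \<inter> space (completion M) \<in> sets (completion M)" by simp
qed (use f in auto)

context hunt_process
begin

lemma prob_space_completion_law: "prob_space (completion (law X x))"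
  using emeasure_law_UNIV[of x] sets.top[of "law X x"]
  by (intro prob_spaceI) (simp del: emeasure_law_UNIV)

lemma measurable_translate:
  "translate X t \<in> natural_filtration X \<infinity> \<rightarrow>\<^sub>M natural_filtration X \<infinity>"
  unfolding natural_filtration_def[of X \<infinity>]
proof (rule measurable_measure_of)
  fix \<Lambda> assume "\<Lambda> \<in> {coord X s -` B | s B. s \<le> \<infinity> \<and> B \<in> sets borel_cemetery}"
  then obtain s B where \<Lambda>: "\<Lambda> = coord X s -` B" "B \<in> sets borel_cemetery" by blast
  have "translate X t -` \<Lambda> = coord X (s + t) -` B"
    by (auto simp: \<Lambda> translate)
  with \<Lambda>(2) show "translate X t -` \<Lambda> \<inter> space (sigma UNIV {coord X s -` B | s B. s \<le> \<infinity> \<and> B \<in> sets borel_cemetery})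
      \<in> sets (sigma UNIV {coord X s -` B | s B. s \<le> \<infinity> \<and> B \<in> sets borel_cemetery})"
    by (subst space_measure_of) (auto intro!: sigma_sets.Basic)
qed auto

text \<open>The strong Markov property at the constant time \<open>t\<close>, rewritten from a
  conditional expectation into an integral over an event \<open>H\<close> of the completed
  sigma-algebra.\<close>

lemma markov_one:
  assumes H: "H \<in> sets (completed_filtration X t)" and B: "B \<in> sets borel_cemetery"
  shows "emeasure (completion (law X x)) (H \<inter> coord X (t + s) -` B) =
    (\<integral>\<^sup>+\<omega>\<in>H. emeasure (law X (coord X t \<omega>)) (coord X s -` B) \<partial>completion (law X x))"
proof -
  let ?M = "completion (law X x)"
  let ?f = "indicator {\<omega>'. coord X (t + s) \<omega>' \<in> B} :: 'w \<Rightarrow> real"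
  interpret M: prob_space ?M
    by (rule prob_space_completion_law)
  interpret fil: filtration UNIV "completed_filtration X"
    by unfold_locales (use completed_filtration_mono in auto)
  let ?F = "fil.pre_sigma (\<lambda>_. t)"
  have st: "stopping_time (completed_filtration X) (\<lambda>_. t)" by (rule stopping_time_const)
  have HM: "K \<in> sets ?M" if "K \<in> sets (completed_filtration X r)" for K r
    using that completed_subset_completion[OF return_in, of r x] by (auto simp: law_from_return)
  have Fsub: "sets ?F \<subseteq> sets ?M"
  proof
    fix K assume "K \<in> sets ?F"
    from fil.sets_pre_sigmaD[OF st this, of t] show "K \<in> sets ?M" by (simp add: HM)
  qed
  interpret finite_measure_subalgebra ?M ?F
    by unfold_locales (use Fsub in \<open>auto simp: subalgebra_def fil.space_pre_sigma\<close>)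
  \<comment> \<open>For \<open>r < t\<close> the required event is empty; for
    \<open>t \<le> r\<close> it is \<open>H\<close>, which monotonicity of the filtration carries to
    time \<open>r\<close>.\<close>
  have HF: "H \<in> sets ?F"
  proof (rule fil.sets_pre_sigmaI[OF st])
    fix r show "{\<omega> \<in> H. t \<le> r} \<in> sets (completed_filtration X r)"
      using H completed_filtration_mono[of t r] by (cases "t \<le> r") auto
  qed
  have C: "coord X r \<in> ?M \<rightarrow>\<^sub>M borel_cemetery" for r
    using measurable_coord[of r \<infinity> X] by (intro measurable_completion) (simp cong: measurable_cong_sets)
  have CB: "coord X (t + s) -` B \<in> sets ?M"
    using measurable_sets[OF C B] by simp
  have fm: "?f \<in> borel_measurable ?M"
    using CB by (intro borel_measurable_indicator) (simp add: vimage_def)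
  have fi: "integrable ?M ?f"
    by (rule M.integrable_const_bound[where B=1]) (use fm in auto)
  let ?g = "\<lambda>\<omega>. measure (law X (coord X t \<omega>)) {\<omega>'. coord X s \<omega>' \<in> B}"
  have sB: "coord X s -` B \<in> sets (natural_filtration X \<infinity>)"
    using measurable_sets[OF measurable_coord[of s \<infinity> X] B] by simp
  have "(\<lambda>y. measure (law X y) (coord X s -` B)) \<in> borel_measurable borel_cemetery"
    by (rule measurable_compose[OF measurable_law measurable_measure_subprob_algebra[OF sB]])
  from measurable_compose[OF C this] have gm: "?g \<in> borel_measurable ?M"
    by (simp add: vimage_def)
  have ae: "AE \<omega> in ?M. real_cond_exp ?M ?F ?f \<omega> = ?g \<omega>"
    using strong_markov[OF return_in st B, of x s]
    unfolding law_from_return .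
  have "measure ?M (H \<inter> coord X (t + s) -` B) = (\<integral>\<omega>\<in>H. ?f \<omega> \<partial>?M)"
  proof -
    have "(\<integral>\<omega>\<in>H. ?f \<omega> \<partial>?M) = (\<integral>\<omega>. indicator (H \<inter> coord X (t + s) -` B) \<omega> \<partial>?M)"
      unfolding set_lebesgue_integral_def by (rule Bochner_Integration.integral_cong) (auto split: split_indicator)
    then show ?thesis by simp
  qed
  also have "\<dots> = (\<integral>\<omega>\<in>H. real_cond_exp ?M ?F ?f \<omega> \<partial>?M)"
    by (rule real_cond_exp_intA[OF fi HF])
  also have "\<dots> = (\<integral>\<omega>. indicator H \<omega> * ?g \<omega> \<partial>?M)"
    unfolding set_lebesgue_integral_def
    by (rule integral_cong_AE) (use ae HM[OF H] gm in \<open>auto intro!: borel_measurable_times borel_measurable_cond_exp2 elim: eventually_mono\<close>)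
  finally have eq: "measure ?M (H \<inter> coord X (t + s) -` B) = (\<integral>\<omega>. indicator H \<omega> * ?g \<omega> \<partial>?M)" .
  have int: "integrable ?M (\<lambda>\<omega>. indicator H \<omega> * ?g \<omega>)"
    by (rule M.integrable_const_bound[where B=1])
       (use gm HM[OF H] in \<open>auto split: split_indicator intro!: prob_space.prob_le_1 prob_space_law\<close>)
  have "emeasure ?M (H \<inter> coord X (t + s) -` B) = ennreal (\<integral>\<omega>. indicator H \<omega> * ?g \<omega> \<partial>?M)"
    by (simp only: M.emeasure_eq_measure eq)
  also have "\<dots> = (\<integral>\<^sup>+\<omega>. ennreal (indicator H \<omega> * ?g \<omega>) \<partial>?M)"
    by (rule nn_integral_eq_integral[OF int, symmetric]) auto
  also have "\<dots> = (\<integral>\<^sup>+\<omega>\<in>H. emeasure (law X (coord X t \<omega>)) (coord X s -` B) \<partial>?M)"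
  proof (rule nn_integral_cong)
    fix \<omega>
    interpret p: prob_space "law X (coord X t \<omega>)" by (rule prob_space_law)
    show "ennreal (indicator H \<omega> * ?g \<omega>) =
        emeasure (law X (coord X t \<omega>)) (coord X s -` B) * indicator H \<omega>"
      by (auto split: split_indicator simp: p.emeasure_eq_measure vimage_def)
  qed
  finally show ?thesis .
qed

lemma markov_one_fun:
  assumes H: "H \<in> sets (completed_filtration X t)"
    and g: "g \<in> borel_measurable borel_cemetery"
  shows "(\<integral>\<^sup>+\<omega>\<in>H. g (coord X (t + s) \<omega>) \<partial>completion (law X x)) =
    (\<integral>\<^sup>+\<omega>\<in>H. (\<integral>\<^sup>+\<omega>'. g (coord X s \<omega>') \<partial>law X (coord X t \<omega>)) \<partial>completion (law X x))"
proof -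
  let ?M = "completion (law X x)"
  have HM: "H \<in> sets ?M"
    using H completed_subset_completion[OF return_in, of t x] by (auto simp: law_from_return)
  have C [measurable]: "coord X r \<in> ?M \<rightarrow>\<^sub>M borel_cemetery" for r
    using measurable_coord[of r \<infinity> X] by (intro measurable_completion) (simp cong: measurable_cong_sets)
  have Cl [measurable]: "coord X r \<in> law X y \<rightarrow>\<^sub>M borel_cemetery" for r y
    using measurable_coord[of r \<infinity> X] by (simp cong: measurable_cong_sets)
  have E [measurable]: "(\<lambda>y. \<integral>\<^sup>+\<omega>'. h (coord X s \<omega>') \<partial>law X y) \<in> borel_measurable borel_cemetery"
    if "h \<in> borel_measurable borel_cemetery" for h :: "'e option \<Rightarrow> ennreal"
    by (rule measurable_compose[OF measurable_law nn_integral_measurable_subprob_algebra])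
       (rule measurable_compose[OF measurable_coord that], simp)
  have iH [measurable]: "(indicator H :: 'w \<Rightarrow> ennreal) \<in> borel_measurable ?M"
    using HM by simp
  from g show ?thesis
  proof (induction rule: borel_measurable_induct)
    case (cong f g)
    then have "f = g" by (auto simp: fun_eq_iff)
    with cong show ?case by simp
  next
    case (set B)
    have "(\<integral>\<^sup>+\<omega>\<in>H. indicator B (coord X (t + s) \<omega>) \<partial>?M) = (\<integral>\<^sup>+\<omega>. indicator (H \<inter> coord X (t + s) -` B) \<omega> \<partial>?M)"
      by (rule nn_integral_cong) (auto split: split_indicator)
    also have "\<dots> = emeasure ?M (H \<inter> coord X (t + s) -` B)"
      using HM measurable_sets[OF C[of "t + s"] set] by (intro nn_integral_indicator) auto
    also have "\<dots> = (\<integral>\<^sup>+\<omega>\<in>H. emeasure (law X (coord X t \<omega>)) (coord X s -` B) \<partial>?M)"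
      by (rule markov_one[OF H set])
    also have "\<dots> = (\<integral>\<^sup>+\<omega>\<in>H. (\<integral>\<^sup>+\<omega>'. indicator B (coord X s \<omega>') \<partial>law X (coord X t \<omega>)) \<partial>?M)"
    proof (rule nn_integral_cong)
      fix \<omega>
      have "emeasure (law X (coord X t \<omega>)) (coord X s -` B) =
          (\<integral>\<^sup>+\<omega>'. indicator (coord X s -` B) \<omega>' \<partial>law X (coord X t \<omega>))"
        using measurable_sets[OF Cl[of s] set] by (intro nn_integral_indicator[symmetric]) auto
      then show "emeasure (law X (coord X t \<omega>)) (coord X s -` B) * indicator H \<omega> =
          (\<integral>\<^sup>+\<omega>'. indicator B (coord X s \<omega>') \<partial>law X (coord X t \<omega>)) * indicator H \<omega>"
        by (simp add: indicator_def)
    qed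
    finally show ?case .
  next
    case (mult u c)
    note [measurable] = mult(2) E[OF mult(2)]
    show ?case
      using mult by (simp add: nn_integral_cmult mult.assoc)
  next
    case (add u v)
    note [measurable] = add.hyps(1,3) E[OF add.hyps(1)] E[OF add.hyps(3)]
    show ?case
      using add by (simp add: nn_integral_add distrib_right)
  next
    case (seq U)
    note [measurable] = seq(1) E[OF seq(1)]
    have inc: "incseq (\<lambda>i y. \<integral>\<^sup>+\<omega>'. U i (coord X s \<omega>') \<partial>law X y)"
      using seq(3) by (auto simp: incseq_def le_fun_def intro!: nn_integral_mono)
    have "(\<integral>\<^sup>+\<omega>\<in>H. (SUP i. U i) (coord X (t + s) \<omega>) \<partial>?M) = (\<integral>\<^sup>+\<omega>. (SUP i. U i (coord X (t + s) \<omega>) * indicator H \<omega>) \<partial>?M)"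
      by (simp add: SUP_mult_right_ennreal image_comp)
    also have "\<dots> = (SUP i. \<integral>\<^sup>+\<omega>. U i (coord X (t + s) \<omega>) * indicator H \<omega> \<partial>?M)"
      using seq(3) by (intro nn_integral_monotone_convergence_SUP) (auto simp: incseq_def le_fun_def intro!: mult_right_mono)
    also have "\<dots> = (SUP i. \<integral>\<^sup>+\<omega>\<in>H. (\<integral>\<^sup>+\<omega>'. U i (coord X s \<omega>') \<partial>law X (coord X t \<omega>)) \<partial>?M)"
      using seq by simp
    also have "\<dots> = (\<integral>\<^sup>+\<omega>. (SUP i. (\<integral>\<^sup>+\<omega>'. U i (coord X s \<omega>') \<partial>law X (coord X t \<omega>)) * indicator H \<omega>) \<partial>?M)"
      using inc by (intro nn_integral_monotone_convergence_SUP[symmetric]) (auto simp: incseq_def le_fun_def intro!: mult_right_mono)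
    also have "\<dots> = (\<integral>\<^sup>+\<omega>\<in>H. (\<integral>\<^sup>+\<omega>'. (SUP i. U i) (coord X s \<omega>') \<partial>law X (coord X t \<omega>)) \<partial>?M)"
      using seq(3)
      by (intro nn_integral_cong)
         (simp add: SUP_mult_right_ennreal[symmetric] image_comp nn_integral_monotone_convergence_SUP incseq_def le_fun_def)
    finally show ?case .
  qed
qed

section \<open>From one later time to events and functionals of the whole path\<close>

definition cylinder :: "ennreal set \<Rightarrow> (ennreal \<Rightarrow> 'e option set) \<Rightarrow> 'w set" where
  "cylinder T B = {\<omega>. \<forall>s\<in>T. coord X s \<omega> \<in> B s}"

lemma cylinder_in:
  assumes "finite T" "\<And>s. B s \<in> sets borel_cemetery"
  shows "cylinder T B \<in> sets (natural_filtration X \<infinity>)"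
proof -
  have "cylinder T B = {\<omega> \<in> space (natural_filtration X \<infinity>). \<forall>s\<in>T. coord X s \<omega> \<in> B s}"
    by (simp add: cylinder_def)
  also have "\<dots> \<in> sets (natural_filtration X \<infinity>)"
    using measurable_sets[OF measurable_coord[of _ \<infinity> X] assms(2)]
    by (intro sets.sets_Collect_finite_All assms(1)) (auto simp: vimage_def)
  finally show ?thesis .
qed

text \<open>Induction on the number of times: the least time \<open>u\<close> is split off and the
  others are shifted by \<open>u\<close>. The induction hypothesis at time \<open>t + u\<close>, on
  \<open>H\<close> cut by the condition at \<open>u\<close>, leaves a function of the position at
  \<open>t + u\<close>. The one-time Markov property at \<open>t\<close> moves it under the law from
  the current position, where the cylinder is reassembled.\<close>

lemma markov_cylinder:
  assumes "finite T" "\<And>s. B s \<in> sets borel_cemetery" "H \<in> sets (completed_filtration X t)"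
  shows "emeasure (completion (law X x)) (H \<inter> translate X t -` cylinder T B) =
    (\<integral>\<^sup>+\<omega>\<in>H. emeasure (law X (coord X t \<omega>)) (cylinder T B) \<partial>completion (law X x))"
  using assms
proof (induction "card T" arbitrary: T B H t x rule: less_induct)
  case less
  let ?M = "\<lambda>x. completion (law X x)"
  have HM: "K \<in> sets (?M x)" if "K \<in> sets (completed_filtration X r)" for K r x
    using that completed_subset_completion[OF return_in, of r x] by (auto simp: law_from_return)
  show ?case
  proof (cases "T = {}")
    case True
    then have "cylinder T B = UNIV" by (simp add: cylinder_def)
    then show ?thesis using HM[OF less.prems(3), of x] by simp
  next
    case False
    define u where "u = Min T"
    define T' where "T' = (\<lambda>s. s - u) ` (T - {u})"
    define B' where "B' = (\<lambda>r. B (u + r))"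
    have uT: "u \<in> T" and ule: "\<And>s. s \<in> T \<Longrightarrow> u \<le> s"
      using False less.prems(1) by (auto simp: u_def)
    have add: "s = u + (s - u)" if "s \<in> T" for s
      using ule[OF that] by (simp add: add_diff_inverse_ennreal)
    have "card T' \<le> card (T - {u})"
      unfolding T'_def using less.prems(1) by (intro card_image_le) simp
    also have "\<dots> < card T" by (rule card_Diff1_less[OF less.prems(1) uT])
    finally have card: "card T' < card T" .
    have fin: "finite T'" using less.prems(1) by (simp add: T'_def)
    have B': "B' r \<in> sets borel_cemetery" for r using less.prems(2) by (simp add: B'_def)
    note IH = less.hyps[OF card fin B']
    have split: "\<omega> \<in> cylinder T B \<longleftrightarrow> coord X u \<omega> \<in> B u \<and> translate X u \<omega> \<in> cylinder T' B'" for \<omega>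
    proof -
      have "translate X u \<omega> \<in> cylinder T' B' \<longleftrightarrow> (\<forall>s\<in>T - {u}. coord X (u + (s - u)) \<omega> \<in> B (u + (s - u)))"
        by (simp add: cylinder_def T'_def B'_def translate add.commute)
      also have "\<dots> \<longleftrightarrow> (\<forall>s\<in>T - {u}. coord X s \<omega> \<in> B s)"
        using add by (intro ball_cong) auto
      finally show ?thesis using uT by (auto simp: cylinder_def)
    qed
    have transl: "translate X u (translate X r \<omega>) \<in> cylinder T' B' \<longleftrightarrow> translate X (r + u) \<omega> \<in> cylinder T' B'" for r \<omega>
      by (simp add: cylinder_def translate add.assoc add.commute[of r u])
    define \<psi> where "\<psi> = (\<lambda>y. emeasure (law X y) (cylinder T' B'))"
    have \<psi> [measurable]: "\<psi> \<in> borel_measurable borel_cemetery"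
      unfolding \<psi>_def
      by (rule measurable_compose[OF measurable_law measurable_emeasure_subprob_algebra[OF cylinder_in[OF fin B']]])
    let ?g = "\<lambda>y. \<psi> y * indicator (B u) y"
    have g [measurable]: "?g \<in> borel_measurable borel_cemetery"
      using less.prems(2)[of u] by measurable
    have coordB: "coord X (r + u) -` B u \<in> sets (completed_filtration X (r + u))" for r
      using measurable_sets[OF measurable_coord[OF order_refl, of X "r + u"] less.prems(2)[of u]]
        natural_subset_completed[of "r + u"] by auto
    \<comment> \<open>The induction hypothesis is used a second time, at time \<open>u\<close> and
      from the starting point \<open>y\<close>; this is why it is generalised over \<open>H\<close>,
      \<open>t\<close> and \<open>x\<close>.\<close>
    have inner: "(\<integral>\<^sup>+\<omega>'. ?g (coord X u \<omega>') \<partial>law X y) = emeasure (law X y) (cylinder T B)" for y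
    proof -
      have "(\<integral>\<^sup>+\<omega>'. ?g (coord X u \<omega>') \<partial>law X y) = (\<integral>\<^sup>+\<omega>'\<in>coord X u -` B u. \<psi> (coord X u \<omega>') \<partial>?M y)"
        by (subst nn_integral_completion) (simp add: indicator_def)
      also have "\<dots> = emeasure (?M y) (coord X u -` B u \<inter> translate X u -` cylinder T' B')"
        using IH[of "coord X u -` B u" u y] coordB[of 0] by (simp add: \<psi>_def)
      also have "coord X u -` B u \<inter> translate X u -` cylinder T' B' = cylinder T B"
        using split by auto
      also have "emeasure (?M y) (cylinder T B) = emeasure (law X y) (cylinder T B)"
      proof -
        have "cylinder T B \<in> sets (law X y)"
          unfolding sets_law by (rule cylinder_in) (rule less.prems)+
        then show ?thesis by simp
      qed
      finally show ?thesis .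
    qed
    have H1: "H \<inter> coord X (t + u) -` B u \<in> sets (completed_filtration X (t + u))"
      using less.prems(3) completed_filtration_mono[of t "t + u"] coordB[of t] by auto
    have "H \<inter> translate X t -` cylinder T B =
        (H \<inter> coord X (t + u) -` B u) \<inter> translate X (t + u) -` cylinder T' B'"
      by (auto simp: split transl translate add.commute[of u t])
    then have "emeasure (?M x) (H \<inter> translate X t -` cylinder T B) =
        (\<integral>\<^sup>+\<omega>\<in>H \<inter> coord X (t + u) -` B u. \<psi> (coord X (t + u) \<omega>) \<partial>?M x)"
      using IH[OF H1, of x] by (simp add: \<psi>_def)
    also have "\<dots> = (\<integral>\<^sup>+\<omega>\<in>H. ?g (coord X (t + u) \<omega>) \<partial>?M x)"
      by (rule nn_integral_cong) (auto split: split_indicator)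
    also have "\<dots> = (\<integral>\<^sup>+\<omega>\<in>H. (\<integral>\<^sup>+\<omega>'. ?g (coord X u \<omega>') \<partial>law X (coord X t \<omega>)) \<partial>?M x)"
      by (rule markov_one_fun[OF less.prems(3) g])
    finally show ?thesis by (simp add: inner)
  qed
qed

lemma sets_natural_filtration_cylinder:
  "sets (natural_filtration X \<infinity>) =
    sigma_sets UNIV {cylinder T B | T B. finite T \<and> (\<forall>s. B s \<in> sets borel_cemetery)}" (is "_ = sigma_sets UNIV ?C")
proof
  show "sets (natural_filtration X \<infinity>) \<subseteq> sigma_sets UNIV ?C"
    unfolding sets_natural_filtration
  proof (rule sigma_sets_mono', safe)
    fix s B assume "(B :: 'e option set) \<in> sets borel_cemetery"
    moreover have "coord X s -` B = cylinder {s} (\<lambda>_. B)" by (auto simp: cylinder_def)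
    ultimately show "\<exists>T Ba. coord X s -` B = cylinder T Ba \<and> finite T \<and> (\<forall>s. Ba s \<in> sets borel_cemetery)"
      by (intro exI[of _ "{s}"] exI[of _ "\<lambda>_. B"]) auto
  qed
  have "sigma_sets (space (natural_filtration X \<infinity>)) ?C \<subseteq> sets (natural_filtration X \<infinity>)"
    using cylinder_in by (intro sets.sigma_sets_subset) auto
  then show "sigma_sets UNIV ?C \<subseteq> sets (natural_filtration X \<infinity>)" by simp
qed

lemma Int_stable_cylinder:
  "Int_stable {cylinder T B | T B. finite T \<and> (\<forall>s. B s \<in> sets borel_cemetery)}"
proof (rule Int_stableI, safe)
  fix T1 T2 :: "ennreal set" and B1 B2 :: "ennreal \<Rightarrow> 'e option set"
  assume *: "finite T1" "finite T2" "\<forall>s. B1 s \<in> sets borel_cemetery" "\<forall>s. B2 s \<in> sets borel_cemetery"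
  \<comment> \<open>A time missing from one of the two index sets imposes no condition there, so
    that factor is \<open>UNIV\<close>.\<close>
  let ?B = "\<lambda>s. (if s \<in> T1 then B1 s else UNIV) \<inter> (if s \<in> T2 then B2 s else UNIV)"
  have "UNIV \<in> sets (borel_cemetery :: 'e option measure)"
    using sets.top[of "borel_cemetery :: 'e option measure"] by simp
  then show "\<exists>T B. cylinder T1 B1 \<inter> cylinder T2 B2 = cylinder T B \<and> finite T \<and> (\<forall>s. B s \<in> sets borel_cemetery)"
    using * by (intro exI[of _ "T1 \<union> T2"] exI[of _ ?B]) (auto simp: cylinder_def split: if_splits)
qed

text \<open>Both sides are finite measures in \<open>\<Gamma>\<close>: the image under the shift of
  the path law restricted to \<open>H\<close>, and the mixture of the laws over the position at time
  \<open>t\<close> on \<open>H\<close>. They agree on cylinders, an intersection-stable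
  generator.\<close>

lemma markov_set:
  assumes \<Gamma>: "\<Gamma> \<in> sets (natural_filtration X \<infinity>)" and H: "H \<in> sets (completed_filtration X t)"
  shows "emeasure (completion (law X x)) (H \<inter> translate X t -` \<Gamma>) =
    (\<integral>\<^sup>+\<omega>\<in>H. emeasure (law X (coord X t \<omega>)) \<Gamma> \<partial>completion (law X x))"
proof -
  let ?M = "completion (law X x)"
  let ?C = "{cylinder T B | T B. finite T \<and> (\<forall>s. B s \<in> sets borel_cemetery)}"
  have HM [measurable]: "H \<in> sets ?M"
    using H completed_subset_completion[OF return_in, of t x] by (auto simp: law_from_return)
  have C [measurable]: "coord X r \<in> ?M \<rightarrow>\<^sub>M borel_cemetery" for r
    using measurable_coord[of r \<infinity> X] by (intro measurable_completion) (simp cong: measurable_cong_sets)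
  have tr: "translate X t \<in> ?M \<rightarrow>\<^sub>M natural_filtration X \<infinity>"
    using measurable_translate by (intro measurable_completion) (simp cong: measurable_cong_sets)
  define N1 where "N1 = distr (density ?M (indicator H)) (natural_filtration X \<infinity>) (translate X t)"
  define N2 where "N2 = distr (density ?M (indicator H)) borel_cemetery (coord X t) \<bind> law X"
  have tr': "translate X t \<in> density ?M (indicator H) \<rightarrow>\<^sub>M natural_filtration X \<infinity>"
    and C': "coord X t \<in> density ?M (indicator H) \<rightarrow>\<^sub>M borel_cemetery"
    using tr C by auto
  have k: "law X \<in> distr (density ?M (indicator H)) borel_cemetery (coord X t) \<rightarrow>\<^sub>M subprob_algebra (natural_filtration X \<infinity>)"
    using measurable_law by simp
  have N1: "emeasure N1 \<Gamma> = emeasure ?M (H \<inter> translate X t -` \<Gamma>)" if "\<Gamma> \<in> sets (natural_filtration X \<infinity>)" for \<Gamma>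
  proof -
    have m: "translate X t -` \<Gamma> \<in> sets ?M" using measurable_sets[OF tr that] by simp
    have "emeasure N1 \<Gamma> = emeasure (density ?M (indicator H)) (translate X t -` \<Gamma>)"
      unfolding N1_def using that by (subst emeasure_distr[OF tr']) auto
    also have "\<dots> = (\<integral>\<^sup>+\<omega>. indicator H \<omega> * indicator (translate X t -` \<Gamma>) \<omega> \<partial>?M)"
      using m by (intro emeasure_density) auto
    also have "\<dots> = (\<integral>\<^sup>+\<omega>. indicator (H \<inter> translate X t -` \<Gamma>) \<omega> \<partial>?M)"
      by (simp only: indicator_inter_arith)
    also have "\<dots> = emeasure ?M (H \<inter> translate X t -` \<Gamma>)"
      using m by (intro nn_integral_indicator) auto
    finally show ?thesis .
  qed
  have e [measurable]: "(\<lambda>y. emeasure (law X y) \<Gamma>) \<in> borel_measurable borel_cemetery"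
    if "\<Gamma> \<in> sets (natural_filtration X \<infinity>)" for \<Gamma>
    by (rule measurable_compose[OF measurable_law measurable_emeasure_subprob_algebra[OF that]])
  have N2: "emeasure N2 \<Gamma> = (\<integral>\<^sup>+\<omega>\<in>H. emeasure (law X (coord X t \<omega>)) \<Gamma> \<partial>?M)"
    if "\<Gamma> \<in> sets (natural_filtration X \<infinity>)" for \<Gamma>
  proof -
    note [measurable] = e[OF that]
    have "emeasure N2 \<Gamma> = (\<integral>\<^sup>+y. emeasure (law X y) \<Gamma> \<partial>distr (density ?M (indicator H)) borel_cemetery (coord X t))"
      unfolding N2_def by (rule emeasure_bind[OF _ k that]) simp
    also have "\<dots> = (\<integral>\<^sup>+\<omega>. emeasure (law X (coord X t \<omega>)) \<Gamma> \<partial>density ?M (indicator H))"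
      by (rule nn_integral_distr[OF C']) simp
    also have "\<dots> = (\<integral>\<^sup>+\<omega>\<in>H. emeasure (law X (coord X t \<omega>)) \<Gamma> \<partial>?M)"
      by (subst nn_integral_density) (auto simp: mult.commute)
    finally show ?thesis .
  qed
  have "N1 = N2"
  proof (rule measure_eqI_generator_eq[OF Int_stable_cylinder, of UNIV _ _ "\<lambda>_. UNIV"])
    fix K assume "K \<in> ?C"
    then obtain T B where K: "K = cylinder T B" "finite T" "\<And>s. B s \<in> sets borel_cemetery" by blast
    then have "K \<in> sets (natural_filtration X \<infinity>)" using cylinder_in by simp
    then show "emeasure N1 K = emeasure N2 K"
      using markov_cylinder[OF K(2,3) H] by (simp add: N1 N2 K(1))
  next
    show "sets N1 = sigma_sets UNIV ?C"
      unfolding N1_def using sets_natural_filtration_cylinder by simp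
    show "sets N2 = sigma_sets UNIV ?C"
      unfolding N2_def by (subst sets_bind[where N="natural_filtration X \<infinity>"]) (use sets_natural_filtration_cylinder in auto)
    show "range (\<lambda>_::nat. UNIV) \<subseteq> ?C"
      by (auto simp: cylinder_def intro!: exI[of _ "{}"] exI[of _ "\<lambda>_. {}"])
    have "UNIV \<in> sets (natural_filtration X \<infinity>)" using sets.top[of "natural_filtration X \<infinity>"] by simp
    then have "emeasure N1 UNIV = emeasure ?M H" using N1 by simp
    also have "\<dots> \<le> emeasure ?M (space ?M)" by (rule emeasure_space)
    also have "\<dots> = 1" by (rule prob_space.emeasure_space_1[OF prob_space_completion_law])
    finally show "emeasure N1 UNIV \<noteq> \<infinity>" for i::nat by (auto simp: top_unique)
  qed auto
  then show ?thesis using N1[OF \<Gamma>] N2[OF \<Gamma>] by simp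
qed

lemma expectation_translate:
  assumes F: "F \<in> borel_measurable (natural_filtration X \<infinity>)"
    and H: "H \<in> sets (completed_filtration X t)"
  shows "(\<integral>\<^sup>+\<omega>\<in>H. F (translate X t \<omega>) \<partial>completion (law X x)) =
    (\<integral>\<^sup>+\<omega>\<in>H. (\<integral>\<^sup>+\<omega>'. F \<omega>' \<partial>law X (coord X t \<omega>)) \<partial>completion (law X x))"
proof -
  let ?M = "completion (law X x)"
  have [measurable]: "H \<in> sets ?M"
    using H completed_subset_completion[OF return_in, of t x] by (auto simp: law_from_return)
  have C [measurable]: "coord X t \<in> ?M \<rightarrow>\<^sub>M borel_cemetery"
    using measurable_coord[of t \<infinity> X] by (intro measurable_completion) (simp cong: measurable_cong_sets)
  have tr [measurable]: "translate X t \<in> ?M \<rightarrow>\<^sub>M natural_filtration X \<infinity>"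
    using measurable_translate by (intro measurable_completion) (simp cong: measurable_cong_sets)
  have e: "(\<lambda>y. \<integral>\<^sup>+\<omega>'. h \<omega>' \<partial>law X y) \<in> borel_measurable borel_cemetery"
    if "h \<in> borel_measurable (natural_filtration X \<infinity>)" for h :: "'w \<Rightarrow> ennreal"
    by (rule measurable_compose[OF measurable_law nn_integral_measurable_subprob_algebra[OF that]])
  from F show ?thesis
  proof (induction rule: borel_measurable_induct)
    case (cong f g)
    then have "f = g" by (auto simp: fun_eq_iff)
    with cong show ?case by simp
  next
    case (set \<Gamma>)
    have "translate X t -` \<Gamma> \<in> sets ?M" using measurable_sets[OF tr set] by simp
    then have m: "H \<inter> translate X t -` \<Gamma> \<in> sets ?M" by simp
    have "(\<integral>\<^sup>+\<omega>\<in>H. indicator \<Gamma> (translate X t \<omega>) \<partial>?M) = (\<integral>\<^sup>+\<omega>. indicator (H \<inter> translate X t -` \<Gamma>) \<omega> \<partial>?M)"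
      by (rule nn_integral_cong) (auto split: split_indicator)
    also have "\<dots> = emeasure ?M (H \<inter> translate X t -` \<Gamma>)"
      using m by (rule nn_integral_indicator)
    also have "\<dots> = (\<integral>\<^sup>+\<omega>\<in>H. emeasure (law X (coord X t \<omega>)) \<Gamma> \<partial>?M)"
      by (rule markov_set[OF set H])
    finally show ?case using set by simp
  next
    case (mult u c)
    note [measurable] = mult.hyps(2) e[OF mult.hyps(2)]
    show ?case using mult by (simp add: nn_integral_cmult mult.assoc)
  next
    case (add u v)
    note [measurable] = add.hyps(1,3) e[OF add.hyps(1)] e[OF add.hyps(3)]
    show ?case using add by (simp add: nn_integral_add distrib_right)
  next
    case (seq U)
    note [measurable] = seq(1) e[OF seq(1)]
    have inc: "incseq (\<lambda>i y. \<integral>\<^sup>+\<omega>'. U i \<omega>' \<partial>law X y)"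
      using seq(3) by (auto simp: incseq_def le_fun_def intro!: nn_integral_mono)
    have "(\<integral>\<^sup>+\<omega>\<in>H. (SUP i. U i) (translate X t \<omega>) \<partial>?M) = (\<integral>\<^sup>+\<omega>. (SUP i. U i (translate X t \<omega>) * indicator H \<omega>) \<partial>?M)"
      by (simp add: SUP_mult_right_ennreal image_comp)
    also have "\<dots> = (SUP i. \<integral>\<^sup>+\<omega>. U i (translate X t \<omega>) * indicator H \<omega> \<partial>?M)"
      using seq(3) by (intro nn_integral_monotone_convergence_SUP) (auto simp: incseq_def le_fun_def intro!: mult_right_mono)
    also have "\<dots> = (SUP i. \<integral>\<^sup>+\<omega>\<in>H. (\<integral>\<^sup>+\<omega>'. U i \<omega>' \<partial>law X (coord X t \<omega>)) \<partial>?M)"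
      using seq by simp
    also have "\<dots> = (\<integral>\<^sup>+\<omega>. (SUP i. (\<integral>\<^sup>+\<omega>'. U i \<omega>' \<partial>law X (coord X t \<omega>)) * indicator H \<omega>) \<partial>?M)"
      using inc by (intro nn_integral_monotone_convergence_SUP[symmetric]) (auto simp: incseq_def le_fun_def intro!: mult_right_mono)
    also have "\<dots> = (\<integral>\<^sup>+\<omega>\<in>H. (\<integral>\<^sup>+\<omega>'. (SUP i. U i) \<omega>' \<partial>law X (coord X t \<omega>)) \<partial>?M)"
      using seq(3)
      by (intro nn_integral_cong)
         (simp add: SUP_mult_right_ennreal[symmetric] image_comp nn_integral_monotone_convergence_SUP incseq_def le_fun_def)
    finally show ?case .
  qed
qed

text \<open>The version \<open>F'\<close> has to be chosen with respect to the law of \<open>X\<^sub>t\<close> as initial distribution.\<close>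

lemma translate_version:
  fixes F :: "'w \<Rightarrow> ennreal"
  assumes F: "F \<in> borel_measurable (completed_filtration X \<infinity>)"
  obtains F' where "F' \<in> borel_measurable (natural_filtration X \<infinity>)"
    "AE \<omega> in law X x. F (translate X t \<omega>) = F' (translate X t \<omega>)"
    "AE \<omega> in law X x. (\<integral>\<^sup>+\<omega>'. F \<omega>' \<partial>law X (coord X t \<omega>)) = (\<integral>\<^sup>+\<omega>'. F' \<omega>' \<partial>law X (coord X t \<omega>))"
    "(\<lambda>y. \<integral>\<^sup>+\<omega>. F' \<omega> \<partial>law X y) \<in> borel_measurable borel_cemetery"
proof -
  have C: "coord X t \<in> law X x \<rightarrow>\<^sub>M borel_cemetery"
    using measurable_coord[of t \<infinity> X] by (simp cong: measurable_cong_sets)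
  define \<mu> where "\<mu> = distr (law X x) borel_cemetery (coord X t)"
  have \<mu>: "\<mu> \<in> space (prob_algebra borel_cemetery)"
    unfolding \<mu>_def by (auto simp: space_prob_algebra intro!: prob_space.prob_space_distr[OF prob_space_law] C)
  obtain F' where F': "F' \<in> borel_measurable (natural_filtration X \<infinity>)"
    "AE \<omega> in law_from X \<mu>. F \<omega> = F' \<omega>"
    "AE x in \<mu>. (\<integral>\<^sup>+\<omega>. F \<omega> \<partial>law X x) = (\<integral>\<^sup>+\<omega>. F' \<omega> \<partial>law X x)"
    "(\<lambda>x. \<integral>\<^sup>+\<omega>. F' \<omega> \<partial>law X x) \<in> borel_measurable borel_cemetery"
    by (rule measurable_expectation_version[OF F \<mu>])
  from F'(2) obtain N where N: "N \<in> null_sets (law_from X \<mu>)" "{\<omega>. F \<omega> \<noteq> F' \<omega>} \<subseteq> N"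
    unfolding eventually_ae_filter by (auto simp: space_law_from[OF \<mu>])
  have NS: "N \<in> sets (natural_filtration X \<infinity>)"
    using null_setsD2[OF N(1)] by (simp only: sets_law_from[OF \<mu>])
  have U: "UNIV \<in> sets (completed_filtration X t)"
    using sets.top[of "completed_filtration X t"] by simp
  have tN: "translate X t -` N \<in> sets (law X x)"
    using measurable_sets[OF measurable_translate NS, of t] by simp
  have eN: "(\<lambda>y. emeasure (law X y) N) \<in> borel_measurable borel_cemetery"
    by (rule measurable_compose[OF measurable_law measurable_emeasure_subprob_algebra[OF NS]])
  \<comment> \<open>By the Markov property the shifted path has law \<open>law_from X \<mu>\<close>,
    where \<open>\<mu>\<close> is the law of the position at time \<open>t\<close>; hence the
    exceptional set \<open>N\<close> stays null after the shift.\<close>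
  have "emeasure (law X x) (translate X t -` N) = (\<integral>\<^sup>+\<omega>. emeasure (law X (coord X t \<omega>)) N \<partial>law X x)"
    using markov_set[OF NS U, of x] emeasure_completion[of "translate X t -` N" "law X x"] tN
    by (simp add: nn_integral_completion)
  also have "\<dots> = (\<integral>\<^sup>+y. emeasure (law X y) N \<partial>\<mu>)"
    unfolding \<mu>_def by (rule nn_integral_distr[symmetric]) (use C eN in auto)
  also have "\<dots> = emeasure (law_from X \<mu>) N"
    unfolding law_from_def by (rule emeasure_bind_prob_algebra[OF \<mu> kernel NS, symmetric])
  also have "\<dots> = 0" using null_setsD1[OF N(1)] .
  finally have "translate X t -` N \<in> null_sets (law X x)" using tN by auto
  then have "AE \<omega> in law X x. F (translate X t \<omega>) = F' (translate X t \<omega>)"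
    by (rule AE_I') (use N(2) in auto)
  moreover have "AE \<omega> in law X x. (\<integral>\<^sup>+\<omega>'. F \<omega>' \<partial>law X (coord X t \<omega>)) = (\<integral>\<^sup>+\<omega>'. F' \<omega>' \<partial>law X (coord X t \<omega>))"
  proof -
    from F'(3) obtain K where K: "K \<in> null_sets \<mu>" "{y. (\<integral>\<^sup>+\<omega>. F \<omega> \<partial>law X y) \<noteq> (\<integral>\<^sup>+\<omega>. F' \<omega> \<partial>law X y)} \<subseteq> K"
      unfolding eventually_ae_filter \<mu>_def by auto
    have KS: "K \<in> sets borel_cemetery" using null_setsD2[OF K(1)] by (simp add: \<mu>_def)
    have "coord X t -` K \<in> null_sets (law X x)"
      using null_setsD1[OF K(1)] measurable_sets[OF C KS] emeasure_distr[OF C KS] by (auto simp: \<mu>_def)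
    then show ?thesis by (rule AE_I') (use K(2) in auto)
  qed
  ultimately show thesis using that F'(1,4) by blast
qed

text \<open>Integrals under \<open>law X x\<close> agree with those under its completion. The
  functional induction over \<open>Y\<close> therefore runs under the completion, where adapted
  functions are measurable, with \<open>F\<close> replaced by the natural version belonging to
  \<open>x\<close> and \<open>t\<close>.\<close>

theorem markov_property:
  fixes Y F :: "'w \<Rightarrow> ennreal"
  assumes F: "F \<in> borel_measurable (completed_filtration X \<infinity>)"
    and Y: "Y \<in> borel_measurable (completed_filtration X t)"
  shows "(\<integral>\<^sup>+\<omega>. Y \<omega> * F (translate X t \<omega>) \<partial>law X x) =
    (\<integral>\<^sup>+\<omega>. Y \<omega> * (\<integral>\<^sup>+\<omega>'. F \<omega>' \<partial>law X (coord X t \<omega>)) \<partial>law X x)"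
proof -
  obtain F' where F': "F' \<in> borel_measurable (natural_filtration X \<infinity>)"
    "AE \<omega> in law X x. F (translate X t \<omega>) = F' (translate X t \<omega>)"
    "AE \<omega> in law X x. (\<integral>\<^sup>+\<omega>'. F \<omega>' \<partial>law X (coord X t \<omega>)) = (\<integral>\<^sup>+\<omega>'. F' \<omega>' \<partial>law X (coord X t \<omega>))"
    "(\<lambda>y. \<integral>\<^sup>+\<omega>. F' \<omega> \<partial>law X y) \<in> borel_measurable borel_cemetery"
    by (rule translate_version[OF F])
  let ?M = "completion (law X x)"
  have C [measurable]: "coord X t \<in> ?M \<rightarrow>\<^sub>M borel_cemetery"
    using measurable_coord[of t \<infinity> X] by (intro measurable_completion) (simp cong: measurable_cong_sets)
  have tr [measurable]: "translate X t \<in> ?M \<rightarrow>\<^sub>M natural_filtration X \<infinity>"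
    using measurable_translate by (intro measurable_completion) (simp cong: measurable_cong_sets)
  note [measurable] = F'(1,4)
  have *: "(\<integral>\<^sup>+\<omega>. Y \<omega> * F' (translate X t \<omega>) \<partial>?M) =
      (\<integral>\<^sup>+\<omega>. Y \<omega> * (\<integral>\<^sup>+\<omega>'. F' \<omega>' \<partial>law X (coord X t \<omega>)) \<partial>?M)"
    using Y
  proof (induction rule: borel_measurable_induct)
    case (cong f g)
    then have "f = g" by (auto simp: fun_eq_iff)
    with cong show ?case by simp
  next
    case (set H)
    then show ?case using expectation_translate[OF F'(1) set, of x] by (simp add: mult.commute)
  next
    case (mult u c)
    note [measurable] = measurable_completion_law[OF mult.hyps(2), of x]
    show ?case using mult by (simp add: nn_integral_cmult mult.assoc)
  next
    case (add u v)
    note [measurable] = measurable_completion_law[OF add.hyps(1), of x] measurable_completion_law[OF add.hyps(3), of x]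
    show ?case using add by (simp add: nn_integral_add distrib_right)
  next
    case (seq U)
    note [measurable] = measurable_completion_law[OF seq(1), where x=x]
    have eq: "(\<integral>\<^sup>+\<omega>. (SUP i. U i) \<omega> * g \<omega> \<partial>?M) = (SUP i. \<integral>\<^sup>+\<omega>. U i \<omega> * g \<omega> \<partial>?M)"
      if [measurable]: "g \<in> borel_measurable ?M" for g
    proof -
      have "(\<integral>\<^sup>+\<omega>. (SUP i. U i) \<omega> * g \<omega> \<partial>?M) = (\<integral>\<^sup>+\<omega>. (SUP i. U i \<omega> * g \<omega>) \<partial>?M)"
        by (simp add: SUP_mult_right_ennreal image_comp)
      also have "\<dots> = (SUP i. \<integral>\<^sup>+\<omega>. U i \<omega> * g \<omega> \<partial>?M)"
        using seq(3) by (intro nn_integral_monotone_convergence_SUP) (auto simp: incseq_def le_fun_def intro!: mult_right_mono)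
      finally show ?thesis .
    qed
    show ?case using seq by (subst (1 2) eq) auto
  qed
  have "(\<integral>\<^sup>+\<omega>. Y \<omega> * F (translate X t \<omega>) \<partial>law X x) = (\<integral>\<^sup>+\<omega>. Y \<omega> * F' (translate X t \<omega>) \<partial>law X x)"
    using F'(2) by (intro nn_integral_cong_AE) auto
  also have "\<dots> = (\<integral>\<^sup>+\<omega>. Y \<omega> * (\<integral>\<^sup>+\<omega>'. F' \<omega>' \<partial>law X (coord X t \<omega>)) \<partial>law X x)"
    using * by (simp add: nn_integral_completion)
  also have "\<dots> = (\<integral>\<^sup>+\<omega>. Y \<omega> * (\<integral>\<^sup>+\<omega>'. F \<omega>' \<partial>law X (coord X t \<omega>)) \<partial>law X x)"
    using F'(3) by (intro nn_integral_cong_AE) auto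
  finally show ?thesis .
qed

text \<open>The shift is measurable for the natural sigma-algebras only. For a completed function it
  is composed with the natural version instead, and the difference is absorbed by the
  completion.\<close>

lemma measurable_translate_completed:
  fixes F :: "'w \<Rightarrow> ennreal"
  assumes F: "F \<in> borel_measurable (completed_filtration X \<infinity>)"
  shows "(\<lambda>\<omega>. F (translate X t \<omega>)) \<in> borel_measurable (completion (law X x))"
    and "(\<lambda>\<omega>. \<integral>\<^sup>+\<omega>'. F \<omega>' \<partial>law X (coord X t \<omega>)) \<in> borel_measurable (completion (law X x))"
proof -
  obtain F' where F': "F' \<in> borel_measurable (natural_filtration X \<infinity>)"
    "AE \<omega> in law X x. F (translate X t \<omega>) = F' (translate X t \<omega>)"
    "AE \<omega> in law X x. (\<integral>\<^sup>+\<omega>'. F \<omega>' \<partial>law X (coord X t \<omega>)) = (\<integral>\<^sup>+\<omega>'. F' \<omega>' \<partial>law X (coord X t \<omega>))"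
    "(\<lambda>y. \<integral>\<^sup>+\<omega>. F' \<omega> \<partial>law X y) \<in> borel_measurable borel_cemetery"
    by (rule translate_version[OF F])
  let ?M = "completion (law X x)"
  have C [measurable]: "coord X t \<in> ?M \<rightarrow>\<^sub>M borel_cemetery"
    using measurable_coord[of t \<infinity> X] by (intro measurable_completion) (simp cong: measurable_cong_sets)
  have tr [measurable]: "translate X t \<in> ?M \<rightarrow>\<^sub>M natural_filtration X \<infinity>"
    using measurable_translate by (intro measurable_completion) (simp cong: measurable_cong_sets)
  note [measurable] = F'(1,4)
  have "(\<lambda>\<omega>. F' (translate X t \<omega>)) \<in> borel_measurable ?M" by measurable
  then show "(\<lambda>\<omega>. F (translate X t \<omega>)) \<in> borel_measurable ?M"
    by (rule measurable_completion_AE) (use F'(2) in simp_all)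
  have "(\<lambda>\<omega>. \<integral>\<^sup>+\<omega>'. F' \<omega>' \<partial>law X (coord X t \<omega>)) \<in> borel_measurable ?M" by measurable
  then show "(\<lambda>\<omega>. \<integral>\<^sup>+\<omega>'. F \<omega>' \<partial>law X (coord X t \<omega>)) \<in> borel_measurable ?M"
    by (rule measurable_completion_AE) (use F'(3) in simp_all)
qed

end

section \<open>Continuous additive functionals with equal potentials\<close>

text \<open>Continuity is required only up to times at which the value is finite, since a functional
  may become infinite at the lifetime. The path properties hold almost surely from every starting
  point, the cemetery included.\<close>

definition continuous_additive ::
    "('w, 'e::topological_space) markov_process \<Rightarrow> (real \<Rightarrow> 'w \<Rightarrow> ennreal) \<Rightarrow> bool" where
  "continuous_additive X J \<longleftrightarrow>
     (\<forall>t\<ge>0. J t \<in> borel_measurable (completed_filtration X (ennreal t))) \<and>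
     (\<forall>x. AE \<omega> in law X x. J 0 \<omega> = 0 \<and>
        (\<forall>s\<ge>0. \<forall>t\<ge>0. J (s + t) \<omega> = J s \<omega> + J t (translate X (ennreal s) \<omega>)) \<and>
        (\<forall>t\<ge>0. J t \<omega> < \<infinity> \<longrightarrow> continuous_on {0..t} (\<lambda>s. enn2real (J s \<omega>))))"

text \<open>The same path properties up to a horizon with finite value, so that estimates on a
  single path can be made with real numbers.\<close>

definition finite_additive_path ::
    "('w, 'e) markov_process \<Rightarrow> (real \<Rightarrow> 'w \<Rightarrow> ennreal) \<Rightarrow> real \<Rightarrow> 'w \<Rightarrow> bool" where
  "finite_additive_path X J T \<omega> \<longleftrightarrow> J T \<omega> < \<infinity> \<and> J 0 \<omega> = 0 \<and>
     (\<forall>s\<ge>0. \<forall>t\<ge>0. J (s + t) \<omega> = J s \<omega> + J t (translate X (ennreal s) \<omega>)) \<and>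
     continuous_on {0..T} (\<lambda>s. enn2real (J s \<omega>))"

section \<open>Discretisation on uniform grids\<close>

definition grid :: "real \<Rightarrow> nat \<Rightarrow> nat \<Rightarrow> real" where
  "grid T n i = real i * T / real n"

lemma grid_0 [simp]: "grid T n 0 = 0" and grid_n: "0 < n \<Longrightarrow> grid T n n = T"
  by (auto simp: grid_def)

lemma grid_mono: "0 \<le> T \<Longrightarrow> i \<le> j \<Longrightarrow> grid T n i \<le> grid T n j"
  unfolding grid_def by (intro divide_right_mono mult_right_mono) auto

lemma grid_nonneg: "0 \<le> T \<Longrightarrow> 0 \<le> grid T n i"
  by (simp add: grid_def)

lemma grid_le: "0 \<le> T \<Longrightarrow> i \<le> n \<Longrightarrow> grid T n i \<le> T"
  using grid_mono[of T i n n] by (cases "n = 0") (auto simp: grid_n)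

lemma grid_Suc: "grid T n (Suc i) - grid T n i = T / real n"
  by (simp add: grid_def field_simps add_divide_distrib[symmetric] diff_divide_distrib[symmetric])

text \<open>Termwise, the left side is the difference of consecutive products of the remaining
  increments of \<open>a\<close> and \<open>b\<close>, and these telescope. The third sum is the
  discrete covariation.\<close>

lemma sum_by_parts:
  fixes a b :: "nat \<Rightarrow> real"
  shows "(\<Sum>i<n. (a (Suc i) - a i) * (b n - b (Suc i))) + (\<Sum>i<n. (b (Suc i) - b i) * (a n - a (Suc i))) +
    (\<Sum>i<n. (a (Suc i) - a i) * (b (Suc i) - b i)) = (a n - a 0) * (b n - b 0)"
proof -
  have "(\<Sum>i<n. (a (Suc i) - a i) * (b n - b (Suc i))) + (\<Sum>i<n. (b (Suc i) - b i) * (a n - a (Suc i))) +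
    (\<Sum>i<n. (a (Suc i) - a i) * (b (Suc i) - b i)) =
    (\<Sum>i<n. (a n - a i) * (b n - b i) - (a n - a (Suc i)) * (b n - b (Suc i)))"
    by (simp add: sum.distrib[symmetric] algebra_simps)
  also have "\<dots> = (a n - a 0) * (b n - b 0)"
    by (subst sum_lessThan_telescope') simp
  finally show ?thesis .
qed

text \<open>For an increasing function the sum of squared increments is at most the largest
  increment times the total increase, and uniform continuity makes the largest increment
  small.\<close>

lemma quadratic_variation_tendsto_zero:
  fixes j :: "real \<Rightarrow> real"
  assumes T: "0 \<le> T" and cont: "continuous_on {0..T} j"
    and mono: "\<And>s t. 0 \<le> s \<Longrightarrow> s \<le> t \<Longrightarrow> t \<le> T \<Longrightarrow> j s \<le> j t"
  shows "(\<lambda>n. \<Sum>i<n. (j (grid T n (Suc i)) - j (grid T n i))\<^sup>2) \<longlonglongrightarrow> 0"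
proof (rule LIMSEQ_I)
  fix r :: real assume r: "0 < r"
  \<comment> \<open>The \<open>1\<close> keeps the denominator positive for a constant function, the
    \<open>2\<close> leaves room for a strict inequality.\<close>
  define \<epsilon> where "\<epsilon> = r / (2 * (j T - j 0 + 1))"
  have jT: "j 0 \<le> j T" using mono[of 0 T] T by simp
  then have \<epsilon>: "0 < \<epsilon>" using r by (simp add: \<epsilon>_def)
  have "uniformly_continuous_on {0..T} j"
    using cont by (rule compact_uniformly_continuous) simp
  then obtain d where d: "0 < d" "\<And>s t. s \<in> {0..T} \<Longrightarrow> t \<in> {0..T} \<Longrightarrow> dist t s < d \<Longrightarrow> dist (j t) (j s) < \<epsilon>"
    using \<epsilon> unfolding uniformly_continuous_on_def by metis
  obtain N :: nat where N: "T / d < real N" using reals_Archimedean2 by blast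
  show "\<exists>no. \<forall>n\<ge>no. norm ((\<Sum>i<n. (j (grid T n (Suc i)) - j (grid T n i))\<^sup>2) - 0) < r"
  proof (intro exI allI impI)
    fix n assume n: "max 1 N \<le> n"
    then have n0: "0 < n" and nN: "T / d < real n" using N by auto
    have Tn: "T / real n < d" using nN n0 d(1) by (simp add: field_simps)
    have "(\<Sum>i<n. (j (grid T n (Suc i)) - j (grid T n i))\<^sup>2) \<le>
        (\<Sum>i<n. \<epsilon> * (j (grid T n (Suc i)) - j (grid T n i)))"
    proof (rule sum_mono)
      fix i assume i: "i \<in> {..<n}"
      have g: "grid T n i \<in> {0..T}" "grid T n (Suc i) \<in> {0..T}" "grid T n i \<le> grid T n (Suc i)"
        using i T by (auto intro: grid_nonneg grid_le grid_mono)
      have "dist (grid T n (Suc i)) (grid T n i) < d"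
        using Tn T unfolding dist_real_def grid_Suc by simp
      then have "\<bar>j (grid T n (Suc i)) - j (grid T n i)\<bar> < \<epsilon>"
        using d(2)[OF g(1,2)] by (simp add: dist_real_def)
      moreover have "j (grid T n i) \<le> j (grid T n (Suc i))" using g by (auto intro!: mono)
      ultimately show "(j (grid T n (Suc i)) - j (grid T n i))\<^sup>2 \<le> \<epsilon> * (j (grid T n (Suc i)) - j (grid T n i))"
        unfolding power2_eq_square by (intro mult_right_mono) auto
    qed
    also have "\<dots> = \<epsilon> * (j T - j 0)"
      using n0 by (simp add: sum_distrib_left[symmetric] sum_lessThan_telescope[of "\<lambda>i. j (grid T n i)"] grid_n)
    also have "\<dots> \<le> \<epsilon> * (j T - j 0 + 1)" using \<epsilon> by (intro mult_left_mono) auto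
    also have "\<dots> = r / 2" using jT by (simp add: \<epsilon>_def field_simps)
    also have "\<dots> < r" using r by simp
    finally show "norm ((\<Sum>i<n. (j (grid T n (Suc i)) - j (grid T n i))\<^sup>2) - 0) < r"
      by (simp add: sum_nonneg)
  qed
qed

lemma AE_eq_of_nn_integral_le:
  fixes f g :: "'a \<Rightarrow> ennreal"
  assumes [measurable]: "f \<in> borel_measurable M" "g \<in> borel_measurable M"
    and le: "AE x in M. f x \<le> g x" and int: "(\<integral>\<^sup>+x. g x \<partial>M) \<le> (\<integral>\<^sup>+x. f x \<partial>M)" "(\<integral>\<^sup>+x. g x \<partial>M) < \<infinity>"
  shows "AE x in M. f x = g x"
proof -
  have fin: "(\<integral>\<^sup>+x. f x \<partial>M) < \<infinity>"
    using nn_integral_mono_AE[OF le] int(2) by (rule le_less_trans)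
  have "(\<integral>\<^sup>+x. g x - f x \<partial>M) = (\<integral>\<^sup>+x. g x \<partial>M) - (\<integral>\<^sup>+x. f x \<partial>M)"
    using fin le by (intro nn_integral_diff) auto
  also have "\<dots> = 0" using int by (simp add: diff_eq_0_iff_ennreal)
  finally have "(\<integral>\<^sup>+x. g x - f x \<partial>M) = 0" .
  then have "AE x in M. g x - f x = 0" by (subst (asm) nn_integral_0_iff_AE) auto
  moreover have "AE x in M. g x \<noteq> \<infinity>" using int(2) by (intro nn_integral_noteq_infinite) auto
  ultimately show ?thesis using le
    by eventually_elim (auto simp: diff_eq_0_iff_ennreal less_top)
qed

lemma finite_additive_path_mono:
  "finite_additive_path X J T \<omega> \<Longrightarrow> 0 \<le> s \<Longrightarrow> s \<le> t \<Longrightarrow> J s \<omega> \<le> J t \<omega>"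
proof -
  assume *: "finite_additive_path X J T \<omega>" "0 \<le> s" "s \<le> t"
  then have "J (s + (t - s)) \<omega> = J s \<omega> + J (t - s) (translate X (ennreal s) \<omega>)"
    unfolding finite_additive_path_def by (metis diff_ge_0_iff_ge)
  then show "J s \<omega> \<le> J t \<omega>" by simp
qed

lemma finite_additive_path_real:
  assumes "finite_additive_path X J T \<omega>" "0 \<le> t" "t \<le> T"
  shows "J t \<omega> = ennreal (enn2real (J t \<omega>))"
proof -
  have "J T \<omega> < top" using assms(1) by (simp add: finite_additive_path_def)
  with finite_additive_path_mono[OF assms] show ?thesis
    by (auto simp: le_less_trans)
qed

lemma finite_additive_path_real_mono:
  assumes "finite_additive_path X J T \<omega>" "0 \<le> s" "s \<le> t" "t \<le> T"
  shows "enn2real (J s \<omega>) \<le> enn2real (J t \<omega>)"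
proof (rule enn2real_mono)
  show "J s \<omega> \<le> J t \<omega>" by (rule finite_additive_path_mono[OF assms(1-3)])
  have "J T \<omega> < top" using assms(1) by (simp add: finite_additive_path_def)
  then show "J t \<omega> < top" using finite_additive_path_mono[OF assms(1), of t T] assms(2-4) by (auto intro: le_less_trans)
qed

text \<open>
  Discretising \<open>J\<^sub>T K\<^sub>T = \<integral>(J\<^sub>T - J\<^sub>s) dK\<^sub>s + \<integral>(K\<^sub>T - K\<^sub>s) dJ\<^sub>s\<close>, the Markov property shows that the
  expectations of both integrals depend on \<open>J\<close> and \<open>K\<close> only through their common potential, so
  \<open>E(J\<^sub>T\<^sup>2 + K\<^sub>T\<^sup>2) \<le> 2 E(J\<^sub>T K\<^sub>T)\<close>.
\<close>

definition cross_sum ::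
    "('w, 'e) markov_process \<Rightarrow> (real \<Rightarrow> 'w \<Rightarrow> ennreal) \<Rightarrow> (real \<Rightarrow> 'w \<Rightarrow> ennreal) \<Rightarrow> real \<Rightarrow> nat \<Rightarrow> 'w \<Rightarrow> ennreal" where
  "cross_sum X J K T n \<omega> = (\<Sum>i<n. (J (grid T n (Suc i)) \<omega> - J (grid T n i) \<omega>) *
     K (T - grid T n (Suc i)) (translate X (ennreal (grid T n (Suc i))) \<omega>))"

text \<open>By additivity the shifted factor is the remaining increment of \<open>K\<close> up to
  \<open>T\<close>. The shifted form in the definition is the one to which the Markov property
  applies, the real form here is the one for summation by parts.\<close>

lemma cross_sum_path:
  fixes J K \<omega>
  defines "a \<equiv> \<lambda>t. enn2real (J t \<omega>)" and "b \<equiv> \<lambda>t. enn2real (K t \<omega>)"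
  assumes J: "finite_additive_path X J T \<omega>" and K: "finite_additive_path X K T \<omega>" and T: "0 \<le> T"
  shows "cross_sum X J K T n \<omega> =
      ennreal (\<Sum>i<n. (a (grid T n (Suc i)) - a (grid T n i)) * (b T - b (grid T n (Suc i))))"
    and "0 \<le> (\<Sum>i<n. (a (grid T n (Suc i)) - a (grid T n i)) * (b T - b (grid T n (Suc i))))"
proof -
  have nonneg: "0 \<le> (a (grid T n (Suc i)) - a (grid T n i)) * (b T - b (grid T n (Suc i)))" if i: "i < n" for i
    using i T unfolding a_def b_def
    by (intro mult_nonneg_nonneg)
       (auto intro!: finite_additive_path_real_mono[OF J] finite_additive_path_real_mono[OF K] grid_mono grid_nonneg grid_le)
  then show "0 \<le> (\<Sum>i<n. (a (grid T n (Suc i)) - a (grid T n i)) * (b T - b (grid T n (Suc i))))"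
    by (intro sum_nonneg) auto
  have "(J (grid T n (Suc i)) \<omega> - J (grid T n i) \<omega>) *
        K (T - grid T n (Suc i)) (translate X (ennreal (grid T n (Suc i))) \<omega>) =
        ennreal ((a (grid T n (Suc i)) - a (grid T n i)) * (b T - b (grid T n (Suc i))))" if i: "i < n" for i
  proof -
    let ?s = "grid T n i" and ?t = "grid T n (Suc i)"
    have st: "0 \<le> ?s" "?s \<le> ?t" "0 \<le> ?t" "?t \<le> T"
      using T i by (auto intro!: grid_mono grid_nonneg grid_le)
    have le: "a ?s \<le> a ?t" "b ?t \<le> b T"
      unfolding a_def b_def using st
      by (auto intro: finite_additive_path_real_mono[OF J] finite_additive_path_real_mono[OF K])
    have Kt: "K ?t \<omega> = ennreal (b ?t)" "K T \<omega> = ennreal (b T)"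
      unfolding b_def using finite_additive_path_real[OF K] st T by auto
    have "K (?t + (T - ?t)) \<omega> = K ?t \<omega> + K (T - ?t) (translate X (ennreal ?t) \<omega>)"
      using K st unfolding finite_additive_path_def by (metis diff_ge_0_iff_ge)
    then have "ennreal (b T) = ennreal (b ?t) + K (T - ?t) (translate X (ennreal ?t) \<omega>)"
      by (simp add: Kt)
    then have "K (T - ?t) (translate X (ennreal ?t) \<omega>) = ennreal (b T) - ennreal (b ?t)"
      by (metis ennreal_add_diff_cancel_left ennreal_neq_top infinity_ennreal_def)
    also have "\<dots> = ennreal (b T - b ?t)"
      by (rule ennreal_minus) (simp add: b_def)
    finally have 1: "K (T - ?t) (translate X (ennreal ?t) \<omega>) = ennreal (b T - b ?t)" .
    have Jt: "J ?t \<omega> = ennreal (a ?t)" "J ?s \<omega> = ennreal (a ?s)"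
      unfolding a_def using finite_additive_path_real[OF J] st T by auto
    have 2: "J ?t \<omega> - J ?s \<omega> = ennreal (a ?t - a ?s)"
      unfolding Jt by (rule ennreal_minus) (simp add: a_def)
    show ?thesis unfolding 1 2 using le by (simp add: ennreal_mult)
  qed
  then show "cross_sum X J K T n \<omega> =
      ennreal (\<Sum>i<n. (a (grid T n (Suc i)) - a (grid T n i)) * (b T - b (grid T n (Suc i))))"
    unfolding cross_sum_def using nonneg by (subst sum_ennreal[symmetric]) auto
qed

text \<open>The two cross sums miss exactly the discrete covariation of \<open>J\<close> and
  \<open>K\<close>, which is non-negative for increasing paths.\<close>

lemma cross_sum_le:
  assumes J: "finite_additive_path X J T \<omega>" and K: "finite_additive_path X K T \<omega>" and T: "0 \<le> T" and n: "0 < n"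
  shows "cross_sum X J K T n \<omega> + cross_sum X K J T n \<omega> \<le> J T \<omega> * K T \<omega>"
proof -
  let ?a = "\<lambda>i. enn2real (J (grid T n i) \<omega>)" and ?b = "\<lambda>i. enn2real (K (grid T n i) \<omega>)"
  have an: "?a n = enn2real (J T \<omega>)" "?b n = enn2real (K T \<omega>)" "?a 0 = 0" "?b 0 = 0"
    using n J K by (auto simp: grid_n finite_additive_path_def)
  have nonneg: "0 \<le> (\<Sum>i<n. (?a (Suc i) - ?a i) * (?b (Suc i) - ?b i))"
    using T by (intro sum_nonneg mult_nonneg_nonneg)
      (auto intro!: finite_additive_path_real_mono[OF J] finite_additive_path_real_mono[OF K] grid_mono grid_nonneg grid_le)
  have "cross_sum X J K T n \<omega> + cross_sum X K J T n \<omega> =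
      ennreal ((\<Sum>i<n. (?a (Suc i) - ?a i) * (?b n - ?b (Suc i))) + (\<Sum>i<n. (?b (Suc i) - ?b i) * (?a n - ?a (Suc i))))"
    using cross_sum_path[OF J K T, of n] cross_sum_path[OF K J T, of n] an by simp
  also have "\<dots> \<le> ennreal (?a n * ?b n)"
    using sum_by_parts[where a="?a" and b="?b" and n=n] nonneg an by (intro ennreal_leI) simp
  also have "\<dots> = J T \<omega> * K T \<omega>"
    unfolding an using finite_additive_path_real[OF J T order_refl] finite_additive_path_real[OF K T order_refl]
    by (metis enn2real_nonneg ennreal_mult)
  finally show ?thesis .
qed

text \<open>For a single functional the missing term is the quadratic variation, which tends to zero
  because the path is continuous and increasing.\<close>

lemma cross_sum_tendsto:
  assumes J: "finite_additive_path X J T \<omega>" and T: "0 \<le> T"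
  shows "(\<lambda>n. 2 * cross_sum X J J T n \<omega>) \<longlonglongrightarrow> J T \<omega> * J T \<omega>"
proof -
  let ?l = "\<lambda>s. enn2real (J s \<omega>)"
  have q: "(\<lambda>n. (?l T)\<^sup>2 - (\<Sum>i<n. (?l (grid T n (Suc i)) - ?l (grid T n i))\<^sup>2)) \<longlonglongrightarrow> (?l T)\<^sup>2 - 0"
    using J by (intro tendsto_diff tendsto_const quadratic_variation_tendsto_zero[OF T] finite_additive_path_real_mono[OF J])
      (auto simp: finite_additive_path_def)
  have "\<forall>\<^sub>F n in sequentially. ennreal ((?l T)\<^sup>2 - (\<Sum>i<n. (?l (grid T n (Suc i)) - ?l (grid T n i))\<^sup>2)) =
      2 * cross_sum X J J T n \<omega>"
    using eventually_gt_at_top[of 0]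
  proof eventually_elim
    case (elim n)
    let ?a = "\<lambda>i. ?l (grid T n i)"
    have "?a n = ?l T" "?a 0 = 0" using elim J by (auto simp: grid_n finite_additive_path_def)
    then have "(?l T)\<^sup>2 - (\<Sum>i<n. (?a (Suc i) - ?a i)\<^sup>2) = 2 * (\<Sum>i<n. (?a (Suc i) - ?a i) * (?l T - ?a (Suc i)))"
      using sum_by_parts[where a="?a" and b="?a" and n=n] by (simp add: power2_eq_square)
    then show ?case
      using cross_sum_path[OF J J T, of n] by (simp add: ennreal_mult)
  qed
  moreover have "ennreal ((?l T)\<^sup>2 - 0) = J T \<omega> * J T \<omega>"
    using finite_additive_path_real[OF J T order_refl]
    by (metis diff_zero enn2real_nonneg ennreal_mult power2_eq_square)
  ultimately show ?thesis
    using tendsto_ennrealI[OF q] by (auto elim: Lim_transform_eventually)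
qed

text \<open>Subtraction in the extended half-line is truncated, so the telescoping is done by an
  induction that uses monotonicity at each grid step.\<close>

lemma cross_sum_increments_le:
  assumes J: "finite_additive_path X J T \<omega>" and T: "0 \<le> T"
  shows "(\<Sum>i<n. J (grid T n (Suc i)) \<omega> - J (grid T n i) \<omega>) \<le> J T \<omega>"
proof -
  have "(\<Sum>i<k. J (grid T n (Suc i)) \<omega> - J (grid T n i) \<omega>) \<le> J (grid T n k) \<omega>" for k
  proof (induction k)
    case (Suc k)
    have "(\<Sum>i<Suc k. J (grid T n (Suc i)) \<omega> - J (grid T n i) \<omega>) \<le>
        J (grid T n k) \<omega> + (J (grid T n (Suc k)) \<omega> - J (grid T n k) \<omega>)"
      using Suc by (simp add: add_right_mono)
    also have "\<dots> = J (grid T n (Suc k)) \<omega>"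
      using T by (intro add_diff_inverse_ennreal finite_additive_path_mono[OF J] grid_nonneg grid_mono) auto
    finally show ?case .
  qed simp
  also have "J (grid T n n) \<omega> \<le> J T \<omega>"
    using T by (intro finite_additive_path_mono[OF J] grid_nonneg grid_le) auto
  finally show ?thesis .
qed

section \<open>Means of the discretised products\<close>

context hunt_process
begin

lemma continuous_additive_measurable:
  "continuous_additive X J \<Longrightarrow> 0 \<le> t \<Longrightarrow> J t \<in> borel_measurable (completed_filtration X (ennreal t))"
  by (simp add: continuous_additive_def)

lemma continuous_additive_measurable_infinity:
  "continuous_additive X J \<Longrightarrow> 0 \<le> t \<Longrightarrow> J t \<in> borel_measurable (completed_filtration X \<infinity>)"
  by (rule measurable_completed_mono[OF continuous_additive_measurable]) auto

text \<open>The total value is the value at \<open>T\<close> plus the total value of the shifted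
  path, and the Markov property turns the latter into the potential at the position at time
  \<open>T\<close>.\<close>

lemma expectation_split:
  assumes J: "continuous_additive X J" and T: "0 \<le> T"
  shows "(\<integral>\<^sup>+\<omega>. J T \<omega> \<partial>law X x) + (\<integral>\<^sup>+\<omega>. (\<integral>\<^sup>+\<omega>'. (SUP n. J (real n) \<omega>') \<partial>law X (coord X (ennreal T) \<omega>)) \<partial>law X x) =
    (\<integral>\<^sup>+\<omega>. (SUP n. J (real n) \<omega>) \<partial>law X x)"
proof -
  let ?M = "completion (law X x)"
  let ?S = "\<lambda>\<omega>. SUP n. J (real n) \<omega>"
  have S: "?S \<in> borel_measurable (completed_filtration X \<infinity>)"
    using continuous_additive_measurable_infinity[OF J] by (intro borel_measurable_SUP) auto
  have JT: "J T \<in> borel_measurable ?M"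
    by (rule measurable_completion_law[OF continuous_additive_measurable[OF J T]])
  have *: "(\<integral>\<^sup>+\<omega>. ?S (translate X (ennreal T) \<omega>) \<partial>law X x) =
      (\<integral>\<^sup>+\<omega>. (\<integral>\<^sup>+\<omega>'. ?S \<omega>' \<partial>law X (coord X (ennreal T) \<omega>)) \<partial>law X x)"
    using markov_property[OF S, of "\<lambda>_. 1" "ennreal T" x] by simp
  have "AE \<omega> in law X x. J 0 \<omega> = 0 \<and>
        (\<forall>s\<ge>0. \<forall>t\<ge>0. J (s + t) \<omega> = J s \<omega> + J t (translate X (ennreal s) \<omega>)) \<and>
        (\<forall>t\<ge>0. J t \<omega> < \<infinity> \<longrightarrow> continuous_on {0..t} (\<lambda>s. enn2real (J s \<omega>)))"
    using J unfolding continuous_additive_def by blast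
  then have "AE \<omega> in law X x. ?S \<omega> = J T \<omega> + ?S (translate X (ennreal T) \<omega>)"
  proof eventually_elim
    case (elim \<omega>)
    then have add: "J (s + t) \<omega> = J s \<omega> + J t (translate X (ennreal s) \<omega>)" if "0 \<le> s" "0 \<le> t" for s t
      using that by blast
    have mono: "J s \<omega> \<le> J t \<omega>" if "0 \<le> s" "s \<le> t" for s t
      using add[of s "t - s"] that by simp
    have "?S \<omega> = (SUP n. J (T + real n) \<omega>)"
    proof (rule antisym)
      show "?S \<omega> \<le> (SUP n. J (T + real n) \<omega>)"
      proof (rule SUP_mono)
        fix n :: nat
        show "\<exists>m\<in>UNIV. J (real n) \<omega> \<le> J (T + real m) \<omega>"
          using T by (intro bexI[of _ n] mono) auto
      qed
      show "(SUP n. J (T + real n) \<omega>) \<le> ?S \<omega>"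
      proof (rule SUP_mono)
        fix n :: nat
        obtain k :: nat where k: "T + real n \<le> real k" using real_arch_simple by blast
        show "\<exists>m\<in>UNIV. J (T + real n) \<omega> \<le> J (real m) \<omega>"
          using T k by (intro bexI[of _ k] mono) auto
      qed
    qed
    also have "\<dots> = (SUP n. J T \<omega> + J (real n) (translate X (ennreal T) \<omega>))"
      using T by (simp add: add)
    also have "\<dots> = J T \<omega> + ?S (translate X (ennreal T) \<omega>)"
      by (rule ennreal_SUP_add_right[symmetric]) simp
    finally show ?case .
  qed
  then have "(\<integral>\<^sup>+\<omega>. ?S \<omega> \<partial>law X x) = (\<integral>\<^sup>+\<omega>. J T \<omega> + ?S (translate X (ennreal T) \<omega>) \<partial>law X x)"
    by (rule nn_integral_cong_AE)
  also have "\<dots> = (\<integral>\<^sup>+\<omega>. J T \<omega> + ?S (translate X (ennreal T) \<omega>) \<partial>?M)"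
    by (simp add: nn_integral_completion)
  also have "\<dots> = (\<integral>\<^sup>+\<omega>. J T \<omega> \<partial>?M) + (\<integral>\<^sup>+\<omega>. ?S (translate X (ennreal T) \<omega>) \<partial>?M)"
    by (rule nn_integral_add[OF JT measurable_translate_completed(1)[OF S]])
  finally show ?thesis by (simp add: nn_integral_completion *)
qed

lemma measurable_increment:
  assumes J: "continuous_additive X J" and T: "0 \<le> T"
  shows "(\<lambda>\<omega>. J (grid T n (Suc i)) \<omega> - J (grid T n i) \<omega>)
    \<in> borel_measurable (completed_filtration X (ennreal (grid T n (Suc i))))"
proof (rule borel_measurable_minus_ennreal)
  show "J (grid T n (Suc i)) \<in> borel_measurable (completed_filtration X (ennreal (grid T n (Suc i))))"
    by (rule continuous_additive_measurable[OF J grid_nonneg[OF T]])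
  show "J (grid T n i) \<in> borel_measurable (completed_filtration X (ennreal (grid T n (Suc i))))"
    by (rule measurable_completed_mono[OF continuous_additive_measurable[OF J grid_nonneg[OF T]]])
       (intro ennreal_leI grid_mono[OF T], simp)
qed

lemma measurable_cross_term:
  assumes J: "continuous_additive X J" and K: "continuous_additive X K" and T: "0 \<le> T" and i: "i < n"
  shows "(\<lambda>\<omega>. (J (grid T n (Suc i)) \<omega> - J (grid T n i) \<omega>) *
      K (T - grid T n (Suc i)) (translate X (ennreal (grid T n (Suc i))) \<omega>)) \<in> borel_measurable (completion (law X x))"
proof (rule borel_measurable_times_ennreal)
  show "(\<lambda>\<omega>. J (grid T n (Suc i)) \<omega> - J (grid T n i) \<omega>) \<in> borel_measurable (completion (law X x))"
    by (rule measurable_completion_law[OF measurable_increment[OF J T]])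
  have "0 \<le> T - grid T n (Suc i)" using grid_le[OF T, of "Suc i" n] i by simp
  then show "(\<lambda>\<omega>. K (T - grid T n (Suc i)) (translate X (ennreal (grid T n (Suc i))) \<omega>)) \<in> borel_measurable (completion (law X x))"
    by (rule measurable_translate_completed(1)[OF continuous_additive_measurable_infinity[OF K]])
qed

text \<open>The increment of \<open>J\<close> is known when the shift takes place, so the Markov
  property replaces the shifted \<open>K\<close> by its mean from the current position. After that
  only the means of \<open>K\<close> enter.\<close>

lemma expectation_cross_sum:
  assumes J: "continuous_additive X J" and K: "continuous_additive X K" and T: "0 \<le> T"
  shows "(\<integral>\<^sup>+\<omega>. cross_sum X J K T n \<omega> \<partial>law X x) =
    (\<Sum>i<n. \<integral>\<^sup>+\<omega>. (J (grid T n (Suc i)) \<omega> - J (grid T n i) \<omega>) *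
      (\<integral>\<^sup>+\<omega>'. K (T - grid T n (Suc i)) \<omega>' \<partial>law X (coord X (ennreal (grid T n (Suc i))) \<omega>)) \<partial>law X x)"
proof -
  let ?M = "completion (law X x)"
  have Kmeas: "K (T - grid T n (Suc i)) \<in> borel_measurable (completed_filtration X \<infinity>)" if "i < n" for i
    using grid_le[OF T, of "Suc i" n] that by (intro continuous_additive_measurable_infinity[OF K]) auto
  have "(\<integral>\<^sup>+\<omega>. cross_sum X J K T n \<omega> \<partial>law X x) = (\<integral>\<^sup>+\<omega>. cross_sum X J K T n \<omega> \<partial>?M)"
    by (simp add: nn_integral_completion)
  also have "\<dots> = (\<Sum>i<n. \<integral>\<^sup>+\<omega>. (J (grid T n (Suc i)) \<omega> - J (grid T n i) \<omega>) *
      K (T - grid T n (Suc i)) (translate X (ennreal (grid T n (Suc i))) \<omega>) \<partial>?M)"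
    unfolding cross_sum_def
    by (rule nn_integral_sum) (rule measurable_cross_term[OF J K T], simp)
  also have "\<dots> = (\<Sum>i<n. \<integral>\<^sup>+\<omega>. (J (grid T n (Suc i)) \<omega> - J (grid T n i) \<omega>) *
      (\<integral>\<^sup>+\<omega>'. K (T - grid T n (Suc i)) \<omega>' \<partial>law X (coord X (ennreal (grid T n (Suc i))) \<omega>)) \<partial>law X x)"
    unfolding nn_integral_completion
    by (rule sum.cong[OF refl]) (rule markov_property[OF Kmeas measurable_increment[OF J T]], simp)
  finally show ?thesis .
qed

lemma AE_finite_additive_path:
  assumes J: "continuous_additive X J" and T: "0 \<le> T" and fin: "(\<integral>\<^sup>+\<omega>. J T \<omega> \<partial>law X x) < \<infinity>"
  shows "AE \<omega> in law X x. finite_additive_path X J T \<omega>"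
proof -
  have "J T \<in> borel_measurable (completion (law X x))"
    by (rule measurable_completion_law[OF continuous_additive_measurable[OF J T]])
  moreover have "(\<integral>\<^sup>+\<omega>. J T \<omega> \<partial>completion (law X x)) \<noteq> \<infinity>"
    using fin by (simp add: nn_integral_completion)
  ultimately have "AE \<omega> in completion (law X x). J T \<omega> \<noteq> \<infinity>" by (rule nn_integral_noteq_infinite)
  then have "AE \<omega> in law X x. J T \<omega> \<noteq> \<infinity>" unfolding AE_completion_iff .
  moreover have "AE \<omega> in law X x. J 0 \<omega> = 0 \<and>
      (\<forall>s\<ge>0. \<forall>t\<ge>0. J (s + t) \<omega> = J s \<omega> + J t (translate X (ennreal s) \<omega>)) \<and>
      (\<forall>t\<ge>0. J t \<omega> < \<infinity> \<longrightarrow> continuous_on {0..t} (\<lambda>s. enn2real (J s \<omega>)))"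
    using J unfolding continuous_additive_def by blast
  ultimately show ?thesis
    by eventually_elim (use T in \<open>auto simp: finite_additive_path_def less_top\<close>)
qed

end

section \<open>Equality of functionals with the same bounded potential\<close>

locale equal_potentials = hunt_process X
  for X :: "('w, 'e::{metric_space, second_countable_topology}) markov_process" +
  fixes J K :: "real \<Rightarrow> 'w \<Rightarrow> ennreal" and c :: ennreal
  assumes J: "continuous_additive X J" and K: "continuous_additive X K"
    and eq: "\<And>x. (\<integral>\<^sup>+\<omega>. (SUP n. J (real n) \<omega>) \<partial>law X x) = (\<integral>\<^sup>+\<omega>. (SUP n. K (real n) \<omega>) \<partial>law X x)"
    and bound: "\<And>x. (\<integral>\<^sup>+\<omega>. (SUP n. J (real n) \<omega>) \<partial>law X x) \<le> c" and c: "c < \<infinity>"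
begin

text \<open>By \<open>expectation_split\<close> the mean at time \<open>t\<close> is the potential
  minus its mean at the position at time \<open>t\<close>; boundedness of the potential permits the
  cancellation.\<close>

lemma mean_eq: "0 \<le> t \<Longrightarrow> (\<integral>\<^sup>+\<omega>. J t \<omega> \<partial>law X y) = (\<integral>\<^sup>+\<omega>. K t \<omega> \<partial>law X y)"
proof -
  assume t: "0 \<le> t"
  let ?U = "\<integral>\<^sup>+\<omega>. (\<integral>\<^sup>+\<omega>'. (SUP n. J (real n) \<omega>') \<partial>law X (coord X (ennreal t) \<omega>)) \<partial>law X y"
  have "?U \<le> (\<integral>\<^sup>+\<omega>. c \<partial>law X y)" by (intro nn_integral_mono bound)
  then have U: "?U \<noteq> \<infinity>" using c by (auto simp: top_unique)
  have "(\<integral>\<^sup>+\<omega>. J t \<omega> \<partial>law X y) + ?U = (\<integral>\<^sup>+\<omega>. K t \<omega> \<partial>law X y) + ?U"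
    using expectation_split[OF J t, of y] expectation_split[OF K t, of y] by (simp add: eq)
  then show ?thesis using U by (metis ennreal_add_left_cancel add.commute infinity_ennreal_def)
qed

lemma mean_le: "L = J \<or> L = K \<Longrightarrow> 0 \<le> t \<Longrightarrow> (\<integral>\<^sup>+\<omega>. L t \<omega> \<partial>law X y) \<le> c"
proof -
  assume L: "L = J \<or> L = K" and t: "0 \<le> t"
  have "(\<integral>\<^sup>+\<omega>. J t \<omega> \<partial>law X y) \<le> (\<integral>\<^sup>+\<omega>. (SUP n. J (real n) \<omega>) \<partial>law X y)"
    unfolding expectation_split[OF J t, of y, symmetric] by simp
  then have "(\<integral>\<^sup>+\<omega>. J t \<omega> \<partial>law X y) \<le> c" using bound by (rule order_trans)
  then show ?thesis using L mean_eq[OF t, of y] by auto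
qed

lemma path: "L = J \<or> L = K \<Longrightarrow> 0 \<le> T \<Longrightarrow> AE \<omega> in law X x. finite_additive_path X L T \<omega>"
proof -
  assume L: "L = J \<or> L = K" and T: "0 \<le> T"
  show ?thesis
    by (rule AE_finite_additive_path[OF _ T]) (use L J K mean_le[OF L T, of x] c in \<open>auto intro: le_less_trans\<close>)
qed

text \<open>In the form given by \<open>expectation_cross_sum\<close> the second functional enters
  only through its means at fixed times, and those agree.\<close>

lemma expectation_swap:
  assumes L: "continuous_additive X L" and T: "0 \<le> T"
  shows "(\<integral>\<^sup>+\<omega>. cross_sum X L J T n \<omega> \<partial>law X x) = (\<integral>\<^sup>+\<omega>. cross_sum X L K T n \<omega> \<partial>law X x)"
  unfolding expectation_cross_sum[OF L J T] expectation_cross_sum[OF L K T]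
proof (rule sum.cong[OF refl])
  fix i assume "i \<in> {..<n}"
  then have "0 \<le> T - grid T n (Suc i)" using grid_le[OF T, of "Suc i" n] by simp
  then show "(\<integral>\<^sup>+\<omega>. (L (grid T n (Suc i)) \<omega> - L (grid T n i) \<omega>) *
      (\<integral>\<^sup>+\<omega>'. J (T - grid T n (Suc i)) \<omega>' \<partial>law X (coord X (ennreal (grid T n (Suc i))) \<omega>)) \<partial>law X x) =
    (\<integral>\<^sup>+\<omega>. (L (grid T n (Suc i)) \<omega> - L (grid T n i) \<omega>) *
      (\<integral>\<^sup>+\<omega>'. K (T - grid T n (Suc i)) \<omega>' \<partial>law X (coord X (ennreal (grid T n (Suc i))) \<omega>)) \<partial>law X x)"
    by (simp only: mean_eq)
qed

text \<open>Conditioning bounds the later factor by \<open>c\<close>, and the remaining increments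
  sum to at most \<open>L T\<close>, whose mean is at most \<open>c\<close>. The bound is uniform in
  \<open>n\<close>, so it survives the passage to the limit and yields finite second
  moments.\<close>

lemma expectation_cross_sum_le:
  assumes LJ: "L = J \<or> L = K" and T: "0 \<le> T"
  shows "(\<integral>\<^sup>+\<omega>. cross_sum X L L T n \<omega> \<partial>law X x) \<le> c * c"
proof -
  have L: "continuous_additive X L" using LJ J K by auto
  let ?M = "completion (law X x)"
  let ?D = "\<lambda>i \<omega>. L (grid T n (Suc i)) \<omega> - L (grid T n i) \<omega>"
  have D: "?D i \<in> borel_measurable ?M" for i
    by (rule measurable_completion_law[OF measurable_increment[OF L T]])
  have "(\<integral>\<^sup>+\<omega>. cross_sum X L L T n \<omega> \<partial>law X x) \<le> (\<Sum>i<n. \<integral>\<^sup>+\<omega>. ?D i \<omega> * c \<partial>?M)"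
    unfolding nn_integral_completion expectation_cross_sum[OF L L T]
  proof (intro sum_mono nn_integral_mono mult_left_mono)
    fix i \<omega> assume "i \<in> {..<n}"
    then show "(\<integral>\<^sup>+\<omega>'. L (T - grid T n (Suc i)) \<omega>' \<partial>law X (coord X (ennreal (grid T n (Suc i))) \<omega>)) \<le> c"
      using grid_le[OF T, of "Suc i" n] by (intro mean_le[OF LJ]) auto
  qed auto
  also have "\<dots> = (\<Sum>i<n. \<integral>\<^sup>+\<omega>. ?D i \<omega> \<partial>?M) * c"
    using D by (simp add: nn_integral_multc sum_distrib_right)
  also have "(\<Sum>i<n. \<integral>\<^sup>+\<omega>. ?D i \<omega> \<partial>?M) = (\<integral>\<^sup>+\<omega>. (\<Sum>i<n. ?D i \<omega>) \<partial>?M)"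
    using D by (simp add: nn_integral_sum)
  also have "\<dots> \<le> (\<integral>\<^sup>+\<omega>. L T \<omega> \<partial>law X x)"
    unfolding nn_integral_completion
    using path[OF LJ T, of x] by (intro nn_integral_mono_AE) (auto elim!: eventually_mono intro: cross_sum_increments_le[OF _ T])
  also have "\<dots> \<le> c" by (rule mean_le[OF LJ T])
  finally show ?thesis by (simp add: mult_right_mono)
qed

text \<open>Fatou's lemma along the grids gives an inequality between means opposite to the
  pointwise inequality \<open>2 * (J T * K T) \<le> J T * J T + K T * K T\<close>. As the means are
  finite, equality holds almost surely, which means that the square of the difference
  vanishes.\<close>

theorem equal_potentials_unique:
  assumes T: "0 \<le> T"
  shows "AE \<omega> in law X x. J T \<omega> = K T \<omega>"
proof -
  let ?M = "completion (law X x)"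
  let ?A = "\<lambda>n \<omega>. 2 * cross_sum X J J T n \<omega> + 2 * cross_sum X K K T n \<omega>"
  have meas: "cross_sum X L L' T n \<in> borel_measurable ?M" if "L = J \<or> L = K" "L' = J \<or> L' = K" for L L' n
    unfolding cross_sum_def[abs_def] using that J K T
    by (intro borel_measurable_sum measurable_cross_term) auto
  note [measurable] = meas[of J J, simplified] meas[of J K, simplified] meas[of K J, simplified] meas[of K K, simplified]
    measurable_completion_law[OF continuous_additive_measurable[OF J T], of x]
    measurable_completion_law[OF continuous_additive_measurable[OF K T], of x]
  note pathJ = path[of J T x, simplified, OF T] and pathK = path[of K T x, simplified, OF T]
  \<comment> \<open>Exchanging the second functional in each diagonal sum produces the two mixed
    sums without changing the mean.\<close>
  have A: "(\<integral>\<^sup>+\<omega>. ?A n \<omega> \<partial>?M) = (\<integral>\<^sup>+\<omega>. 2 * (cross_sum X J K T n \<omega> + cross_sum X K J T n \<omega>) \<partial>?M)" for n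
    using expectation_swap[OF J T, where n=n and x=x] expectation_swap[OF K T, where n=n and x=x]
    by (simp add: nn_integral_cmult nn_integral_add distrib_left) (simp add: nn_integral_completion)
  have A_le: "(\<integral>\<^sup>+\<omega>. ?A n \<omega> \<partial>?M) \<le> (\<integral>\<^sup>+\<omega>. 2 * (J T \<omega> * K T \<omega>) \<partial>?M)" if n: "0 < n" for n
    unfolding A
  proof (rule nn_integral_mono_AE, unfold AE_completion_iff)
    show "AE \<omega> in law X x. 2 * (cross_sum X J K T n \<omega> + cross_sum X K J T n \<omega>) \<le> 2 * (J T \<omega> * K T \<omega>)"
      using pathJ pathK by eventually_elim (intro mult_left_mono cross_sum_le T n; simp)
  qed
  have A_bound: "(\<integral>\<^sup>+\<omega>. ?A n \<omega> \<partial>?M) \<le> 2 * (c * c) + 2 * (c * c)" for n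
    using expectation_cross_sum_le[of J T, where n=n and x=x] expectation_cross_sum_le[of K T, where n=n and x=x] T
    by (simp add: nn_integral_cmult nn_integral_add) (simp add: nn_integral_completion add_mono mult_left_mono)
  have "AE \<omega> in law X x. J T \<omega> * J T \<omega> + K T \<omega> * K T \<omega> = liminf (\<lambda>n. ?A n \<omega>)"
    using pathJ pathK
  proof eventually_elim
    case (elim \<omega>)
    have "(\<lambda>n. ?A n \<omega>) \<longlonglongrightarrow> J T \<omega> * J T \<omega> + K T \<omega> * K T \<omega>"
      using elim by (intro tendsto_add cross_sum_tendsto T)
    then show ?case by (intro lim_imp_Liminf[symmetric]) auto
  qed
  then have lim: "AE \<omega> in ?M. J T \<omega> * J T \<omega> + K T \<omega> * K T \<omega> = liminf (\<lambda>n. ?A n \<omega>)"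
    unfolding AE_completion_iff .
  have fatou: "(\<integral>\<^sup>+\<omega>. J T \<omega> * J T \<omega> + K T \<omega> * K T \<omega> \<partial>?M) \<le> liminf (\<lambda>n. \<integral>\<^sup>+\<omega>. ?A n \<omega> \<partial>?M)"
    unfolding nn_integral_cong_AE[OF lim] by (rule nn_integral_liminf) measurable
  have le1: "(\<integral>\<^sup>+\<omega>. J T \<omega> * J T \<omega> + K T \<omega> * K T \<omega> \<partial>?M) \<le> (\<integral>\<^sup>+\<omega>. 2 * (J T \<omega> * K T \<omega>) \<partial>?M)"
  proof (rule order_trans[OF fatou])
    have "liminf (\<lambda>n. \<integral>\<^sup>+\<omega>. ?A n \<omega> \<partial>?M) \<le> liminf (\<lambda>n. \<integral>\<^sup>+\<omega>. 2 * (J T \<omega> * K T \<omega>) \<partial>?M)"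
      by (intro Liminf_mono eventually_mono[OF eventually_gt_at_top[of 0]] A_le)
    then show "liminf (\<lambda>n. \<integral>\<^sup>+\<omega>. ?A n \<omega> \<partial>?M) \<le> (\<integral>\<^sup>+\<omega>. 2 * (J T \<omega> * K T \<omega>) \<partial>?M)"
      by (simp add: Liminf_const)
  qed
  \<comment> \<open>Only first moments are bounded at the outset; finiteness of the second moments
    comes from the uniform bound on the cross sums.\<close>
  have le2: "(\<integral>\<^sup>+\<omega>. J T \<omega> * J T \<omega> + K T \<omega> * K T \<omega> \<partial>?M) < \<infinity>"
  proof -
    have "liminf (\<lambda>n. \<integral>\<^sup>+\<omega>. ?A n \<omega> \<partial>?M) \<le> liminf (\<lambda>n. 2 * (c * c) + 2 * (c * c))"
      by (rule Liminf_mono) (simp add: A_bound)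
    also have "\<dots> = 2 * (c * c) + 2 * (c * c)" by (simp add: Liminf_const)
    also have "\<dots> < \<infinity>" using c by (auto simp: ennreal_mult_less_top)
    finally show ?thesis using fatou by (auto intro: le_less_trans)
  qed
  have sq: "2 * (J T \<omega> * K T \<omega>) \<le> J T \<omega> * J T \<omega> + K T \<omega> * K T \<omega>"
    "2 * (J T \<omega> * K T \<omega>) = J T \<omega> * J T \<omega> + K T \<omega> * K T \<omega> \<Longrightarrow> J T \<omega> = K T \<omega>"
    if fin: "finite_additive_path X J T \<omega>" "finite_additive_path X K T \<omega>" for \<omega>
  proof -
    obtain a b where ab: "J T \<omega> = ennreal a" "0 \<le> a" "K T \<omega> = ennreal b" "0 \<le> b"
      using fin by (cases "J T \<omega>"; cases "K T \<omega>") (auto simp: finite_additive_path_def)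
    have 1: "2 * (J T \<omega> * K T \<omega>) = ennreal (2 * (a * b))" "J T \<omega> * J T \<omega> + K T \<omega> * K T \<omega> = ennreal (a * a + b * b)"
      using ab by (auto simp: ennreal_mult)
    have 2: "(a - b)\<^sup>2 = a * a + b * b - 2 * (a * b)" by (simp add: power2_eq_square algebra_simps)
    have "0 \<le> (a - b)\<^sup>2" by simp
    then show "2 * (J T \<omega> * K T \<omega>) \<le> J T \<omega> * J T \<omega> + K T \<omega> * K T \<omega>"
      unfolding 1 2 by (intro ennreal_leI) simp
    assume "2 * (J T \<omega> * K T \<omega>) = J T \<omega> * J T \<omega> + K T \<omega> * K T \<omega>"
    then have "2 * (a * b) = a * a + b * b" unfolding 1 using ab by (subst (asm) ennreal_inj) auto
    then have "(a - b)\<^sup>2 = 0" unfolding 2 by simp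
    then show "J T \<omega> = K T \<omega>" using ab by simp
  qed
  have "AE \<omega> in ?M. 2 * (J T \<omega> * K T \<omega>) = J T \<omega> * J T \<omega> + K T \<omega> * K T \<omega>"
  proof (rule AE_eq_of_nn_integral_le[OF _ _ _ le1 le2])
    show "AE \<omega> in ?M. 2 * (J T \<omega> * K T \<omega>) \<le> J T \<omega> * J T \<omega> + K T \<omega> * K T \<omega>"
      unfolding AE_completion_iff using pathJ pathK by eventually_elim (rule sq)
  qed measurable
  then show ?thesis
    unfolding AE_completion_iff using pathJ pathK by eventually_elim (rule sq)
qed

end

section \<open>Measurability of the paths\<close>

text \<open>The next point of the grid of mesh \<open>1 / Suc n\<close>, strictly to the right of
  \<open>s < t\<close> even when \<open>s\<close> is itself a grid point, as limits from the right
  demand. The cut at \<open>t\<close> keeps the evaluation within the information available at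
  \<open>t\<close>.\<close>

definition round_up :: "nat \<Rightarrow> real \<Rightarrow> real \<Rightarrow> real" where
  "round_up n t s = min t (real_of_int (\<lfloor>s * real (Suc n)\<rfloor> + 1) / real (Suc n))"

lemma round_up_gt: "s < t \<Longrightarrow> s < round_up n t s"
  unfolding round_up_def by (simp add: field_simps) linarith

lemma round_up_le: "round_up n t s \<le> s + 1 / real (Suc n)"
proof -
  have "real_of_int (\<lfloor>s * real (Suc n)\<rfloor> + 1) \<le> s * real (Suc n) + 1" by linarith
  then have "real_of_int (\<lfloor>s * real (Suc n)\<rfloor> + 1) / real (Suc n) \<le> (s * real (Suc n) + 1) / real (Suc n)"
    by (intro divide_right_mono) auto
  also have "\<dots> = s + 1 / real (Suc n)" by (simp add: field_simps)
  finally show ?thesis unfolding round_up_def by linarith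
qed

lemma round_up_ge: "t \<le> s \<Longrightarrow> round_up n t s = t"
proof -
  assume "t \<le> s"
  have "s * real (Suc n) \<le> real_of_int (\<lfloor>s * real (Suc n)\<rfloor> + 1)" by linarith
  then have "s \<le> real_of_int (\<lfloor>s * real (Suc n)\<rfloor> + 1) / real (Suc n)" by (simp add: field_simps)
  with \<open>t \<le> s\<close> show ?thesis unfolding round_up_def by linarith
qed

lemma round_up_tendsto: "s < t \<Longrightarrow> (\<lambda>n. round_up n t s) \<longlonglongrightarrow> s"
proof (rule tendsto_sandwich)
  assume "s < t"
  show "\<forall>\<^sub>F n in sequentially. s \<le> round_up n t s"
    by (rule always_eventually) (use round_up_gt[OF \<open>s < t\<close>] in \<open>auto intro: less_imp_le\<close>)
  show "\<forall>\<^sub>F n in sequentially. round_up n t s \<le> s + 1 / real (Suc n)"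
    by (rule always_eventually) (use round_up_le in auto)
  show "(\<lambda>n. s + 1 / real (Suc n)) \<longlonglongrightarrow> s"
    using tendsto_add[OF tendsto_const LIMSEQ_Suc[OF lim_1_over_n], of s] by simp
qed auto

lemma round_up_at_right:
  assumes "0 \<le> s" "s < t"
  shows "filterlim (\<lambda>n. ennreal (round_up n t s)) (at_right (ennreal s)) sequentially"
  unfolding filterlim_at
proof
  have "ennreal s < ennreal (round_up n t s)" for n
    using round_up_gt[OF assms(2), of n] assms(1) by (simp add: ennreal_less_iff)
  then show "\<forall>\<^sub>F n in sequentially. ennreal (round_up n t s) \<in> {ennreal s<..} \<and> ennreal (round_up n t s) \<noteq> ennreal s"
    by (intro always_eventually allI) (metis greaterThan_iff less_irrefl)
  show "(\<lambda>n. ennreal (round_up n t s)) \<longlonglongrightarrow> ennreal s"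
    by (intro tendsto_ennrealI round_up_tendsto assms)
qed

text \<open>At each stage the rounded time takes countably many values, so the approximations are
  jointly measurable, and right limits along \<open>round_up\<close> give the process itself. From
  \<open>t\<close> on the time is frozen at \<open>t\<close>.\<close>

lemma measurable_right_limit:
  fixes g :: "real \<Rightarrow> 'w \<Rightarrow> ennreal"
  assumes g: "\<And>r. 0 \<le> r \<Longrightarrow> r \<le> t \<Longrightarrow> g r \<in> borel_measurable M"
    and lim: "\<And>\<omega> s. \<omega> \<in> space M \<Longrightarrow> 0 \<le> s \<Longrightarrow> s < t \<Longrightarrow> (\<lambda>n. g (round_up n t s) \<omega>) \<longlonglongrightarrow> g s \<omega>"
    and t: "0 \<le> t"
  shows "(\<lambda>(\<omega>, s). g (min (max 0 s) t) \<omega>) \<in> borel_measurable (M \<Otimes>\<^sub>M borel)"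
proof (rule borel_measurable_LIMSEQ_order[where u="\<lambda>n (\<omega>, s). g (round_up n t (max 0 s)) \<omega>"])
  fix n
  let ?f = "\<lambda>(i::int) x. g (max 0 (min t (real_of_int (i + 1) / real (Suc n)))) (fst x)"
  have "(\<lambda>x. ?f \<lfloor>max 0 (snd x) * real (Suc n)\<rfloor> x) \<in> borel_measurable (M \<Otimes>\<^sub>M borel)"
  proof (rule measurable_compose_countable[where f="?f"])
    fix i :: int
    have "g (max 0 (min t (real_of_int (i + 1) / real (Suc n)))) \<in> borel_measurable M"
      using t by (intro g) auto
    then show "?f i \<in> borel_measurable (M \<Otimes>\<^sub>M (borel :: real measure))"
      by (rule measurable_compose[OF measurable_fst])
  qed measurable
  moreover have "max 0 (min t (real_of_int (\<lfloor>max 0 s * real (Suc n)\<rfloor> + 1) / real (Suc n))) = round_up n t (max 0 s)" for s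
    unfolding round_up_def using t by (auto intro!: divide_nonneg_nonneg simp: max_absorb2)
  ultimately show "(\<lambda>(\<omega>, s). g (round_up n t (max 0 s)) \<omega>) \<in> borel_measurable (M \<Otimes>\<^sub>M borel)"
    by (simp only: case_prod_beta')
next
  fix x assume "x \<in> space (M \<Otimes>\<^sub>M (borel :: real measure))"
  then obtain \<omega> s where x: "x = (\<omega>, s)" "\<omega> \<in> space M" by (auto simp: space_pair_measure)
  show "(\<lambda>n. case x of (\<omega>, s) \<Rightarrow> g (round_up n t (max 0 s)) \<omega>) \<longlonglongrightarrow> (case x of (\<omega>, s) \<Rightarrow> g (min (max 0 s) t) \<omega>)"
  proof (cases "max 0 s < t")
    case True
    then show ?thesis using lim[OF x(2), of "max 0 s"] by (simp add: x(1) min_def)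
  next
    case False
    then have "t \<le> max 0 s" by linarith
    then show ?thesis by (simp add: x(1) round_up_ge min_absorb2)
  qed
qed

text \<open>Off the compact closure of its support \<open>\<phi>\<close> vanishes, and the
  complement of this compact set together with the cemetery is a neighbourhood of the cemetery.
  Extension by zero is therefore continuous on the one-point compactification.\<close>

lemma tendsto_case_option_zero:
  fixes \<phi> :: "'e::metric_space \<Rightarrow> real"
  assumes lim: "limitin cemetery_topology f l F" and cont: "continuous_on UNIV \<phi>"
    and supp: "compact (closure {x. \<phi> x \<noteq> 0})"
  shows "((\<lambda>s. case_option 0 \<phi> (f s)) \<longlongrightarrow> case_option 0 \<phi> l) F"
proof (rule topological_tendstoI)
  fix S :: "real set" assume S: "open S" "case_option 0 \<phi> l \<in> S"
  have ev: "eventually (\<lambda>s. f s \<in> U) F" if "openin cemetery_topology U" "l \<in> U" for U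
    using lim that unfolding limitin_def by blast
  show "eventually (\<lambda>s. case_option 0 \<phi> (f s) \<in> S) F"
  proof (cases l)
    case (Some y)
    have "open (\<phi> -` S)" using cont S(1) by (simp add: continuous_on_open_vimage)
    then have "eventually (\<lambda>s. f s \<in> Some ` (\<phi> -` S)) F"
      using Some S(2) by (intro ev) auto
    then show ?thesis by eventually_elim auto
  next
    case None
    let ?C = "closure {x. \<phi> x \<noteq> 0}"
    have "openin cemetery_topology (insert None (Some ` (- ?C)))"
      unfolding openin_Alexandroff_compactification
      by (rule disjI2, rule exI[of _ ?C]) (use supp in \<open>auto simp: Compl_eq_Diff_UNIV\<close>)
    then have "eventually (\<lambda>s. f s \<in> insert None (Some ` (- ?C))) F"
      using None by (intro ev) auto
    then show ?thesis
    proof eventually_elim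
      case (elim s)
      have *: "\<phi> x = 0" if "x \<notin> ?C" for x
        using that closure_subset[of "{x. \<phi> x \<noteq> 0}"] by blast
      have "case_option 0 \<phi> (f s) = 0"
      proof (cases "f s")
        case (Some x)
        with elim have "x \<notin> ?C" by (simp add: image_iff)
        from *[OF this] Some show ?thesis by simp
      qed simp
      then show ?case using None S(2) by simp
    qed
  qed
qed

text \<open>Local compactness puts a member of a countable base with compact closure around each
  point of \<open>U\<close>, inside \<open>U\<close>.\<close>

lemma relatively_compact_open_cover:
  fixes U :: "'e::{metric_space, second_countable_topology} set"
  assumes lc: "locally compact (UNIV :: 'e set)" and U: "open U"
  obtains C where "countable C" "\<And>V. V \<in> C \<Longrightarrow> open V \<and> compact (closure V)" "\<Union>C = U"
proof -
  obtain B :: "'e set set" where B: "countable B" "topological_basis B"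
    using ex_countable_basis by blast
  let ?C = "{V \<in> B. V \<subseteq> U \<and> compact (closure V)}"
  have "U \<subseteq> \<Union>?C"
  proof
    fix x assume "x \<in> U"
    then obtain u v where uv: "open u" "compact v" "x \<in> u" "u \<subseteq> v" "v \<subseteq> U"
      using lc U unfolding locally_def by (metis open_openin subtopology_UNIV)
    then obtain V where V: "V \<in> B" "x \<in> V" "V \<subseteq> u"
      using B(2) by (meson topological_basisE)
    have "closure V \<subseteq> v" using V uv by (intro closure_minimal compact_imp_closed) auto
    then have "compact (closure V)" using uv(2) by (metis closed_closure compact_Int_closed inf.absorb_iff2)
    then show "x \<in> \<Union>?C" using V uv by auto
  qed
  then have "\<Union>?C = U" by blast
  moreover have "countable ?C" using B(1) by (rule countable_subset[rotated]) auto
  moreover have "open V \<and> compact (closure V)" if "V \<in> ?C" for V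
    using that B(2) topological_basis_open by auto
  ultimately show thesis using that by blast
qed

text \<open>The distance to the complement works unless the complement is empty. Then
  \<open>infdist\<close> has the default value zero, but the whole space is compact and the constant
  one is available.\<close>

lemma bump_function:
  fixes U :: "'e::metric_space set"
  assumes "open U" "compact (closure U)"
  obtains \<phi> :: "'e \<Rightarrow> real" where "continuous_on UNIV \<phi>" "compact (closure {x. \<phi> x \<noteq> 0})"
    "\<And>x. 0 \<le> \<phi> x" "\<And>x. \<phi> x \<noteq> 0 \<longleftrightarrow> x \<in> U"
proof (cases "- U = {}")
  case True
  then have "U = UNIV" by auto
  then have "compact (UNIV :: 'e set)" using assms(2) by simp
  then show thesis using \<open>U = UNIV\<close> by (intro that[of "\<lambda>_. 1"]) auto
next
  case False
  have *: "infdist x (- U) \<noteq> 0 \<longleftrightarrow> x \<in> U" for x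
    using in_closed_iff_infdist_zero[of "- U" x] assms(1) False by auto
  show thesis
    using assms by (intro that[of "\<lambda>x. infdist x (- U)"]) (auto simp: * continuous_on_infdist infdist_nonneg)
qed

text \<open>The cemetery is absorbing, so whether the path is alive is decided by its position at
  the single time \<open>t\<close>.\<close>

lemma (in hunt_process) alive_iff: "t \<in> alive X \<omega> \<longleftrightarrow> 0 \<le> t \<and> coord X (ennreal t) \<omega> \<noteq> None"
proof -
  have "coord X (ennreal t) \<omega> = None \<longleftrightarrow> lifetime X \<omega> \<le> ennreal t"
    using after_lifetime[of \<omega> "ennreal t"] unfolding lifetime_def by (auto intro: Inf_lower)
  then show ?thesis by (auto simp: alive_def not_le)
qed

lemma alive_downward: "t \<in> alive X \<omega> \<Longrightarrow> 0 \<le> r \<Longrightarrow> r \<le> t \<Longrightarrow> r \<in> alive X \<omega>"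
  by (auto simp: alive_def intro: le_less_trans ennreal_leI)

lemma (in hunt_process) alive_empty_iff: "alive X \<omega> = {} \<longleftrightarrow> coord X 0 \<omega> = None"
proof -
  have "0 \<notin> alive X \<omega> \<longleftrightarrow> coord X 0 \<omega> = None" by (simp add: alive_iff)
  then show ?thesis using alive_downward[of _ X \<omega> 0] by (auto simp: alive_def)
qed

section \<open>Joint measurability of the position in path and time\<close>

locale lc_hunt_process = hunt_process X
  for X :: "('w, 'e::{metric_space, second_countable_topology}) markov_process" +
  assumes locally_compact_space: "locally compact (UNIV :: 'e set)"
begin

text \<open>The position lies in a relatively compact open set exactly when a bump function for this
  set is positive there, and along a path the bump function is right-continuous. Countable unions
  give all open sets, and induction over the generated sigma-algebra gives the Borel sets.\<close>

lemma measurable_coord_progressive: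
  assumes t: "0 \<le> t"
  shows "(\<lambda>(\<omega>, s). coord X (ennreal (min s t)) \<omega>) \<in> natural_filtration X (ennreal t) \<Otimes>\<^sub>M borel \<rightarrow>\<^sub>M borel_cemetery"
proof -
  let ?N = "natural_filtration X (ennreal t) \<Otimes>\<^sub>M (borel :: real measure)"
  let ?f = "\<lambda>(\<omega>, s). coord X (ennreal (min s t)) \<omega>"
  \<comment> \<open>\<open>ennreal\<close> sends negative times to zero, so clamping the time at
    zero from below changes nothing.\<close>
  have f_eq: "?f (\<omega>, s) = coord X (ennreal (min (max 0 s) t)) \<omega>" for \<omega> s
    using t by (auto simp: min_def max_def ennreal_neg)
  have base: "?f -` (Some ` V) \<inter> space ?N \<in> sets ?N" if V: "open V" "compact (closure V)" for V
  proof -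
    obtain \<phi> :: "'e \<Rightarrow> real" where \<phi>: "continuous_on UNIV \<phi>" "compact (closure {x. \<phi> x \<noteq> 0})"
      "\<And>x. 0 \<le> \<phi> x" "\<And>x. \<phi> x \<noteq> 0 \<longleftrightarrow> x \<in> V"
      by (rule bump_function[OF V]) blast
    let ?g = "\<lambda>r \<omega>. ennreal (case_option 0 \<phi> (coord X (ennreal r) \<omega>))"
    have [measurable]: "\<phi> \<in> borel_measurable borel"
      using \<phi>(1) by (rule borel_measurable_continuous_onI)
    have "(\<lambda>(\<omega>, s). ?g (min (max 0 s) t) \<omega>) \<in> borel_measurable ?N"
    proof (rule measurable_right_limit[OF _ _ t])
      fix r assume "0 \<le> r" "r \<le> t"
      then have [measurable]: "coord X (ennreal r) \<in> natural_filtration X (ennreal t) \<rightarrow>\<^sub>M borel_cemetery"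
        by (intro measurable_coord ennreal_leI)
      show "?g r \<in> borel_measurable (natural_filtration X (ennreal t))"
        using measurable_compose[OF _ measurable_case_option_zero, of "coord X (ennreal r)" "natural_filtration X (ennreal t)" \<phi>]
        by measurable
    next
      fix \<omega> s assume s: "0 \<le> s" "s < t"
      have "limitin cemetery_topology (\<lambda>n. coord X (ennreal (round_up n t s)) \<omega>) (coord X (ennreal s) \<omega>) sequentially"
        unfolding limitin_def
      proof (intro conjI allI impI)
        have r: "limitin cemetery_topology (\<lambda>s. coord X s \<omega>) (coord X (ennreal s) \<omega>) (at_right (ennreal s))"
          by (rule right_continuous) simp
        then show "coord X (ennreal s) \<omega> \<in> topspace cemetery_topology" by (simp add: limitin_def)
        fix U assume "openin cemetery_topology U \<and> coord X (ennreal s) \<omega> \<in> U"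
        then have "\<forall>\<^sub>F q in at_right (ennreal s). coord X q \<omega> \<in> U"
          using r by (simp add: limitin_def)
        then show "\<forall>\<^sub>F n in sequentially. coord X (ennreal (round_up n t s)) \<omega> \<in> U"
          by (rule eventually_compose_filterlim[OF _ round_up_at_right[OF s]])
      qed
      then show "(\<lambda>n. ?g (round_up n t s) \<omega>) \<longlonglongrightarrow> ?g s \<omega>"
        by (intro tendsto_ennrealI tendsto_case_option_zero \<phi>)
    qed
    then have m: "(\<lambda>(\<omega>, s). ?g (min (max 0 s) t) \<omega>) -` {0<..} \<inter> space ?N \<in> sets ?N"
      by (rule measurable_sets) simp
    have "case_option 0 \<phi> z > 0 \<longleftrightarrow> z \<in> Some ` V" for z
      using \<phi>(3,4) by (cases z) (auto simp: less_le)
    then have "?f -` (Some ` V) = (\<lambda>(\<omega>, s). ?g (min (max 0 s) t) \<omega>) -` {0<..}"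
      unfolding set_eq_iff split_paired_All vimage_eq f_eq by simp
    with m show ?thesis by simp
  qed
  have opn: "?f -` (Some ` U) \<inter> space ?N \<in> sets ?N" if U: "open U" for U
  proof -
    obtain C where C: "countable C" "\<And>V. V \<in> C \<Longrightarrow> open V \<and> compact (closure V)" "\<Union>C = U"
      using relatively_compact_open_cover[OF locally_compact_space U] by blast
    have "?f -` (Some ` U) \<inter> space ?N = (\<Union>V\<in>C. ?f -` (Some ` V) \<inter> space ?N)"
      unfolding C(3)[symmetric] by blast
    also have "\<dots> \<in> sets ?N" using C base by (intro sets.countable_UN'') auto
    finally show ?thesis .
  qed
  show ?thesis
  proof (rule measurable_option_cases)
    fix B :: "'e set" assume "B \<in> sets borel"
    then have "B \<in> sigma_sets UNIV {S. open S}" by (simp add: borel_def)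
    then show "?f -` (Some ` B) \<inter> space ?N \<in> sets ?N"
    proof (induction rule: sigma_sets.induct)
      case (Basic U) then show ?case using opn by simp
    next
      case Empty then show ?case by simp
    next
      case (Compl B)
      have "?f -` (Some ` (UNIV - B)) \<inter> space ?N = (?f -` (Some ` UNIV) \<inter> space ?N) - (?f -` (Some ` B) \<inter> space ?N)"
        by (auto simp: image_iff)
      also have "\<dots> \<in> sets ?N" using opn[of UNIV] Compl by auto
      finally show ?case .
    next
      case (Union B)
      have "?f -` (Some ` (\<Union>i. B i)) \<inter> space ?N = (\<Union>i. ?f -` (Some ` B i) \<inter> space ?N)" by blast
      also have "\<dots> \<in> sets ?N" using Union by (intro sets.countable_UN) auto
      finally show ?case .
    qed
  qed
qed

text \<open>Choosing \<open>nat \<lceil>s\<rceil>\<close> as horizon for time \<open>s\<close>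
  reduces the claim to countably many bounded horizons.\<close>

lemma measurable_coord_joint:
  "(\<lambda>(\<omega>, s). coord X (ennreal s) \<omega>) \<in> natural_filtration X \<infinity> \<Otimes>\<^sub>M borel \<rightarrow>\<^sub>M borel_cemetery"
proof -
  have "(\<lambda>x. (\<lambda>i (\<omega>, s). coord X (ennreal (min s (real i))) \<omega>) (nat \<lceil>snd x\<rceil>) x)
      \<in> natural_filtration X \<infinity> \<Otimes>\<^sub>M (borel :: real measure) \<rightarrow>\<^sub>M borel_cemetery"
  proof (rule measurable_compose_countable)
    fix i
    have "(\<lambda>\<omega>. \<omega>) \<in> natural_filtration X \<infinity> \<rightarrow>\<^sub>M natural_filtration X (ennreal (real i))"
      using natural_filtration_mono[of "ennreal (real i)" \<infinity> X] by (intro measurableI) auto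
    from measurable_compose[OF measurable_fst this, of "borel :: real measure"]
    have "(\<lambda>x. (fst x, snd x)) \<in> natural_filtration X \<infinity> \<Otimes>\<^sub>M (borel :: real measure) \<rightarrow>\<^sub>M
        natural_filtration X (ennreal (real i)) \<Otimes>\<^sub>M borel"
      by (intro measurable_Pair measurable_snd)
    from measurable_compose[OF this measurable_coord_progressive[of "real i"]] show "(\<lambda>(\<omega>, s). coord X (ennreal (min s (real i))) \<omega>) \<in> natural_filtration X \<infinity> \<Otimes>\<^sub>M (borel :: real measure) \<rightarrow>\<^sub>M borel_cemetery"
      by (simp add: case_prod_beta')
  qed measurable
  moreover have "ennreal (min s (real (nat \<lceil>s\<rceil>))) = ennreal s" for s
    using real_nat_ceiling_ge[of s] by (simp add: min_def)
  ultimately show ?thesis by (simp add: case_prod_beta')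
qed

lemma measurable_coord_path [measurable]: "(\<lambda>s. coord X (ennreal s) \<omega>) \<in> borel \<rightarrow>\<^sub>M borel_cemetery"
  using measurable_compose[OF measurable_Pair1' measurable_coord_joint, of \<omega>] by simp

lemma measurable_alive [measurable]: "alive X \<omega> \<in> sets borel"
proof -
  have "{s. coord X (ennreal s) \<omega> = None} \<in> sets borel"
    using measurable_sets[OF measurable_coord_path None_in_borel_cemetery] by (simp add: vimage_def)
  then have "{0..} - {s. coord X (ennreal s) \<omega> = None} \<in> sets borel" by (intro sets.Diff) auto
  moreover have "alive X \<omega> = {0..} - {s. coord X (ennreal s) \<omega> = None}" by (auto simp: alive_iff)
  ultimately show ?thesis by simp
qed

end

section \<open>Stieltjes integrals along a path\<close>

lemma Int_stable_Ioc: "Int_stable (range (\<lambda>(a, b). {a<..b::real}))"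
proof (rule Int_stableI)
  fix S T assume "S \<in> range (\<lambda>(a, b). {a<..b::real})" "T \<in> range (\<lambda>(a, b). {a<..b::real})"
  then obtain a b c d where "S = {a<..b}" "T = {c<..d}" by auto
  then have "S \<inter> T = {max a c<..min b d}" by auto
  then show "S \<inter> T \<in> range (\<lambda>(a, b). {a<..b::real})" by auto
qed

lemma sets_borel_Ioc: "sets (borel :: real measure) = sigma_sets UNIV (range (\<lambda>(a, b). {a<..b::real}))"
  by (subst borel_sigma_sets_Ioc) (rule sets_measure_of, simp)

lemma UN_Ioc_eq_UNIV: "(\<Union>n. {- real n<..real n}) = UNIV"
proof (rule UNIV_eq_I[symmetric])
  fix x :: real
  obtain n where "\<bar>x\<bar> < real n" using reals_Archimedean2 by blast
  then have "x \<in> {- real n<..real n}" by auto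
  then show "x \<in> (\<Union>i. {- real i<..real i})" by blast
qed

lemma eq_interval_measure:
  fixes F :: "real \<Rightarrow> real"
  assumes F: "mono F" "continuous_on UNIV F" and N: "sets N = sets borel"
    and eq: "\<And>a b. a \<le> b \<Longrightarrow> emeasure N {a<..b} = ennreal (F b - F a)"
  shows "N = interval_measure F"
proof (rule measure_eqI_generator_eq[where E="range (\<lambda>(a, b). {a<..b::real})" and \<Omega>=UNIV and A="\<lambda>i. {- real i<..real i}"])
  have cont: "continuous (at_right a) F" for a
    using F(2) by (simp add: continuous_on_eq_continuous_at continuous_at_imp_continuous_at_within)
  have *: "emeasure N {a<..b} = emeasure (interval_measure F) {a<..b}" for a b
    using eq[of a b] emeasure_interval_measure_Ioc[of a b F] monoD[OF F(1)] cont
    by (cases "a \<le> b") auto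
  show "emeasure N S = emeasure (interval_measure F) S" if "S \<in> range (\<lambda>(a, b). {a<..b::real})" for S
    using that * by auto
  show "Int_stable (range (\<lambda>(a, b). {a<..b::real}))" by (rule Int_stable_Ioc)
  show "sets N = sigma_sets UNIV (range (\<lambda>(a, b). {a<..b::real}))"
    "sets (interval_measure F) = sigma_sets UNIV (range (\<lambda>(a, b). {a<..b::real}))"
    using N sets_borel_Ioc by auto
  show "(\<Union>i. {- real i<..real i}) = UNIV" by (rule UN_Ioc_eq_UNIV)
  show "emeasure N {- real i<..real i} \<noteq> \<infinity>" for i using eq[of "- real i" "real i"] by simp
qed auto

text \<open>The properties of a single path on which the Stieltjes calculus rests, separated from
  the almost sure quantifier of \<open>strict_pcaf\<close>.\<close>

definition pcaf_path ::
    "('w, 'e) markov_process \<Rightarrow> (ennreal \<Rightarrow> 'w \<Rightarrow> ennreal) \<Rightarrow> 'w \<Rightarrow> bool" where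
  "pcaf_path X A \<omega> \<longleftrightarrow> A 0 \<omega> = 0 \<and> continuous_on {..<\<infinity>} (\<lambda>t. A t \<omega>) \<and>
     (\<forall>t<lifetime X \<omega>. A t \<omega> < \<infinity>) \<and>
     (\<forall>s<\<infinity>. \<forall>t<\<infinity>. A (s + t) \<omega> = A s \<omega> + A t (translate X s \<omega>))"

text \<open>On a good path with \<open>r\<close> before the lifetime this is a continuous
  distribution function. It is zero at negative times because \<open>ennreal\<close> truncates there
  and \<open>A 0\<close> vanishes.\<close>

definition stopped :: "(ennreal \<Rightarrow> 'w \<Rightarrow> ennreal) \<Rightarrow> real \<Rightarrow> 'w \<Rightarrow> real \<Rightarrow> real" where
  "stopped A r \<omega> t = enn2real (A (ennreal (min t r)) \<omega>)"

definition stieltjes ::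
    "('w, 'e) markov_process \<Rightarrow> (ennreal \<Rightarrow> 'w \<Rightarrow> ennreal) \<Rightarrow> ('e \<Rightarrow> ennreal) \<Rightarrow> real \<Rightarrow> 'w \<Rightarrow> ennreal" where
  "stieltjes X A f r \<omega> =
     (\<integral>\<^sup>+t\<in>{0..r}. case_option 0 f (coord X (ennreal t) \<omega>) \<partial>interval_measure (stopped A r \<omega>))"

text \<open>The functional \<open>f . A\<close> at time \<open>T\<close>. The supremum runs over
  times at which the path is alive, since \<open>A\<close> may be infinite at the lifetime; from the
  lifetime on the value stays constant.\<close>

definition functional_up_to ::
    "('w, 'e) markov_process \<Rightarrow> (ennreal \<Rightarrow> 'w \<Rightarrow> ennreal) \<Rightarrow> ('e \<Rightarrow> ennreal) \<Rightarrow> real \<Rightarrow> 'w \<Rightarrow> ennreal" where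
  "functional_up_to X A f T \<omega> = (SUP r\<in>{r \<in> alive X \<omega>. r \<le> T}. stieltjes X A f r \<omega>)"

lemma functional_integral_stieltjes:
  "functional_integral X A \<omega> (\<lambda>t. case_option 0 f (coord X (ennreal t) \<omega>)) = (SUP r\<in>alive X \<omega>. stieltjes X A f r \<omega>)"
  by (simp add: functional_integral_def stieltjes_def stopped_def[abs_def])

text \<open>Every alive time lies below a natural number. This puts the potential of the Revuz
  correspondence into the form \<open>SUP n. J (real n)\<close> in which potentials of additive
  functionals are compared.\<close>

lemma functional_integral_SUP:
  "functional_integral X A \<omega> (\<lambda>t. case_option 0 f (coord X (ennreal t) \<omega>)) = (SUP n. functional_up_to X A f (real n) \<omega>)"
  unfolding functional_integral_stieltjes
proof (rule antisym)
  show "(SUP r\<in>alive X \<omega>. stieltjes X A f r \<omega>) \<le> (SUP n. functional_up_to X A f (real n) \<omega>)"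
  proof (rule SUP_least)
    fix r assume "r \<in> alive X \<omega>"
    moreover obtain n where "r \<le> real n" using real_arch_simple by blast
    ultimately have "stieltjes X A f r \<omega> \<le> functional_up_to X A f (real n) \<omega>"
      unfolding functional_up_to_def by (intro SUP_upper) auto
    then show "stieltjes X A f r \<omega> \<le> (SUP n. functional_up_to X A f (real n) \<omega>)"
      by (rule order_trans) (rule SUP_upper, simp)
  qed
  show "(SUP n. functional_up_to X A f (real n) \<omega>) \<le> (SUP r\<in>alive X \<omega>. stieltjes X A f r \<omega>)"
    unfolding functional_up_to_def by (intro SUP_least SUP_upper) auto
qed

lemma pcaf_path_mono:
  assumes "pcaf_path X A \<omega>" "r \<le> t" "t < \<infinity>"
  shows "A r \<omega> \<le> A t \<omega>"
proof -
  have "A (r + (t - r)) \<omega> = A r \<omega> + A (t - r) (translate X r \<omega>)"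
    using assms unfolding pcaf_path_def by (metis diff_le_self_ennreal le_less_trans)
  then show ?thesis using assms(2) by (simp add: add_diff_inverse_ennreal)
qed

lemma pcaf_path_real:
  assumes "pcaf_path X A \<omega>" "t \<in> alive X \<omega>"
  shows "A (ennreal t) \<omega> = ennreal (enn2real (A (ennreal t) \<omega>))"
  using assms by (auto simp: pcaf_path_def alive_def)

lemma stopped_mono:
  assumes A: "pcaf_path X A \<omega>" and t: "t \<in> alive X \<omega>"
  shows "mono (stopped A t \<omega>)"
proof (rule monoI)
  fix a b :: real assume "a \<le> b"
  then have "A (ennreal (min a t)) \<omega> \<le> A (ennreal (min b t)) \<omega>"
    by (intro pcaf_path_mono[OF A] ennreal_leI) auto
  moreover have "A (ennreal (min b t)) \<omega> \<le> A (ennreal t) \<omega>"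
    by (intro pcaf_path_mono[OF A] ennreal_leI) auto
  moreover have "A (ennreal t) \<omega> < top" using A t by (auto simp: pcaf_path_def alive_def)
  ultimately show "stopped A t \<omega> a \<le> stopped A t \<omega> b"
    unfolding stopped_def by (intro enn2real_mono) (auto intro: le_less_trans)
qed

lemma stopped_continuous:
  assumes A: "pcaf_path X A \<omega>" and t: "t \<in> alive X \<omega>"
  shows "continuous_on UNIV (stopped A t \<omega>)"
proof -
  have c: "continuous_on UNIV (\<lambda>s. A (ennreal (min s t)) \<omega>)"
    by (rule continuous_on_compose2[of "{..<\<infinity>}" "\<lambda>t. A t \<omega>"])
       (use A in \<open>auto simp: pcaf_path_def intro!: continuous_on_ennreal continuous_intros\<close>)
  show ?thesis
    unfolding continuous_on_def stopped_def
  proof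
    fix s :: real assume "s \<in> UNIV"
    have "A (ennreal (min s t)) \<omega> \<le> A (ennreal t) \<omega>"
      by (intro pcaf_path_mono[OF A] ennreal_leI) auto
    moreover have "A (ennreal t) \<omega> < top" using A t by (auto simp: pcaf_path_def alive_def)
    ultimately have "A (ennreal (min s t)) \<omega> \<noteq> top" by auto
    then have eq: "ennreal (enn2real (A (ennreal (min s t)) \<omega>)) = A (ennreal (min s t)) \<omega>"
      by (simp add: less_top)
    have "((\<lambda>s. A (ennreal (min s t)) \<omega>) \<longlongrightarrow> ennreal (enn2real (A (ennreal (min s t)) \<omega>))) (at s within UNIV)"
      unfolding eq using c by (simp add: continuous_on_def)
    then show "((\<lambda>s. enn2real (A (ennreal (min s t)) \<omega>)) \<longlongrightarrow> enn2real (A (ennreal (min s t)) \<omega>)) (at s within UNIV)"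
      by (rule tendsto_enn2real) simp
  qed
qed

lemma emeasure_stopped_Ioc:
  assumes A: "pcaf_path X A \<omega>" and t: "t \<in> alive X \<omega>" and "a \<le> b"
  shows "emeasure (interval_measure (stopped A t \<omega>)) {a<..b} = ennreal (stopped A t \<omega> b - stopped A t \<omega> a)"
  using assms(3) monoD[OF stopped_mono[OF A t]] stopped_continuous[OF A t]
  by (intro emeasure_interval_measure_Ioc)
     (auto simp: continuous_on_eq_continuous_at continuous_at_imp_continuous_at_within)

text \<open>Stopping at \<open>r\<close> freezes the distribution function of the longer path at its
  value at \<open>r\<close>, so it removes exactly the mass beyond \<open>r\<close>.\<close>

lemma stopped_restrict:
  assumes A: "pcaf_path X A \<omega>" and t: "t \<in> alive X \<omega>" and r: "0 \<le> r" "r \<le> t"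
  shows "density (interval_measure (stopped A t \<omega>)) (indicator {..r}) = interval_measure (stopped A r \<omega>)"
proof (rule eq_interval_measure)
  have r': "r \<in> alive X \<omega>" using alive_downward[OF t r] .
  show "mono (stopped A r \<omega>)" "continuous_on UNIV (stopped A r \<omega>)"
    using stopped_mono[OF A r'] stopped_continuous[OF A r'] by auto
  fix a b :: real assume ab: "a \<le> b"
  have [simp]: "stopped A t \<omega> (min c r) = stopped A r \<omega> c" for c
    using r by (simp add: stopped_def min.absorb1 min.assoc)
  have "emeasure (density (interval_measure (stopped A t \<omega>)) (indicator {..r})) {a<..b} =
      emeasure (interval_measure (stopped A t \<omega>)) ({..r} \<inter> {a<..b})"
    by (subst emeasure_density) (auto simp: indicator_inter_arith[symmetric])
  also have "\<dots> = emeasure (interval_measure (stopped A t \<omega>)) {min a r<..min b r}"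
  proof (cases "a \<le> r")
    case True
    then have "{..r} \<inter> {a<..b} = {min a r<..min b r}" by auto
    then show ?thesis by simp
  next
    case False
    then have *: "{..r} \<inter> {a<..b} = {}" "min a r = r" "min b r = r" using ab by auto
    show ?thesis unfolding * by simp
  qed
  also have "\<dots> = ennreal (stopped A t \<omega> (min b r) - stopped A t \<omega> (min a r))"
    using ab by (intro emeasure_stopped_Ioc[OF A t]) auto
  finally show "emeasure (density (interval_measure (stopped A t \<omega>)) (indicator {..r})) {a<..b} =
      ennreal (stopped A r \<omega> b - stopped A r \<omega> a)" by simp
qed simp

lemma pcaf_path_translate_real:
  assumes A: "pcaf_path X A \<omega>" and "s + t \<in> alive X \<omega>" and st: "0 \<le> s" "0 \<le> t"
  shows "enn2real (A (ennreal t) (translate X (ennreal s) \<omega>)) = enn2real (A (ennreal (s + t)) \<omega>) - enn2real (A (ennreal s) \<omega>)"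
proof -
  have s: "s \<in> alive X \<omega>" using alive_downward[OF assms(2)] st by auto
  have "A (ennreal s + ennreal t) \<omega> = A (ennreal s) \<omega> + A (ennreal t) (translate X (ennreal s) \<omega>)"
    using A unfolding pcaf_path_def by simp
  then have "ennreal (enn2real (A (ennreal (s + t)) \<omega>)) =
      ennreal (enn2real (A (ennreal s) \<omega>)) + A (ennreal t) (translate X (ennreal s) \<omega>)"
    using pcaf_path_real[OF A s] pcaf_path_real[OF A assms(2)] st by (simp add: ennreal_plus)
  then have "A (ennreal t) (translate X (ennreal s) \<omega>) =
      ennreal (enn2real (A (ennreal (s + t)) \<omega>)) - ennreal (enn2real (A (ennreal s) \<omega>))"
    by (metis ennreal_add_diff_cancel_left ennreal_neq_top infinity_ennreal_def)
  also have "\<dots> = ennreal (enn2real (A (ennreal (s + t)) \<omega>) - enn2real (A (ennreal s) \<omega>))"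
    by (rule ennreal_minus) simp
  finally have eq: "A (ennreal t) (translate X (ennreal s) \<omega>) =
      ennreal (enn2real (A (ennreal (s + t)) \<omega>) - enn2real (A (ennreal s) \<omega>))" .
  have "stopped A (s + t) \<omega> s \<le> stopped A (s + t) \<omega> (s + t)"
    using st by (intro monoD[OF stopped_mono[OF A assms(2)]]) simp
  then show ?thesis using st unfolding eq by (simp add: stopped_def)
qed

text \<open>The \<open>max\<close> accounts for the truncation of times: a negative \<open>q\<close>
  counts as time zero of the shifted path. The cut at \<open>t\<close> becomes the cut at
  \<open>s + t\<close> inside \<open>stopped\<close>.\<close>

lemma stopped_translate:
  assumes A: "pcaf_path X A \<omega>" and st: "s + t \<in> alive X \<omega>" "0 \<le> s" "0 \<le> t"
  shows "stopped A t (translate X (ennreal s) \<omega>) q = stopped A (s + t) \<omega> (max s (q + s)) - stopped A (s + t) \<omega> s"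
proof -
  have pos: "ennreal (max 0 r) = ennreal r" for r :: real
    by (auto simp: max_def ennreal_neg)
  have al: "s + max 0 (min q t) \<in> alive X \<omega>" using st by (intro alive_downward[OF st(1)]) auto
  have "stopped A t (translate X (ennreal s) \<omega>) q = enn2real (A (ennreal (max 0 (min q t))) (translate X (ennreal s) \<omega>))"
    unfolding stopped_def pos ..
  also have "\<dots> = enn2real (A (ennreal (s + max 0 (min q t))) \<omega>) - enn2real (A (ennreal s) \<omega>)"
    using st by (intro pcaf_path_translate_real[OF A al]) auto
  also have "s + max 0 (min q t) = min (max s (q + s)) (s + t)" using st by auto
  finally show ?thesis using st by (simp add: stopped_def)
qed

text \<open>Additivity of \<open>A\<close> says that the increments of the shifted path are those of
  the original path after \<open>s\<close>, so the two measures agree on half-open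
  intervals.\<close>

lemma stopped_shift:
  assumes A: "pcaf_path X A \<omega>" and st: "s + t \<in> alive X \<omega>" "0 \<le> s" "0 \<le> t"
  shows "distr (density (interval_measure (stopped A (s + t) \<omega>)) (indicator {s<..})) borel (\<lambda>q. q - s) =
    interval_measure (stopped A t (translate X (ennreal s) \<omega>))" (is "?N = _")
proof (rule eq_interval_measure)
  let ?M = "interval_measure (stopped A (s + t) \<omega>)"
  note eq = stopped_translate[OF A st]
  show "mono (stopped A t (translate X (ennreal s) \<omega>))"
    using monoD[OF stopped_mono[OF A st(1)]] by (intro monoI) (auto simp: eq)
  have "continuous_on UNIV (\<lambda>q. stopped A (s + t) \<omega> (max s (q + s)) - stopped A (s + t) \<omega> s)"
    by (intro continuous_intros continuous_on_compose2[OF stopped_continuous[OF A st(1)]]) auto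
  then show "continuous_on UNIV (stopped A t (translate X (ennreal s) \<omega>))"
    by (simp add: eq[abs_def])
  fix a b :: real assume ab: "a \<le> b"
  have "emeasure ?N {a<..b} = emeasure (density ?M (indicator {s<..})) {a + s<..b + s}"
  proof -
    have "(\<lambda>q. q - s) -` {a<..b} = {a + s<..b + s}" by auto
    then show ?thesis by (subst emeasure_distr) auto
  qed
  also have "\<dots> = emeasure ?M ({s<..} \<inter> {a + s<..b + s})"
    by (subst emeasure_density) (auto simp: indicator_inter_arith[symmetric])
  also have "{s<..} \<inter> {a + s<..b + s} = {max s (a + s)<..max s (b + s)}" by auto
  also have "emeasure ?M \<dots> = ennreal (stopped A (s + t) \<omega> (max s (b + s)) - stopped A (s + t) \<omega> (max s (a + s)))"
    using ab by (intro emeasure_stopped_Ioc[OF A st(1)]) auto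
  finally show "emeasure ?N {a<..b} = ennreal (stopped A t (translate X (ennreal s) \<omega>) b - stopped A t (translate X (ennreal s) \<omega>) a)"
    by (simp add: eq)
qed simp

section \<open>Integrals of functions of the position along one path\<close>

context lc_hunt_process
begin

lemma measurable_f_path [measurable]:
  "f \<in> borel_measurable borel \<Longrightarrow> (\<lambda>t. case_option 0 f (coord X (ennreal t) \<omega>) :: ennreal) \<in> borel_measurable borel"
  by (rule measurable_compose[OF measurable_coord_path measurable_case_option_zero])

text \<open>All integrals up to times before \<open>t\<close> are thereby expressed under one
  measure, that of the path stopped at \<open>t\<close>, and can be compared.\<close>

lemma stieltjes_eq:
  assumes A: "pcaf_path X A \<omega>" and t: "t \<in> alive X \<omega>" and r: "0 \<le> r" "r \<le> t"
    and [measurable]: "f \<in> borel_measurable borel"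
  shows "stieltjes X A f r \<omega> =
    (\<integral>\<^sup>+q\<in>{0..r}. case_option 0 f (coord X (ennreal q) \<omega>) \<partial>interval_measure (stopped A t \<omega>))"
  unfolding stieltjes_def stopped_restrict[OF A t r, symmetric]
  by (subst nn_integral_density) (auto intro!: nn_integral_cong simp: indicator_def)

lemma stieltjes_mono:
  assumes A: "pcaf_path X A \<omega>" and t: "t \<in> alive X \<omega>" and r: "0 \<le> r" "r \<le> t"
    and f: "f \<in> borel_measurable borel"
  shows "stieltjes X A f r \<omega> \<le> stieltjes X A f t \<omega>"
  unfolding stieltjes_eq[OF A t r f] stieltjes_def[of X A f t \<omega>] using r
  by (intro nn_integral_mono mult_left_mono) (auto simp: indicator_def)

text \<open>The interval is split at \<open>s\<close>: the measure restricted to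
  \<open>(s, s + t]\<close> and shifted back by \<open>s\<close> is the measure of the shifted
  path.\<close>

lemma stieltjes_add:
  assumes A: "pcaf_path X A \<omega>" and st: "s + t \<in> alive X \<omega>" "0 \<le> s" "0 \<le> t"
    and [measurable]: "f \<in> borel_measurable borel"
  shows "stieltjes X A f (s + t) \<omega> = stieltjes X A f s \<omega> + stieltjes X A f t (translate X (ennreal s) \<omega>)"
proof -
  let ?M = "interval_measure (stopped A (s + t) \<omega>)"
  let ?g = "\<lambda>q. case_option 0 f (coord X (ennreal q) \<omega>)"
  have "stieltjes X A f t (translate X (ennreal s) \<omega>) = (\<integral>\<^sup>+q\<in>{s<..s + t}. ?g q \<partial>?M)"
  proof -
    have "stieltjes X A f t (translate X (ennreal s) \<omega>) =
        (\<integral>\<^sup>+q. case_option 0 f (coord X (ennreal (q - s)) (translate X (ennreal s) \<omega>)) * indicator {0..t} (q - s)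
          \<partial>density ?M (indicator {s<..}))"
      unfolding stieltjes_def stopped_shift[OF A st, symmetric] by (subst nn_integral_distr) auto
    also have "\<dots> = (\<integral>\<^sup>+q. indicator {s<..} q *
        (case_option 0 f (coord X (ennreal (q - s)) (translate X (ennreal s) \<omega>)) * indicator {0..t} (q - s)) \<partial>?M)"
      by (subst nn_integral_density) auto
    also have "\<dots> = (\<integral>\<^sup>+q\<in>{s<..s + t}. ?g q \<partial>?M)"
    proof (rule nn_integral_cong)
      fix q :: real
      have "ennreal (q - s) + ennreal s = ennreal q" if "s < q"
        using that st by (simp flip: ennreal_plus)
      then show "indicator {s<..} q *
          (case_option 0 f (coord X (ennreal (q - s)) (translate X (ennreal s) \<omega>)) * indicator {0..t} (q - s)) =
          ?g q * indicator {s<..s + t} q"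
        by (auto simp: indicator_def translate)
    qed
    finally show ?thesis .
  qed
  moreover have "stieltjes X A f s \<omega> = (\<integral>\<^sup>+q\<in>{0..s}. ?g q \<partial>?M)"
    using st by (intro stieltjes_eq[OF A st(1)]) auto
  moreover have "stieltjes X A f (s + t) \<omega> = (\<integral>\<^sup>+q. ?g q * indicator {0..s} q + ?g q * indicator {s<..s + t} q \<partial>?M)"
    unfolding stieltjes_def using st by (intro nn_integral_cong) (auto simp: indicator_def)
  ultimately show ?thesis by (simp add: nn_integral_add)
qed

lemma stieltjes_le:
  assumes A: "pcaf_path X A \<omega>" and t: "t \<in> alive X \<omega>" and f: "\<And>x. f x \<le> 1"
  shows "stieltjes X A f t \<omega> \<le> A (ennreal t) \<omega>"
proof -
  let ?M = "interval_measure (stopped A t \<omega>)"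
  have t0: "0 \<le> t" using t by (simp add: alive_def)
  have f': "case_option 0 f z \<le> 1" for z using f by (cases z) auto
  \<comment> \<open>Starting the half-open interval at \<open>-1\<close> makes it cover time zero,
    and negative times carry no mass.\<close>
  have "stieltjes X A f t \<omega> \<le> (\<integral>\<^sup>+q. indicator {-1<..t} q \<partial>?M)"
    unfolding stieltjes_def by (intro nn_integral_mono) (auto simp: indicator_def f')
  also have "\<dots> = ennreal (stopped A t \<omega> t - stopped A t \<omega> (-1))"
    using emeasure_stopped_Ioc[OF A t, of "-1" t] t0 by simp
  also have "\<dots> = A (ennreal t) \<omega>"
    using A t0 pcaf_path_real[OF A t] by (simp add: stopped_def ennreal_neg pcaf_path_def)
  finally show ?thesis .
qed

lemma stieltjes_one:
  assumes A: "pcaf_path X A \<omega>" and t: "t \<in> alive X \<omega>"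
  shows "stieltjes X A (\<lambda>_. 1) t \<omega> = A (ennreal t) \<omega>"
proof -
  let ?M = "interval_measure (stopped A t \<omega>)"
  have t0: "0 \<le> t" using t by (simp add: alive_def)
  have "emeasure ?M {-1<..<0} = 0"
  proof -
    have "emeasure ?M {-1<..0} = 0"
      using emeasure_stopped_Ioc[OF A t, of "-1" 0] t0 by (simp add: stopped_def ennreal_neg)
    moreover have "emeasure ?M {-1<..<0} \<le> emeasure ?M {-1<..0}" by (intro emeasure_mono) auto
    ultimately show ?thesis by simp
  qed
  then have "AE q in ?M. q \<notin> {-1<..<0}" by (intro AE_not_in null_setsI) auto
  moreover have "case_option 0 (\<lambda>_. 1) (coord X (ennreal q) \<omega>) = (1 :: ennreal)" if "0 \<le> q" "q \<le> t" for q
    using alive_downward[OF t that] by (auto simp: alive_iff)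
  ultimately have "stieltjes X A (\<lambda>_. 1) t \<omega> = (\<integral>\<^sup>+q. indicator {-1<..t} q \<partial>?M)"
    unfolding stieltjes_def by (intro nn_integral_cong_AE) (auto elim!: eventually_mono simp: indicator_def)
  also have "\<dots> = ennreal (stopped A t \<omega> t - stopped A t \<omega> (-1))"
    using emeasure_stopped_Ioc[OF A t, of "-1" t] t0 by simp
  also have "\<dots> = A (ennreal t) \<omega>"
    using A t0 pcaf_path_real[OF A t] by (simp add: stopped_def ennreal_neg pcaf_path_def)
  finally show ?thesis .
qed

lemma functional_up_to_alive:
  assumes A: "pcaf_path X A \<omega>" and T: "T \<in> alive X \<omega>" and f: "f \<in> borel_measurable borel"
  shows "functional_up_to X A f T \<omega> = stieltjes X A f T \<omega>"
  unfolding functional_up_to_def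
proof (rule antisym)
  show "(SUP r\<in>{r \<in> alive X \<omega>. r \<le> T}. stieltjes X A f r \<omega>) \<le> stieltjes X A f T \<omega>"
    by (intro SUP_least stieltjes_mono[OF A T _ _ f]) (auto simp: alive_def)
  show "stieltjes X A f T \<omega> \<le> (SUP r\<in>{r \<in> alive X \<omega>. r \<le> T}. stieltjes X A f r \<omega>)"
    using T by (intro SUP_upper) auto
qed

lemma functional_up_to_dead:
  assumes "T \<notin> alive X \<omega>" "0 \<le> T"
  shows "functional_up_to X A f T \<omega> = (SUP r\<in>alive X \<omega>. stieltjes X A f r \<omega>)"
proof -
  have "{r \<in> alive X \<omega>. r \<le> T} = alive X \<omega>"
    using assms alive_downward[of _ X \<omega> T] by (auto simp: linorder_le_cases) (metis linear)
  then show ?thesis by (simp add: functional_up_to_def)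
qed

lemma alive_translate:
  "0 \<le> s \<Longrightarrow> 0 \<le> t \<Longrightarrow> t \<in> alive X (translate X (ennreal s) \<omega>) \<longleftrightarrow> s + t \<in> alive X \<omega>"
  by (auto simp: alive_iff translate add.commute simp flip: ennreal_plus)

lemma alive_right_open:
  assumes "t \<in> alive X \<omega>"
  obtains r where "t < r" "r \<in> alive X \<omega>"
proof -
  have "ennreal t < lifetime X \<omega>" using assms by (simp add: alive_def)
  then obtain z where z: "ennreal t < z" "z < lifetime X \<omega>" using dense by blast
  then obtain r where r: "z = ennreal r" "0 \<le> r" by (cases z) auto
  then show thesis using z assms that[of r] by (auto simp: alive_def ennreal_less_iff)
qed

text \<open>If the path is alive at \<open>s\<close>, each integral up to \<open>s + r\<close>
  splits at \<open>s\<close>, and a constant may be pulled out of a supremum over a nonempty set. If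
  it is dead at \<open>s\<close>, the shifted path contributes nothing and the value no longer
  changes.\<close>

lemma functional_up_to_add:
  assumes A: "pcaf_path X A \<omega>" and st: "0 \<le> s" "0 \<le> t" and f: "f \<in> borel_measurable borel"
  shows "functional_up_to X A f (s + t) \<omega> = functional_up_to X A f s \<omega> + functional_up_to X A f t (translate X (ennreal s) \<omega>)"
proof (cases "s \<in> alive X \<omega>")
  case True
  let ?\<theta> = "translate X (ennreal s) \<omega>"
  have "functional_up_to X A f (s + t) \<omega> = (SUP r\<in>{r \<in> alive X ?\<theta>. r \<le> t}. stieltjes X A f (s + r) \<omega>)"
    unfolding functional_up_to_def
  proof (rule antisym)
    show "(SUP r\<in>{r \<in> alive X \<omega>. r \<le> s + t}. stieltjes X A f r \<omega>) \<le> (SUP r\<in>{r \<in> alive X ?\<theta>. r \<le> t}. stieltjes X A f (s + r) \<omega>)"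
    proof (rule SUP_mono)
      fix r assume r: "r \<in> {r \<in> alive X \<omega>. r \<le> s + t}"
      \<comment> \<open>Times \<open>r\<close> before \<open>s\<close> are raised to
        \<open>s\<close>, which can only increase the integral.\<close>
      let ?r = "max 0 (r - s)"
      have "max s r \<in> alive X \<omega>" using True r by (simp add: max_def)
      moreover have sr: "s + ?r = max s r" by auto
      ultimately have "?r \<in> alive X ?\<theta>" using alive_translate[of s ?r \<omega>] st by simp
      moreover have "stieltjes X A f r \<omega> \<le> stieltjes X A f (s + ?r) \<omega>"
        unfolding sr using r True by (intro stieltjes_mono[OF A _ _ _ f]) (auto simp: max_def alive_def)
      ultimately show "\<exists>q\<in>{r \<in> alive X ?\<theta>. r \<le> t}. stieltjes X A f r \<omega> \<le> stieltjes X A f (s + q) \<omega>"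
        using r st by (intro bexI[of _ ?r]) auto
    qed
    show "(SUP r\<in>{r \<in> alive X ?\<theta>. r \<le> t}. stieltjes X A f (s + r) \<omega>) \<le> (SUP r\<in>{r \<in> alive X \<omega>. r \<le> s + t}. stieltjes X A f r \<omega>)"
    proof (rule SUP_mono)
      fix r assume r: "r \<in> {r \<in> alive X ?\<theta>. r \<le> t}"
      then have "0 \<le> r" by (simp add: alive_def)
      then show "\<exists>q\<in>{r \<in> alive X \<omega>. r \<le> s + t}. stieltjes X A f (s + r) \<omega> \<le> stieltjes X A f q \<omega>"
        using r st by (intro bexI[of _ "s + r"]) (auto simp: alive_translate)
    qed
  qed
  also have "\<dots> = (SUP r\<in>{r \<in> alive X ?\<theta>. r \<le> t}. stieltjes X A f s \<omega> + stieltjes X A f r ?\<theta>)"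
  proof (rule SUP_cong[OF refl])
    fix r assume r: "r \<in> {r \<in> alive X ?\<theta>. r \<le> t}"
    then have "0 \<le> r" by (simp add: alive_def)
    then show "stieltjes X A f (s + r) \<omega> = stieltjes X A f s \<omega> + stieltjes X A f r ?\<theta>"
      using r st by (intro stieltjes_add[OF A]) (auto simp: alive_translate f)
  qed
  also have "\<dots> = stieltjes X A f s \<omega> + functional_up_to X A f t ?\<theta>"
  proof -
    have "0 \<in> alive X ?\<theta>" using True st alive_translate[of s 0 \<omega>] by simp
    then have "{r \<in> alive X ?\<theta>. r \<le> t} \<noteq> {}" using st by blast
    then show ?thesis unfolding functional_up_to_def by (rule ennreal_SUP_add_right[symmetric])
  qed
  finally show ?thesis using functional_up_to_alive[OF A True f] by simp
next
  case False
  then have "r \<notin> alive X (translate X (ennreal s) \<omega>)" for r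
    using alive_translate[of s r \<omega>] alive_downward[of "s + r" X \<omega> s] st by (cases "0 \<le> r") (auto simp: alive_def)
  then have "functional_up_to X A f t (translate X (ennreal s) \<omega>) = 0"
    by (simp add: functional_up_to_def bot_ennreal)
  moreover have "s + t \<notin> alive X \<omega>" using False alive_downward[of "s + t" X \<omega> s] st by auto
  ultimately show ?thesis using False st by (simp add: functional_up_to_dead)
qed

lemma functional_up_to_mono: "s \<le> t \<Longrightarrow> functional_up_to X A f s \<omega> \<le> functional_up_to X A f t \<omega>"
  unfolding functional_up_to_def by (rule SUP_subset_mono) auto

lemma functional_up_to_0:
  assumes A: "pcaf_path X A \<omega>" and f: "f \<in> borel_measurable borel" "\<And>x. f x \<le> 1"
  shows "functional_up_to X A f 0 \<omega> = 0"
proof (cases "0 \<in> alive X \<omega>")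
  case True
  have "stieltjes X A f 0 \<omega> \<le> A (ennreal 0) \<omega>" by (rule stieltjes_le[OF A True f(2)])
  then show ?thesis using A by (simp add: functional_up_to_alive[OF A True f(1)] pcaf_path_def)
next
  case False
  then have "alive X \<omega> = {}" using alive_downward[of _ X \<omega> 0] by (auto simp: alive_def)
  then show ?thesis by (simp add: functional_up_to_def bot_ennreal)
qed

text \<open>As \<open>f \<le> 1\<close>, the mass on \<open>(s, t]\<close> bounds the increment of
  \<open>f . A\<close> by that of \<open>A\<close>; continuity is inherited in this way.\<close>

lemma functional_up_to_increment:
  assumes A: "pcaf_path X A \<omega>" and f: "f \<in> borel_measurable borel" "\<And>x. f x \<le> 1"
    and t: "t \<in> alive X \<omega>" and s: "0 \<le> s" "s \<le> t"
  shows "functional_up_to X A f t \<omega> \<le> functional_up_to X A f s \<omega> + ennreal (stopped A t \<omega> t - stopped A t \<omega> s)"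
proof -
  have s': "s \<in> alive X \<omega>" using alive_downward[OF t s] .
  let ?M = "interval_measure (stopped A t \<omega>)"
  let ?g = "\<lambda>q. case_option 0 f (coord X (ennreal q) \<omega>)"
  have g: "?g q \<le> 1" for q using f(2) by (cases "coord X (ennreal q) \<omega>") auto
  note [measurable] = f(1)
  have "stieltjes X A f t \<omega> \<le> (\<integral>\<^sup>+q. ?g q * indicator {0..s} q + indicator {s<..t} q \<partial>?M)"
    unfolding stieltjes_def by (intro nn_integral_mono) (use g s in \<open>auto simp: indicator_def\<close>)
  also have "\<dots> = stieltjes X A f s \<omega> + emeasure ?M {s<..t}"
    unfolding stieltjes_eq[OF A t s f(1)] by (subst nn_integral_add) auto
  also have "emeasure ?M {s<..t} = ennreal (stopped A t \<omega> t - stopped A t \<omega> s)"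
    by (rule emeasure_stopped_Ioc[OF A t s(2)])
  finally show ?thesis by (simp add: functional_up_to_alive[OF A _ f(1)] t s')
qed

lemma functional_up_to_finite:
  assumes A: "pcaf_path X A \<omega>" and f: "f \<in> borel_measurable borel" "\<And>x. f x \<le> 1" and t: "t \<in> alive X \<omega>"
  shows "functional_up_to X A f t \<omega> < \<infinity>"
proof -
  have "functional_up_to X A f t \<omega> \<le> A (ennreal t) \<omega>"
    using stieltjes_le[OF A t f(2)] by (simp add: functional_up_to_alive[OF A t f(1)])
  also have "\<dots> < \<infinity>" using A t by (auto simp: pcaf_path_def alive_def)
  finally show ?thesis .
qed

end

section \<open>Uniqueness of additive functionals\<close>

lemma emeasure_stopped_UNIV:
  assumes A: "pcaf_path X A \<omega>" and r: "r \<in> alive X \<omega>"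
  shows "emeasure (interval_measure (stopped A r \<omega>)) UNIV = A (ennreal r) \<omega>"
proof -
  let ?M = "interval_measure (stopped A r \<omega>)"
  have r0: "0 \<le> r" using r by (simp add: alive_def)
  have "(\<lambda>n. emeasure ?M {- real n<..real n}) \<longlonglongrightarrow> emeasure ?M (\<Union>n. {- real n<..real n})"
    by (rule Lim_emeasure_incseq) (auto simp: incseq_def)
  also have "(\<Union>n. {- real n<..real n}) = UNIV" by (rule UN_Ioc_eq_UNIV)
  finally have 1: "(\<lambda>n. emeasure ?M {- real n<..real n}) \<longlonglongrightarrow> emeasure ?M UNIV" .
  obtain N where N: "r \<le> real N" using real_arch_simple by blast
  have "\<forall>\<^sub>F n in sequentially. A (ennreal r) \<omega> = emeasure ?M {- real n<..real n}"
    using eventually_ge_at_top[of N]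
  proof eventually_elim
    case (elim n)
    then have n: "r \<le> real n" using N by linarith
    have "emeasure ?M {- real n<..real n} = ennreal (stopped A r \<omega> (real n) - stopped A r \<omega> (- real n))"
      by (rule emeasure_stopped_Ioc[OF A r]) simp
    also have "\<dots> = A (ennreal r) \<omega>"
      using n r0 A pcaf_path_real[OF A r] by (simp add: stopped_def ennreal_neg pcaf_path_def)
    finally show ?case by simp
  qed
  then have "(\<lambda>n. emeasure ?M {- real n<..real n}) \<longlonglongrightarrow> A (ennreal r) \<omega>"
    by (rule Lim_transform_eventually[OF tendsto_const])
  then show ?thesis using LIMSEQ_unique[OF 1] by simp
qed

context lc_hunt_process
begin

lemma continuous_on_functional_up_to_alive:
  assumes A: "pcaf_path X A \<omega>" and f: "f \<in> borel_measurable borel" "\<And>x. f x \<le> 1" and T: "T \<in> alive X \<omega>"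
  shows "continuous_on {0..T} (\<lambda>s. enn2real (functional_up_to X A f s \<omega>))"
proof -
  let ?j = "\<lambda>s. enn2real (functional_up_to X A f s \<omega>)" and ?a = "stopped A T \<omega>"
  have inc: "\<bar>?j t - ?j s\<bar> \<le> \<bar>?a t - ?a s\<bar>" if "0 \<le> s" "s \<le> t" "t \<le> T" for s t
  proof -
    have al: "s \<in> alive X \<omega>" "t \<in> alive X \<omega>" using that alive_downward[OF T] by auto
    have fin: "functional_up_to X A f q \<omega> < top" if "q \<in> alive X \<omega>" for q
      using functional_up_to_finite[OF A f that] by simp
    have eqs: "stopped A t \<omega> t = ?a t" "stopped A t \<omega> s = ?a s" using that by (auto simp: stopped_def)
    have "?a s \<le> ?a t" using that by (intro monoD[OF stopped_mono[OF A T]])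
    moreover have "ennreal (?j t) \<le> ennreal (?j s + (?a t - ?a s))"
      using functional_up_to_increment[OF A f al(2) that(1,2)] \<open>?a s \<le> ?a t\<close>
      by (simp add: fin al eqs)
    moreover have "?j s \<le> ?j t" using that by (intro enn2real_mono functional_up_to_mono fin al)
    ultimately show ?thesis by (subst (asm) ennreal_le_iff) auto
  qed
  have inc': "dist (?j t) (?j s) \<le> dist (?a t) (?a s)" if "s \<in> {0..T}" "t \<in> {0..T}" for s t
    using inc[of s t] inc[of t s] that by (cases "s \<le> t") (auto simp: dist_real_def abs_minus_commute)
  have "continuous_on {0..T} ?a" using stopped_continuous[OF A T] by (rule continuous_on_subset) simp
  then show ?thesis
    unfolding continuous_on_iff using inc' by (meson le_less_trans)
qed

text \<open>Before the lifetime the modulus of continuity comes from \<open>A\<close>. From the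
  lifetime on the value is constant, and continuity from the left at the lifetime holds because the
  value is the supremum of the integrals up to earlier times; finiteness turns this into a statement
  about reals.\<close>

lemma continuous_on_functional_up_to:
  assumes A: "pcaf_path X A \<omega>" and f: "f \<in> borel_measurable borel" "\<And>x. f x \<le> 1"
    and fin: "functional_up_to X A f T \<omega> < \<infinity>"
  shows "continuous_on {0..T} (\<lambda>s. enn2real (functional_up_to X A f s \<omega>))"
proof (cases "T \<in> alive X \<omega>")
  case True
  then show ?thesis by (rule continuous_on_functional_up_to_alive[OF A f])
next
  case False
  let ?J = "\<lambda>s. functional_up_to X A f s \<omega>"
  let ?j = "\<lambda>s. enn2real (?J s)"
  show ?thesis
    unfolding continuous_on_iff
  proof (intro ballI allI impI)
    fix t e :: real assume t: "t \<in> {0..T}" and e: "0 < e"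
    show "\<exists>d>0. \<forall>s\<in>{0..T}. dist s t < d \<longrightarrow> dist (?j s) (?j t) < e"
    proof (cases "t \<in> alive X \<omega>")
      case True
      obtain r where r: "t < r" "r \<in> alive X \<omega>" using alive_right_open[OF True] .
      from continuous_on_functional_up_to_alive[OF A f r(2)] obtain d where
        d: "0 < d" "\<And>s. s \<in> {0..r} \<Longrightarrow> dist s t < d \<Longrightarrow> dist (?j s) (?j t) < e"
        unfolding continuous_on_iff using t r(1) e by (metis atLeastAtMost_iff less_imp_le)
      show ?thesis
        using d r(1) by (intro exI[of _ "min d (r - t)"]) (auto simp: dist_real_def)
    next
      case False
      have t0: "0 \<le> t" "t \<le> T" using t by auto
      have top: "?J s < top" if "s \<le> T" for s
        using fin functional_up_to_mono[OF that, of A f \<omega>] by (auto intro: le_less_trans)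
      \<comment> \<open>No alive time follows a dead one, so from \<open>t\<close> to
        \<open>T\<close> the functional is constant.\<close>
      have Jt: "?J t = (SUP r\<in>alive X \<omega>. stieltjes X A f r \<omega>)" "?J T = ?J t"
        using functional_up_to_dead[OF False] functional_up_to_dead[OF \<open>T \<notin> alive X \<omega>\<close>] t0 by auto
      show ?thesis
      proof (cases "?j t = 0")
        case True
        then have "?J t = 0" using top[OF t0(2)] by (auto simp: enn2real_eq_0_iff)
        then have "?J s = 0" if "s \<le> T" for s
          using functional_up_to_mono[OF that, of A f \<omega>] by (simp add: Jt(2))
        then show ?thesis using e True by (intro exI[of _ 1]) auto
      next
        case False
        then have pos: "0 < ?j t" using enn2real_nonneg[of "?J t"] by linarith
        have "ennreal (max 0 (?j t - e / 2)) < ?J t"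
        proof -
          have "ennreal (max 0 (?j t - e / 2)) < ennreal (?j t)" using pos e by (intro ennreal_lessI) simp_all
          then show ?thesis using top[OF t0(2)] by simp
        qed
        then obtain r where r: "r \<in> alive X \<omega>" "ennreal (max 0 (?j t - e / 2)) < stieltjes X A f r \<omega>"
          unfolding Jt(1) less_SUP_iff by blast
        have rt: "r < t"
          using r(1) \<open>t \<notin> alive X \<omega>\<close> alive_downward[OF r(1), of t] t0 by (meson not_le)
        have "ennreal (max 0 (?j t - e / 2)) < ennreal (?j r)"
          using r top[of r] rt t0 by (simp add: functional_up_to_alive[OF A _ f(1)])
        then have jr: "?j t - e / 2 < ?j r"
          using ennreal_leI[of "?j r" "max 0 (?j t - e / 2)"] by (meson max.cobounded2 not_le order_trans)
        show ?thesis
        proof (intro exI[of _ "t - r"] conjI ballI impI)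
          fix s assume s: "s \<in> {0..T}" "dist s t < t - r"
          then have "r \<le> s" by (auto simp: dist_real_def)
          then have "?j r \<le> ?j s" using s top[of s] by (intro enn2real_mono functional_up_to_mono) auto
          moreover have "?j s \<le> ?j t" using s top[of T] Jt(2)
            by (metis atLeastAtMost_iff enn2real_mono functional_up_to_mono order_refl)
          ultimately show "dist (?j s) (?j t) < e" using jr e by (simp add: dist_real_def)
        qed (use rt in simp)
      qed
    qed
  qed
qed

section \<open>Adaptedness of the integrated functionals and their uniqueness\<close>

lemma measurable_completed_AE:
  fixes F F' :: "'w \<Rightarrow> ennreal"
  assumes F: "F \<in> borel_measurable (completed_filtration X t)"
    and eq: "\<And>\<mu>. \<mu> \<in> space (prob_algebra borel_cemetery) \<Longrightarrow> AE \<omega> in law_from X \<mu>. F' \<omega> = F \<omega>"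
  shows "F' \<in> borel_measurable (completed_filtration X t)"
proof (rule measurableI)
  fix S :: "ennreal set" assume "S \<in> sets borel"
  then have FS: "F -` S \<in> sets (completed_filtration X t)" using measurable_sets[OF F] by simp
  have "F' -` S \<in> sets (completed_filtration X t)"
    unfolding sets_completed_filtration
  proof (intro CollectI ballI)
    fix \<mu> :: "'e option measure" assume \<mu>: "\<mu> \<in> space (prob_algebra borel_cemetery)"
    then obtain \<Gamma> where \<Gamma>: "\<Gamma> \<in> sets (natural_filtration X t)" "AE \<omega> in law_from X \<mu>. \<omega> \<in> F -` S \<longleftrightarrow> \<omega> \<in> \<Gamma>"
      using FS unfolding sets_completed_filtration by blast
    have "AE \<omega> in law_from X \<mu>. \<omega> \<in> F' -` S \<longleftrightarrow> \<omega> \<in> \<Gamma>"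
      using \<Gamma>(2) eq[OF \<mu>] by eventually_elim simp
    then show "\<exists>\<Gamma>\<in>sets (natural_filtration X t). AE \<omega> in law_from X \<mu>. \<omega> \<in> F' -` S \<longleftrightarrow> \<omega> \<in> \<Gamma>"
      using \<Gamma>(1) by blast
  qed
  then show "F' -` S \<inter> space (completed_filtration X t) \<in> sets (completed_filtration X t)" by simp
qed simp

text \<open>The defining set of a strict functional has full mass from points of \<open>E\<close>
  only. Adding the paths that start in the cemetery, which have no alive times, makes it full from
  every starting point.\<close>

lemma strict_pcaf_good_set:
  assumes "strict_pcaf X A"
  obtains \<Lambda> where "\<Lambda> \<in> sets (completed_filtration X \<infinity>)" "\<And>x. AE \<omega> in law X x. \<omega> \<in> \<Lambda>"
    "\<And>\<omega>. \<omega> \<in> \<Lambda> \<Longrightarrow> pcaf_path X A \<omega> \<or> alive X \<omega> = {}"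
proof -
  from assms[unfolded strict_pcaf_def, THEN conjunct2] obtain \<Lambda> where
    \<Lambda>1: "\<Lambda> \<in> sets (completed_filtration X \<infinity>)" and
    rest: "(\<forall>x. emeasure (completion (law X (Some x))) \<Lambda> = 1) \<and>
        (\<forall>t. 0 < t \<and> t < \<infinity> \<longrightarrow> translate X t ` \<Lambda> \<subseteq> \<Lambda>) \<and>
        (\<forall>\<omega>\<in>\<Lambda>.
           A 0 \<omega> = 0 \<and>
           continuous_on {..<\<infinity>} (\<lambda>t. A t \<omega>) \<and>
           (\<forall>t<lifetime X \<omega>. A t \<omega> < \<infinity>) \<and>
           (\<forall>t<\<infinity>. lifetime X \<omega> \<le> t \<longrightarrow> A t \<omega> = A (lifetime X \<omega>) \<omega>) \<and>
           (\<forall>s<\<infinity>. \<forall>t<\<infinity>. A (s + t) \<omega> = A s \<omega> + A t (translate X s \<omega>)))"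
    by (rule bexE)
  have \<Lambda>2: "emeasure (completion (law X (Some x))) \<Lambda> = 1" for x
    using rest[THEN conjunct1] by (rule spec)
  have \<Lambda>3: "pcaf_path X A \<omega>" if "\<omega> \<in> \<Lambda>" for \<omega>
    using rest[THEN conjunct2, THEN conjunct2, THEN bspec, OF that]
    unfolding pcaf_path_def by (elim conjE) (intro conjI; assumption)
  note \<Lambda> = \<Lambda>1 \<Lambda>2 \<Lambda>3
  let ?D = "coord X 0 -` {None}"
  have D: "?D \<in> sets (completed_filtration X \<infinity>)"
    using measurable_sets[OF measurable_coord[of 0 \<infinity> X] None_in_borel_cemetery] natural_subset_completed[of \<infinity>] by auto
  have "AE \<omega> in law X x. \<omega> \<in> \<Lambda> \<union> ?D" for x
  proof (cases x)
    case None
    then show ?thesis using normal[of None] by (auto elim!: eventually_mono)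
  next
    case (Some y)
    interpret p: prob_space "completion (law X (Some y))" by (rule prob_space_completion_law)
    have "\<Lambda> \<in> sets (completion (law X (Some y)))"
      using \<Lambda>(1) completed_subset_completion[OF return_in, of \<infinity> "Some y"] by (auto simp: law_from_return)
    moreover have "p.prob \<Lambda> = 1" using \<Lambda>(2)[of y] by (simp add: measure_def del: emeasure_completion)
    ultimately have "AE \<omega> in completion (law X (Some y)). \<omega> \<in> \<Lambda>" by (subst p.AE_in_set_eq_1) auto
    then show ?thesis unfolding AE_completion_iff Some by eventually_elim simp
  qed
  moreover have "alive X \<omega> = {}" if "\<omega> \<in> ?D" for \<omega> using that by (simp add: alive_empty_iff)
  ultimately show thesis
    using \<Lambda> D by (intro that[of "\<Lambda> \<union> ?D"]) auto
qed

lemma strict_pcaf_measurable: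
  "strict_pcaf X A \<Longrightarrow> t < \<infinity> \<Longrightarrow> A t \<in> borel_measurable (completed_filtration X t)"
  unfolding strict_pcaf_def by (drule conjunct1) blast

text \<open>The stopped measure divided by \<open>1 + A r\<close> has mass at most one and is a
  sub-probability kernel, since it depends measurably on the path on half-open intervals. The
  integrand is progressively measurable, so the kernel integral is adapted, and the factor is
  multiplied back afterwards.\<close>

lemma measurable_stieltjes:
  assumes pcaf: "strict_pcaf X A" and f [measurable]: "f \<in> borel_measurable borel" and r: "0 \<le> r"
    and \<Lambda>: "\<Lambda> \<in> sets (completed_filtration X (ennreal r))"
    and path: "\<And>\<omega>. \<omega> \<in> \<Lambda> \<Longrightarrow> pcaf_path X A \<omega> \<or> alive X \<omega> = {}"
  shows "(\<lambda>\<omega>. if \<omega> \<in> \<Lambda> \<and> r \<in> alive X \<omega> then stieltjes X A f r \<omega> else 0)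
    \<in> borel_measurable (completed_filtration X (ennreal r))"
proof -
  let ?F = "completed_filtration X (ennreal r)"
  let ?H = "{\<omega>. \<omega> \<in> \<Lambda> \<and> r \<in> alive X \<omega>}"
  have "coord X (ennreal r) -` {None} \<in> sets ?F"
    using measurable_sets[OF measurable_coord[OF order_refl, of X "ennreal r"] None_in_borel_cemetery] natural_subset_completed[of "ennreal r"] by auto
  then have "\<Lambda> - coord X (ennreal r) -` {None} \<in> sets ?F" using \<Lambda> by (rule sets.Diff[rotated])
  moreover have "?H = \<Lambda> - coord X (ennreal r) -` {None}" using r by (auto simp: alive_iff)
  ultimately have H: "?H \<in> sets ?F" by simp
  have Hp: "pcaf_path X A \<omega>" "r \<in> alive X \<omega>" if "\<omega> \<in> ?H" for \<omega> using path[of \<omega>] that by auto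
  have Am: "(\<lambda>\<omega>. A (ennreal (min b r)) \<omega>) \<in> borel_measurable ?F" for b
    by (rule measurable_completed_mono[OF strict_pcaf_measurable[OF pcaf]]) (auto intro!: ennreal_leI)
  have Ar [measurable]: "A (ennreal r) \<in> borel_measurable ?F" using Am[of r] by simp
  have st [measurable]: "(\<lambda>\<omega>. stopped A r \<omega> b) \<in> borel_measurable ?F" for b
    unfolding stopped_def using Am[of b] by measurable
  define K where "K \<omega> = (if \<omega> \<in> ?H then scale_measure (1 / (1 + A (ennreal r) \<omega>)) (interval_measure (stopped A r \<omega>))
    else null_measure borel)" for \<omega>
  have [measurable]: "Measurable.pred ?F (\<lambda>\<omega>. \<omega> \<in> ?H)" using H by (rule pred_sets2) simp
  have Ioc: "emeasure (K \<omega>) {a<..b} = (if \<omega> \<in> ?H then 1 / (1 + A (ennreal r) \<omega>) * ennreal (stopped A r \<omega> b - stopped A r \<omega> a) else 0)"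
    if "a \<le> b" for a b \<omega>
    using emeasure_stopped_Ioc[OF Hp that] by (simp add: K_def)
  have UN: "emeasure (K \<omega>) UNIV = (if \<omega> \<in> ?H then 1 / (1 + A (ennreal r) \<omega>) * A (ennreal r) \<omega> else 0)" for \<omega>
    using emeasure_stopped_UNIV[OF Hp] by (simp add: K_def)
  have sK: "sets (K \<omega>) = sets borel" for \<omega> by (simp add: K_def)
  then have spK: "space (K \<omega>) = UNIV" for \<omega> using sets_eq_imp_space_eq[OF sK] by simp
  have KM: "K \<in> ?F \<rightarrow>\<^sub>M subprob_algebra borel"
  proof (rule measurable_subprob_algebra_generated[where \<Omega>=UNIV and G="range (\<lambda>(a, b). {a<..b::real})"])
    show "sets (borel :: real measure) = sigma_sets UNIV (range (\<lambda>(a, b). {a<..b::real}))"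
      by (rule sets_borel_Ioc)
    show "Int_stable (range (\<lambda>(a, b). {a<..b::real}))" by (rule Int_stable_Ioc)
    fix \<omega>
    show "subprob_space (K \<omega>)"
    proof (rule subprob_spaceI)
      have "1 / (1 + A (ennreal r) \<omega>) * A (ennreal r) \<omega> \<le> 1" if "A (ennreal r) \<omega> < top"
        using that by (cases "A (ennreal r) \<omega>") (auto simp: divide_ennreal ennreal_mult[symmetric] simp flip: ennreal_1 ennreal_plus)
      then show "emeasure (K \<omega>) (space (K \<omega>)) \<le> 1"
        using Hp[of \<omega>] unfolding spK UN by (auto simp: pcaf_path_def alive_def)
      show "space (K \<omega>) \<noteq> {}" by (simp add: spK)
    qed
    show "sets (K \<omega>) = sets borel" by (rule sK)
  next
    fix S assume "S \<in> range (\<lambda>(a, b). {a<..b::real})"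
    then obtain a b where S: "S = {a<..b}" by auto
    show "(\<lambda>\<omega>. emeasure (K \<omega>) S) \<in> borel_measurable ?F"
    proof (cases "a \<le> b")
      case True
      show ?thesis unfolding S Ioc[OF True] by measurable
    next
      case False
      then show ?thesis by (simp add: S)
    qed
  next
    show "(\<lambda>\<omega>. emeasure (K \<omega>) UNIV) \<in> borel_measurable ?F" unfolding UN by measurable
  qed auto
  have prog: "(\<lambda>(\<omega>, q). coord X (ennreal (min q r)) \<omega>) \<in> ?F \<Otimes>\<^sub>M borel \<rightarrow>\<^sub>M borel_cemetery"
  proof -
    have "(\<lambda>\<omega>. \<omega>) \<in> ?F \<rightarrow>\<^sub>M natural_filtration X (ennreal r)"
      using natural_subset_completed[of "ennreal r"] by (intro measurableI) auto
    from measurable_compose[OF measurable_fst this, of "borel :: real measure"]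
    have "(\<lambda>x. (fst x, snd x)) \<in> ?F \<Otimes>\<^sub>M (borel :: real measure) \<rightarrow>\<^sub>M natural_filtration X (ennreal r) \<Otimes>\<^sub>M borel"
      by (intro measurable_Pair measurable_snd)
    from measurable_compose[OF this measurable_coord_progressive[OF r]] show ?thesis
      by (simp add: case_prod_beta')
  qed
  let ?g = "\<lambda>\<omega> q. case_option 0 f (coord X (ennreal (min q r)) \<omega>) * indicator {0..r} q"
  have "(\<lambda>x. case_option 0 f (coord X (ennreal (min (snd x) r)) (fst x))) \<in> borel_measurable (?F \<Otimes>\<^sub>M borel)"
    using measurable_compose[OF prog measurable_case_option_zero[OF f]] by (simp add: case_prod_beta')
  then have "(\<lambda>(\<omega>, q). ?g \<omega> q) \<in> borel_measurable (?F \<Otimes>\<^sub>M borel)"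
    unfolding case_prod_beta' by measurable
  from nn_integral_measurable_subprob_algebra2[OF this KM]
  have int: "(\<lambda>\<omega>. \<integral>\<^sup>+q. ?g \<omega> q \<partial>K \<omega>) \<in> borel_measurable ?F" .
  have "(if \<omega> \<in> \<Lambda> \<and> r \<in> alive X \<omega> then stieltjes X A f r \<omega> else 0) =
      (if \<omega> \<in> ?H then (1 + A (ennreal r) \<omega>) * (\<integral>\<^sup>+q. ?g \<omega> q \<partial>K \<omega>) else 0)" for \<omega>
  proof (cases "\<omega> \<in> ?H")
    case True
    let ?I = "interval_measure (stopped A r \<omega>)"
    have gm: "(\<lambda>q. ?g \<omega> q) \<in> borel_measurable ?I"
    proof -
      have "(\<lambda>q. coord X (ennreal (min q r)) \<omega>) \<in> borel \<rightarrow>\<^sub>M borel_cemetery"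
        by (rule measurable_compose[OF _ measurable_coord_path]) simp
      from measurable_compose[OF this measurable_case_option_zero[OF f]] show ?thesis by simp
    qed
    have fin: "A (ennreal r) \<omega> < top" using Hp[OF True] by (auto simp: pcaf_path_def alive_def)
    have "(\<integral>\<^sup>+q. ?g \<omega> q \<partial>K \<omega>) = 1 / (1 + A (ennreal r) \<omega>) * (\<integral>\<^sup>+q. ?g \<omega> q \<partial>?I)"
      using True by (simp add: K_def nn_integral_scale_measure[OF gm])
    also have "(\<integral>\<^sup>+q. ?g \<omega> q \<partial>?I) = stieltjes X A f r \<omega>"
      unfolding stieltjes_def by (intro nn_integral_cong) (auto simp: indicator_def)
    finally have "(1 + A (ennreal r) \<omega>) * (\<integral>\<^sup>+q. ?g \<omega> q \<partial>K \<omega>) =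
        ((1 + A (ennreal r) \<omega>) * (1 / (1 + A (ennreal r) \<omega>))) * stieltjes X A f r \<omega>"
      by (simp add: mult.assoc)
    also have "(1 + A (ennreal r) \<omega>) * (1 / (1 + A (ennreal r) \<omega>)) = 1"
      using fin by (cases "A (ennreal r) \<omega>") (auto simp: divide_ennreal ennreal_mult[symmetric] simp flip: ennreal_1 ennreal_plus)
    finally show ?thesis using True by simp
  qed auto
  moreover have "(\<lambda>\<omega>. if \<omega> \<in> ?H then (1 + A (ennreal r) \<omega>) * (\<integral>\<^sup>+q. ?g \<omega> q \<partial>K \<omega>) else 0) \<in> borel_measurable ?F"
    using int by measurable
  ultimately show ?thesis by simp
qed

text \<open>The set of alive times is open to the right, so an alive time before \<open>T\<close>
  can be raised to a rational alive time before \<open>T\<close>, which does not decrease the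
  integral. \<open>T\<close> itself has to be added to the index set.\<close>

lemma functional_up_to_countable:
  assumes A: "pcaf_path X A \<omega> \<or> alive X \<omega> = {}" and f: "f \<in> borel_measurable borel" and T: "0 \<le> T"
  shows "functional_up_to X A f T \<omega> =
    (SUP r\<in>insert T {q \<in> \<rat>. 0 \<le> q \<and> q \<le> T}. if r \<in> alive X \<omega> then stieltjes X A f r \<omega> else 0)"
proof (rule antisym)
  let ?D = "insert T {q \<in> \<rat>. 0 \<le> q \<and> q \<le> T}"
  show "functional_up_to X A f T \<omega> \<le> (SUP r\<in>?D. if r \<in> alive X \<omega> then stieltjes X A f r \<omega> else 0)"
    unfolding functional_up_to_def
  proof (rule SUP_least)
    fix r assume r: "r \<in> {r \<in> alive X \<omega>. r \<le> T}"
    then have path: "pcaf_path X A \<omega>" and r0: "0 \<le> r" using A by (auto simp: alive_def)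
    have "\<exists>q\<in>?D. r \<le> q \<and> q \<in> alive X \<omega>"
    proof (cases "r = T")
      case False
      obtain r' where r': "r < r'" "r' \<in> alive X \<omega>" using alive_right_open r by blast
      obtain q where q: "q \<in> \<rat>" "r < q" "q < min r' T"
        using Rats_dense_in_real[of r "min r' T"] r r' False by auto
      then show ?thesis using r0 alive_downward[OF r'(2), of q] by (intro bexI[of _ q]) auto
    qed (use r in auto)
    then obtain q where q: "q \<in> ?D" "r \<le> q" "q \<in> alive X \<omega>" by blast
    have "stieltjes X A f r \<omega> \<le> (if q \<in> alive X \<omega> then stieltjes X A f q \<omega> else 0)"
      using stieltjes_mono[OF path q(3) r0 q(2) f] q by simp
    also have "\<dots> \<le> (SUP r\<in>?D. if r \<in> alive X \<omega> then stieltjes X A f r \<omega> else 0)"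
      using q(1) by (rule SUP_upper)
    finally show "stieltjes X A f r \<omega> \<le> (SUP r\<in>?D. if r \<in> alive X \<omega> then stieltjes X A f r \<omega> else 0)" .
  qed
  show "(SUP r\<in>?D. if r \<in> alive X \<omega> then stieltjes X A f r \<omega> else 0) \<le> functional_up_to X A f T \<omega>"
    unfolding functional_up_to_def by (intro SUP_least) (auto intro: SUP_upper)
qed

text \<open>The supremum over countably many times is measurable at \<open>T\<close>, and it agrees
  with the functional on a set that is full under every initial law.\<close>

lemma measurable_functional_up_to:
  assumes pcaf: "strict_pcaf X A" and f: "f \<in> borel_measurable borel" and T: "0 \<le> T"
  shows "functional_up_to X A f T \<in> borel_measurable (completed_filtration X (ennreal T))"
proof -
  obtain \<Lambda> where \<Lambda>: "\<Lambda> \<in> sets (completed_filtration X \<infinity>)" "\<And>x. AE \<omega> in law X x. \<omega> \<in> \<Lambda>"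
    "\<And>\<omega>. \<omega> \<in> \<Lambda> \<Longrightarrow> pcaf_path X A \<omega> \<or> alive X \<omega> = {}"
    using strict_pcaf_good_set[OF pcaf] by blast
  note full = AE_law_from[OF \<Lambda>(1,2)]
  note \<Lambda>t = full_set_in_completed[OF full]
  let ?D = "insert T {q \<in> \<rat>. 0 \<le> q \<and> q \<le> T}"
  let ?S = "\<lambda>\<omega>. SUP r\<in>?D. if \<omega> \<in> \<Lambda> \<and> r \<in> alive X \<omega> then stieltjes X A f r \<omega> else 0"
  show ?thesis
  proof (rule measurable_completed_AE)
    show "?S \<in> borel_measurable (completed_filtration X (ennreal T))"
    proof (rule borel_measurable_SUP)
      have "countable {q \<in> \<rat>. 0 \<le> q \<and> q \<le> T}" by (rule countable_subset[OF _ countable_rat]) auto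
      then show "countable ?D" by simp
      fix r assume "r \<in> ?D"
      then have "0 \<le> r" "r \<le> T" using T by auto
      then show "(\<lambda>\<omega>. if \<omega> \<in> \<Lambda> \<and> r \<in> alive X \<omega> then stieltjes X A f r \<omega> else 0)
          \<in> borel_measurable (completed_filtration X (ennreal T))"
        by (intro measurable_completed_mono[OF measurable_stieltjes[OF pcaf f _ \<Lambda>t \<Lambda>(3)]] ennreal_leI)
    qed
    fix \<mu> :: "'e option measure" assume "\<mu> \<in> space (prob_algebra borel_cemetery)"
    from full[OF this] show "AE \<omega> in law_from X \<mu>. functional_up_to X A f T \<omega> = ?S \<omega>"
      by eventually_elim (simp add: functional_up_to_countable[OF \<Lambda>(3) f T])
  qed
qed

lemma continuous_additive_functional_up_to:
  assumes pcaf: "strict_pcaf X A" and f: "f \<in> borel_measurable borel" "\<And>x. f x \<le> 1"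
  shows "continuous_additive X (functional_up_to X A f)"
  unfolding continuous_additive_def
proof (intro conjI allI impI)
  fix t :: real assume "0 \<le> t"
  then show "functional_up_to X A f t \<in> borel_measurable (completed_filtration X (ennreal t))"
    by (rule measurable_functional_up_to[OF pcaf f(1)])
next
  fix x
  obtain \<Lambda> where \<Lambda>: "\<Lambda> \<in> sets (completed_filtration X \<infinity>)" "\<And>x. AE \<omega> in law X x. \<omega> \<in> \<Lambda>"
    "\<And>\<omega>. \<omega> \<in> \<Lambda> \<Longrightarrow> pcaf_path X A \<omega> \<or> alive X \<omega> = {}"
    using strict_pcaf_good_set[OF pcaf] by blast
  from \<Lambda>(2) show "AE \<omega> in law X x. functional_up_to X A f 0 \<omega> = 0 \<and>
      (\<forall>s\<ge>0. \<forall>t\<ge>0. functional_up_to X A f (s + t) \<omega> =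
        functional_up_to X A f s \<omega> + functional_up_to X A f t (translate X (ennreal s) \<omega>)) \<and>
      (\<forall>t\<ge>0. functional_up_to X A f t \<omega> < \<infinity> \<longrightarrow> continuous_on {0..t} (\<lambda>s. enn2real (functional_up_to X A f s \<omega>)))"
  proof eventually_elim
    case (elim \<omega>)
    show ?case
    proof (cases "pcaf_path X A \<omega>")
      case True
      then show ?thesis
        using functional_up_to_0[OF True f] functional_up_to_add[OF True _ _ f(1)] continuous_on_functional_up_to[OF True f]
        by blast
    next
      case False
      then have dead: "alive X \<omega> = {}" using \<Lambda>(3)[OF elim] by blast
      have "alive X (translate X (ennreal s) \<omega>) = {}" if "0 \<le> s" for s
      proof -
        have "t \<notin> alive X (translate X (ennreal s) \<omega>)" for t
          using alive_translate[OF that, of t \<omega>] dead by (cases "0 \<le> t") (auto simp: alive_def)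
        then show ?thesis by blast
      qed
      then show ?thesis using dead by (simp add: functional_up_to_def bot_ennreal)
    qed
  qed
qed

lemma expectation_functional_cemetery:
  "(\<integral>\<^sup>+\<omega>. (SUP n. functional_up_to X A f (real n) \<omega>) \<partial>law X None) = 0"
proof -
  have "AE \<omega> in law X None. (SUP n. functional_up_to X A f (real n) \<omega>) = 0"
    using normal[of None]
  proof eventually_elim
    case (elim \<omega>)
    then have "alive X \<omega> = {}" by (simp add: alive_empty_iff)
    then show ?case by (simp add: functional_up_to_def bot_ennreal)
  qed
  then have "(\<integral>\<^sup>+\<omega>. (SUP n. functional_up_to X A f (real n) \<omega>) \<partial>law X None) = (\<integral>\<^sup>+\<omega>. 0 \<partial>law X None)"
    by (rule nn_integral_cong_AE)
  then show ?thesis by simp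
qed

text \<open>The Revuz correspondence identifies the potentials at points of \<open>E\<close> with
  the Green integrals, and from the cemetery both are zero. Adapted, additive and continuous as they
  are, the two functionals form an instance of \<open>equal_potentials\<close>.\<close>

theorem pcaf_unique:
  assumes A: "strict_pcaf X A" "revuz_correspondence X G A \<beta>"
    and B: "strict_pcaf X B" "revuz_correspondence X G B \<gamma>"
    and f: "f \<in> borel_measurable borel" "\<And>x. f x \<le> 1" and g: "g \<in> borel_measurable borel" "\<And>x. g x \<le> 1"
    and eq: "\<And>x. (\<integral>\<^sup>+y. G x y * f y \<partial>\<beta>) = (\<integral>\<^sup>+y. G x y * g y \<partial>\<gamma>)"
    and bound: "\<And>x. (\<integral>\<^sup>+y. G x y * f y \<partial>\<beta>) \<le> c" "c < \<infinity>" and T: "0 \<le> T"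
  shows "AE \<omega> in law X x. functional_up_to X A f T \<omega> = functional_up_to X B g T \<omega>"
proof -
  have rA: "(\<integral>\<^sup>+\<omega>. (SUP n. functional_up_to X A f (real n) \<omega>) \<partial>law X (Some y)) = (\<integral>\<^sup>+z. G y z * f z \<partial>\<beta>)" for y
    using A(2) f(1) unfolding revuz_correspondence_def functional_integral_SUP by blast
  have rB: "(\<integral>\<^sup>+\<omega>. (SUP n. functional_up_to X B g (real n) \<omega>) \<partial>law X (Some y)) = (\<integral>\<^sup>+z. G y z * g z \<partial>\<gamma>)" for y
    using B(2) g(1) unfolding revuz_correspondence_def functional_integral_SUP by blast
  interpret equal_potentials X "functional_up_to X A f" "functional_up_to X B g" c
  proof unfold_locales
    show "continuous_additive X (functional_up_to X A f)" by (rule continuous_additive_functional_up_to[OF A(1) f])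
    show "continuous_additive X (functional_up_to X B g)" by (rule continuous_additive_functional_up_to[OF B(1) g])
    fix z
    show "(\<integral>\<^sup>+\<omega>. (SUP n. functional_up_to X A f (real n) \<omega>) \<partial>law X z) = (\<integral>\<^sup>+\<omega>. (SUP n. functional_up_to X B g (real n) \<omega>) \<partial>law X z)"
      by (cases z) (simp_all add: expectation_functional_cemetery rA rB eq)
    show "(\<integral>\<^sup>+\<omega>. (SUP n. functional_up_to X A f (real n) \<omega>) \<partial>law X z) \<le> c"
      by (cases z) (simp_all add: expectation_functional_cemetery rA bound)
  qed (rule bound(2))
  show ?thesis by (rule equal_potentials_unique[OF T])
qed

end

section \<open>Comparison of functionals by their Revuz measures\<close>

text \<open>Splitting along \<open>{g < f}\<close> shows that \<open>max f g\<close> and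
  \<open>g\<close> define the same measure, and densities over a sigma-finite measure are unique.
  The maximum avoids differences of infinite integrals.\<close>

lemma (in sigma_finite_measure) AE_le_of_density_le:
  assumes f [measurable]: "f \<in> borel_measurable M" and g [measurable]: "g \<in> borel_measurable M"
    and le: "\<And>S. S \<in> sets M \<Longrightarrow> emeasure (density M f) S \<le> emeasure (density M g) S"
  shows "AE x in M. f x \<le> g x"
proof -
  have "density M (\<lambda>x. max (f x) (g x)) = density M g"
  proof (rule measure_eqI)
    fix S assume "S \<in> sets (density M (\<lambda>x. max (f x) (g x)))"
    then have S [measurable]: "S \<in> sets M" by simp
    let ?F = "{x \<in> space M. g x < f x}"
    have F [measurable]: "?F \<in> sets M" by measurable
    have "emeasure (density M (\<lambda>x. max (f x) (g x))) S =
        (\<integral>\<^sup>+x. f x * indicator (S \<inter> ?F) x + g x * indicator (S - ?F) x \<partial>M)"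
      by (subst emeasure_density) (auto intro!: nn_integral_cong simp: indicator_def max_def)
    also have "\<dots> = emeasure (density M f) (S \<inter> ?F) + emeasure (density M g) (S - ?F)"
      by (subst nn_integral_add) (auto simp: emeasure_density)
    also have "\<dots> \<le> emeasure (density M g) (S \<inter> ?F) + emeasure (density M g) (S - ?F)"
      by (intro add_right_mono le) auto
    also have "\<dots> = emeasure (density M g) S"
      by (subst plus_emeasure) (auto intro!: arg_cong[where f="emeasure _"])
    finally have "emeasure (density M (\<lambda>x. max (f x) (g x))) S \<le> emeasure (density M g) S" .
    moreover have "emeasure (density M g) S \<le> emeasure (density M (\<lambda>x. max (f x) (g x))) S"
      by (simp add: emeasure_density) (intro nn_integral_mono mult_right_mono, auto)
    ultimately show "emeasure (density M (\<lambda>x. max (f x) (g x))) S = emeasure (density M g) S" by simp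
  qed simp
  then have "AE x in M. max (f x) (g x) = g x" by (intro density_unique) auto
  then show ?thesis by eventually_elim (metis max.cobounded1)
qed

text \<open>Truncation at one changes the density on a null set only and makes the bound hold at
  every point, as the estimates of the Stieltjes integrals require.\<close>

lemma (in sigma_finite_measure) Radon_Nikodym_le_1:
  assumes N: "sets N = sets M" and le: "\<And>S. S \<in> sets M \<Longrightarrow> emeasure N S \<le> emeasure M S"
  obtains h where "h \<in> borel_measurable M" "density M h = N" "\<And>x. h x \<le> (1 :: ennreal)"
proof -
  have "absolutely_continuous M N"
    unfolding absolutely_continuous_def
  proof
    fix S assume S: "S \<in> null_sets M"
    then have "emeasure N S = 0" using le[OF null_setsD2[OF S]] null_setsD1[OF S] by simp
    then show "S \<in> null_sets N" using null_setsD2[OF S] N by (intro null_setsI) auto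
  qed
  from Radon_Nikodym[OF this N] obtain h where h [measurable]: "h \<in> borel_measurable M" "density M h = N" by blast
  have "AE x in M. h x \<le> 1"
    using h le by (intro AE_le_of_density_le) (auto simp: density_1)
  then have "density M (\<lambda>x. min 1 (h x)) = density M h"
    by (intro density_cong) (auto elim: eventually_mono)
  with h show thesis by (intro that[of "\<lambda>x. min 1 (h x)"]) auto
qed

lemma capacity_mono: "B \<subseteq> C \<Longrightarrow> capacity m D \<E> B \<le> capacity m D \<E> C"
  unfolding capacity_def by (intro INF_superset_mono) auto

text \<open>What the sets \<open>F n\<close> leave over of a relatively compact set has capacity
  zero, hence measure zero, and countably many relatively compact open sets cover the space.\<close>

lemma smooth_measure_sigma_finite:
  fixes \<nu> :: "'e::{metric_space, second_countable_topology} measure"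
  assumes lc: "locally compact (UNIV :: 'e set)" and \<nu>: "smooth_measure m D \<E> \<nu>"
  shows "sigma_finite_measure \<nu>"
proof -
  have sets: "sets \<nu> = sets borel" and null: "\<And>B. B \<in> sets borel \<Longrightarrow> capacity m D \<E> B = 0 \<Longrightarrow> emeasure \<nu> B = 0"
    using \<nu> unfolding smooth_measure_def by auto
  obtain F :: "nat \<Rightarrow> 'e set" where F: "\<And>n. closed (F n)" "\<And>n. emeasure \<nu> (F n) < \<infinity>"
    "\<And>K. compact K \<Longrightarrow> (\<lambda>n. capacity m D \<E> (K - F n)) \<longlonglongrightarrow> 0"
    using \<nu> unfolding smooth_measure_def by blast
  obtain C where C: "countable C" "\<And>V. V \<in> C \<Longrightarrow> open V \<and> compact (closure V)" "\<Union>C = (UNIV :: 'e set)"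
    using relatively_compact_open_cover[OF lc open_UNIV] by blast
  let ?R = "\<lambda>V. closure V - (\<Union>n. F n)"
  have R: "emeasure \<nu> (?R V) = 0" if V: "V \<in> C" for V
  proof (rule null)
    show "?R V \<in> sets borel" using F(1) by (intro sets.Diff sets.countable_UN) auto
    have "capacity m D \<E> (?R V) \<le> 0"
    proof (rule LIMSEQ_le_const[OF F(3)])
      show "compact (closure V)" using C(2)[OF V] by simp
      show "\<exists>N. \<forall>n\<ge>N. capacity m D \<E> (?R V) \<le> capacity m D \<E> (closure V - F n)"
        by (intro exI allI impI capacity_mono) auto
    qed
    then show "capacity m D \<E> (?R V) = 0" by simp
  qed
  show ?thesis
  proof
    let ?A = "range F \<union> ?R ` C"
    have "x \<in> \<Union>?A" for x
    proof -
      obtain V where "V \<in> C" "x \<in> V" using C(3) by blast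
      moreover then have "x \<in> closure V" using closure_subset by blast
      ultimately show ?thesis by blast
    qed
    then have "\<Union>?A = UNIV" by blast
    moreover have "countable ?A" using C(1) by simp
    moreover have "?A \<subseteq> sets \<nu>"
      unfolding sets using F(1) by (auto intro!: sets.Diff sets.countable_UN)
    moreover have "\<forall>a\<in>?A. emeasure \<nu> a \<noteq> \<infinity>" using F(2) R by (auto simp: less_top[symmetric])
    ultimately show "\<exists>A. countable A \<and> A \<subseteq> sets \<nu> \<and> \<Union>A = space \<nu> \<and> (\<forall>a\<in>A. emeasure \<nu> a \<noteq> \<infinity>)"
      using sets_eq_imp_space_eq[OF sets] by (intro exI[of _ ?A]) simp
  qed
qed

lemma strictly_smooth_exhaustion:
  assumes "strictly_smooth_measure m D \<E> G \<nu>"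
  obtains B where "\<And>n. B n \<in> sets borel" "incseq B" "(\<Union>n::nat. B n) = UNIV"
    "\<And>n. \<exists>c<\<infinity>. \<forall>x. green_potential G (density \<nu> (indicator (B n))) x \<le> c"
proof -
  obtain B where "\<And>n. B n \<in> sets borel" "incseq B" "(\<Union>n::nat. B n) = UNIV"
    and B: "\<And>n. (SUP x. green_potential G (density \<nu> (indicator (B n))) x) < \<infinity>"
    using assms unfolding strictly_smooth_measure_def by blast
  moreover have "\<exists>c<\<infinity>. \<forall>x. green_potential G (density \<nu> (indicator (B n))) x \<le> c" for n
    using B[of n] by (intro exI[of _ "SUP x. green_potential G (density \<nu> (indicator (B n))) x"]) (auto intro: SUP_upper)
  ultimately show thesis using that by blast
qed

lemma strictly_smooth_smooth: "strictly_smooth_measure m D \<E> G \<nu> \<Longrightarrow> smooth_measure m D \<E> \<nu>"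
  by (simp add: strictly_smooth_measure_def)

lemma smooth_measure_sets: "smooth_measure m D \<E> \<nu> \<Longrightarrow> sets \<nu> = sets borel"
  by (simp add: smooth_measure_def)

lemma measures_increase_to_le:
  "measures_increase_to \<nu>s \<nu> \<Longrightarrow> B \<in> sets borel \<Longrightarrow> emeasure (\<nu>s n) B \<le> emeasure \<nu> B"
  unfolding measures_increase_to_def using incseq_le by blast

section \<open>Dependence of the functionals on the integrand and on the Revuz measure\<close>

context lc_hunt_process
begin

lemma stieltjes_SUP:
  assumes f [measurable]: "\<And>n. f n \<in> borel_measurable borel" and inc: "\<And>x. incseq (\<lambda>n. f n x)"
  shows "stieltjes X A (\<lambda>x. SUP n. f n x) r \<omega> = (SUP n. stieltjes X A (f n) r \<omega>)"
proof -
  have *: "case_option 0 (\<lambda>x. SUP n. f n x) z = (SUP n. case_option 0 (f n) z)" for z by (cases z) auto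
  have inc': "case_option 0 (f i) z \<le> case_option 0 (f j) z" if "i \<le> j" for i j z
    using inc that by (cases z) (auto simp: incseq_def)
  show ?thesis
    unfolding stieltjes_def * SUP_mult_right_ennreal[symmetric]
    by (subst SUP_mult_right_ennreal, subst nn_integral_monotone_convergence_SUP)
       (auto simp: incseq_def le_fun_def intro!: mult_right_mono inc')
qed

lemma functional_up_to_SUP:
  assumes "\<And>n. f n \<in> borel_measurable borel" "\<And>x. incseq (\<lambda>n. f n x)"
  shows "functional_up_to X A (\<lambda>x. SUP n. f n x) T \<omega> = (SUP n. functional_up_to X A (f n) T \<omega>)"
  unfolding functional_up_to_def stieltjes_SUP[OF assms] by (rule SUP_commute)

lemma functional_up_to_subadditive:
  assumes [measurable]: "f \<in> borel_measurable borel" "g \<in> borel_measurable borel"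
    and le: "\<And>x. h x \<le> f x + g x"
  shows "functional_up_to X A h T \<omega> \<le> functional_up_to X A f T \<omega> + functional_up_to X A g T \<omega>"
  unfolding functional_up_to_def[of X A h]
proof (rule SUP_least)
  fix r assume r: "r \<in> {r \<in> alive X \<omega>. r \<le> T}"
  have le': "case_option 0 h z \<le> case_option 0 f z + case_option 0 g z" for z using le by (cases z) auto
  have "stieltjes X A h r \<omega> \<le> stieltjes X A f r \<omega> + stieltjes X A g r \<omega>"
    unfolding stieltjes_def
    by (subst nn_integral_add[symmetric])
       (auto intro!: nn_integral_mono mult_right_mono le' simp: distrib_right[symmetric])
  also have "\<dots> \<le> functional_up_to X A f T \<omega> + functional_up_to X A g T \<omega>"
    unfolding functional_up_to_def using r by (intro add_mono SUP_upper)
  finally show "stieltjes X A h r \<omega> \<le> functional_up_to X A f T \<omega> + functional_up_to X A g T \<omega>" .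
qed

text \<open>The Green integral is the mean of the total value, which dominates the value at
  \<open>T\<close>.\<close>

lemma functional_up_to_null:
  assumes A: "strict_pcaf X A" "revuz_correspondence X G A \<beta>"
    and f: "f \<in> borel_measurable borel" and null: "\<And>x. (\<integral>\<^sup>+y. G x y * f y \<partial>\<beta>) = 0" and T: "0 \<le> T"
  shows "AE \<omega> in law X (Some x). functional_up_to X A f T \<omega> = 0"
proof -
  let ?M = "completion (law X (Some x))"
  obtain n where n: "T \<le> real n" using real_arch_simple by blast
  have "(\<integral>\<^sup>+\<omega>. functional_up_to X A f T \<omega> \<partial>?M) \<le>
      (\<integral>\<^sup>+\<omega>. functional_integral X A \<omega> (\<lambda>t. case_option 0 f (coord X (ennreal t) \<omega>)) \<partial>?M)"
    unfolding functional_integral_SUP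
    by (intro nn_integral_mono order_trans[OF functional_up_to_mono[OF n]] SUP_upper) simp
  also have "\<dots> = 0"
    using A(2) f null[of x] by (simp add: revuz_correspondence_def nn_integral_completion)
  finally have "(\<integral>\<^sup>+\<omega>. functional_up_to X A f T \<omega> \<partial>?M) = 0" by simp
  moreover have "functional_up_to X A f T \<in> borel_measurable ?M"
    by (rule measurable_completion_law[OF measurable_functional_up_to[OF A(1) f T]])
  ultimately have "AE \<omega> in ?M. functional_up_to X A f T \<omega> = 0" by (simp add: nn_integral_0_iff_AE)
  then show ?thesis unfolding AE_completion_iff .
qed

end

locale green_process = lc_hunt_process X
  for X :: "('w, 'e::{metric_space, second_countable_topology}) markov_process" +
  fixes m :: "'e measure" and D :: "('e \<Rightarrow> real) set" and \<E> :: "('e \<Rightarrow> real) \<Rightarrow> ('e \<Rightarrow> real) \<Rightarrow> real"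
    and G :: "'e \<Rightarrow> 'e \<Rightarrow> ennreal"
  assumes measurable_green [measurable]: "\<And>x. G x \<in> borel_measurable borel"
begin

text \<open>On the sets \<open>C n\<close> of an exhaustion for \<open>\<beta>\<close> the potential
  is bounded, and equality of the two measures transfers the bound to \<open>\<gamma>\<close>, so
  \<open>pcaf_unique\<close> applies there. Both functionals are recovered as increasing limits in
  \<open>n\<close>.\<close>

lemma functional_eq_of_density_eq:
  assumes A: "strict_pcaf X A" "revuz_correspondence X G A \<beta>" and \<beta>: "strictly_smooth_measure m D \<E> G \<beta>"
    and B: "strict_pcaf X B" "revuz_correspondence X G B \<gamma>" and \<gamma>: "sets \<gamma> = sets borel"
    and f [measurable]: "f \<in> borel_measurable borel" and f1: "\<And>x. f x \<le> 1"
    and g [measurable]: "g \<in> borel_measurable borel" and g1: "\<And>x. g x \<le> 1"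
    and eq: "density \<beta> f = density \<gamma> g" and T: "0 \<le> T"
  shows "AE \<omega> in law X (Some x). functional_up_to X A f T \<omega> = functional_up_to X B g T \<omega>"
proof -
  have \<beta>s: "sets \<beta> = sets borel" by (rule smooth_measure_sets[OF strictly_smooth_smooth[OF \<beta>]])
  note [measurable_cong] = \<beta>s \<gamma>
  obtain C where C [measurable]: "\<And>n. C n \<in> sets borel" and Cinc: "incseq C" and CU: "(\<Union>n::nat. C n) = UNIV"
    and Cb: "\<And>n. \<exists>c<\<infinity>. \<forall>x. green_potential G (density \<beta> (indicator (C n))) x \<le> c"
    using strictly_smooth_exhaustion[OF \<beta>] by metis
  let ?f = "\<lambda>n x. f x * indicator (C n) x" and ?g = "\<lambda>n x. g x * indicator (C n) x"
  have int: "(\<integral>\<^sup>+y. G x y * ?f n y \<partial>\<beta>) = (\<integral>\<^sup>+y. G x y * indicator (C n) y \<partial>density \<beta> f)"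
    "(\<integral>\<^sup>+y. G x y * ?g n y \<partial>\<gamma>) = (\<integral>\<^sup>+y. G x y * indicator (C n) y \<partial>density \<gamma> g)" for n x
    by (subst nn_integral_density, auto intro!: nn_integral_cong simp: mult_ac)+
  have "AE \<omega> in law X (Some x). functional_up_to X A (?f n) T \<omega> = functional_up_to X B (?g n) T \<omega>" for n
  proof -
    obtain c where c: "c < \<infinity>" "\<And>x. green_potential G (density \<beta> (indicator (C n))) x \<le> c" using Cb by blast
    show ?thesis
    proof (rule pcaf_unique[OF A B _ _ _ _ _ _ c(1) T])
      fix y
      show "?f n y \<le> 1" "?g n y \<le> 1" using f1 g1 by (auto simp: indicator_def)
      show "(\<integral>\<^sup>+z. G y z * ?f n z \<partial>\<beta>) = (\<integral>\<^sup>+z. G y z * ?g n z \<partial>\<gamma>)" unfolding int eq ..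
      have "(\<integral>\<^sup>+z. G y z * ?f n z \<partial>\<beta>) \<le> (\<integral>\<^sup>+z. indicator (C n) z * G y z \<partial>\<beta>)"
        using f1 by (intro nn_integral_mono) (auto simp: indicator_def intro: mult_left_le)
      also have "\<dots> = green_potential G (density \<beta> (indicator (C n))) y"
        unfolding green_potential_def by (subst nn_integral_density) auto
      also have "\<dots> \<le> c" by (rule c(2))
      finally show "(\<integral>\<^sup>+z. G y z * ?f n z \<partial>\<beta>) \<le> c" .
    qed measurable
  qed
  then have "AE \<omega> in law X (Some x). \<forall>n. functional_up_to X A (?f n) T \<omega> = functional_up_to X B (?g n) T \<omega>"
    by (simp add: AE_all_countable)
  then show ?thesis
  proof eventually_elim
    case (elim \<omega>)
    have lim: "(\<lambda>x. SUP n. h x * indicator (C n) x) = h" for h :: "'e \<Rightarrow> ennreal"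
    proof
      fix x
      obtain n where n: "x \<in> C n" using CU by blast
      show "(SUP n. h x * indicator (C n) x) = h x"
      proof (rule antisym)
        show "(SUP n. h x * indicator (C n) x) \<le> h x" by (intro SUP_least) (auto simp: indicator_def)
        show "h x \<le> (SUP n. h x * indicator (C n) x)" using n by (intro SUP_upper2[of n]) auto
      qed
    qed
    have inc: "incseq (\<lambda>n. h x * indicator (C n) x)" for h :: "'e \<Rightarrow> ennreal" and x
      using Cinc by (auto simp: incseq_def indicator_def)
    have "functional_up_to X A f T \<omega> = (SUP n. functional_up_to X A (?f n) T \<omega>)"
      using functional_up_to_SUP[of ?f A T \<omega>] inc[of f] by (simp add: lim)
    moreover have "functional_up_to X B g T \<omega> = (SUP n. functional_up_to X B (?g n) T \<omega>)"
      using functional_up_to_SUP[of ?g B T \<omega>] inc[of g] by (simp add: lim)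
    ultimately show ?case using elim by simp
  qed
qed

text \<open>Let \<open>g\<close> be the density of \<open>f . \<beta>\<close> with respect to
  \<open>\<gamma>\<close>. The functional of \<open>f\<close> along \<open>A\<close> is that of
  \<open>g\<close> along \<open>B\<close>, and \<open>g \<le> 1\<close>.\<close>

lemma functional_le_of_density_le:
  assumes A: "strict_pcaf X A" "revuz_correspondence X G A \<beta>" and \<beta>: "strictly_smooth_measure m D \<E> G \<beta>"
    and B: "strict_pcaf X B" "revuz_correspondence X G B \<gamma>" and \<gamma>: "smooth_measure m D \<E> \<gamma>"
    and f: "f \<in> borel_measurable borel" "\<And>x. f x \<le> 1"
    and le: "\<And>S. S \<in> sets borel \<Longrightarrow> emeasure (density \<beta> f) S \<le> emeasure \<gamma> S" and T: "0 \<le> T"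
  shows "AE \<omega> in law X (Some x). T \<in> alive X \<omega> \<longrightarrow> functional_up_to X A f T \<omega> \<le> B (ennreal T) \<omega>"
proof -
  have \<beta>s: "sets \<beta> = sets borel" by (rule smooth_measure_sets[OF strictly_smooth_smooth[OF \<beta>]])
  have \<gamma>s: "sets \<gamma> = sets borel" by (rule smooth_measure_sets[OF \<gamma>])
  interpret \<gamma>: sigma_finite_measure \<gamma> by (rule smooth_measure_sigma_finite[OF locally_compact_space \<gamma>])
  obtain g where g: "g \<in> borel_measurable \<gamma>" "density \<gamma> g = density \<beta> f" "\<And>x. g x \<le> 1"
    by (rule \<gamma>.Radon_Nikodym_le_1[of "density \<beta> f"]) (auto simp: \<beta>s \<gamma>s le)
  have gb: "g \<in> borel_measurable borel" using g(1) by (simp add: measurable_cong_sets[OF \<gamma>s refl])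
  obtain \<Lambda> where \<Lambda>: "\<And>x. AE \<omega> in law X x. \<omega> \<in> \<Lambda>" "\<And>\<omega>. \<omega> \<in> \<Lambda> \<Longrightarrow> pcaf_path X B \<omega> \<or> alive X \<omega> = {}"
    using strict_pcaf_good_set[OF B(1)] by metis
  show ?thesis
    using functional_eq_of_density_eq[OF A \<beta> B \<gamma>s f gb g(3) g(2)[symmetric] T] \<Lambda>(1)
  proof eventually_elim
    case (elim \<omega>)
    show ?case
    proof
      assume al: "T \<in> alive X \<omega>"
      then have path: "pcaf_path X B \<omega>" using \<Lambda>(2)[OF elim(2)] by blast
      show "functional_up_to X A f T \<omega> \<le> B (ennreal T) \<omega>"
        using stieltjes_le[OF path al g(3)] elim(1) by (simp add: functional_up_to_alive[OF path al gb])
    qed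
  qed
qed

text \<open>
  Domination passes to an increasing limit of measures: with \<open>f \<cdot> \<beta> = h \<cdot> \<nu>\<close> and \<open>\<gamma>\<^sub>k = h\<^sub>k \<cdot> \<nu>\<close>, the
  measures \<open>min h h\<^sub>k \<cdot> \<nu>\<close> lie below both \<open>f \<cdot> \<beta>\<close> and \<open>\<gamma>\<^sub>k\<close> and increase to \<open>f \<cdot> \<beta>\<close>.
\<close>

lemma functional_le_SUP:
  assumes A: "strict_pcaf X A" "revuz_correspondence X G A \<beta>" and \<beta>: "sets \<beta> = sets borel"
    and \<nu>: "sigma_finite_measure \<nu>" "sets \<nu> = sets borel"
    and \<gamma>: "\<And>k. sets (\<gamma> k) = sets borel" "measures_increase_to \<gamma> \<nu>"
    and f [measurable]: "f \<in> borel_measurable borel" and f1: "\<And>x. f x \<le> 1"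
    and le: "\<And>S. S \<in> sets borel \<Longrightarrow> emeasure (density \<beta> f) S \<le> emeasure \<nu> S" and T: "0 \<le> T"
    and V: "\<And>k f'. f' \<in> borel_measurable borel \<Longrightarrow> (\<And>x. f' x \<le> 1) \<Longrightarrow>
      (\<And>S. S \<in> sets borel \<Longrightarrow> emeasure (density \<beta> f') S \<le> emeasure (\<gamma> k) S) \<Longrightarrow>
      AE \<omega> in law X (Some x). T \<in> alive X \<omega> \<longrightarrow> functional_up_to X A f' T \<omega> \<le> V k \<omega>"
  shows "AE \<omega> in law X (Some x). T \<in> alive X \<omega> \<longrightarrow> functional_up_to X A f T \<omega> \<le> (SUP k. V k \<omega>)"
proof -
  interpret \<nu>: sigma_finite_measure \<nu> by fact
  note [measurable_cong] = \<beta> \<nu>(2) \<gamma>(1)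
  obtain h where h': "h \<in> borel_measurable \<nu>" and h: "density \<nu> h = density \<beta> f" "\<And>x. h x \<le> 1"
    by (rule \<nu>.Radon_Nikodym_le_1[of "density \<beta> f"]) (auto simp: \<beta> \<nu>(2) le)
  have "\<exists>hk. hk \<in> borel_measurable \<nu> \<and> density \<nu> hk = \<gamma> k \<and> (\<forall>x. hk x \<le> (1 :: ennreal))" for k
    by (rule \<nu>.Radon_Nikodym_le_1[of "\<gamma> k"]) (use \<gamma> \<nu>(2) measures_increase_to_le in auto)
  then obtain hk where hk': "\<And>k. hk k \<in> borel_measurable \<nu>" and hk: "\<And>k. density \<nu> (hk k) = \<gamma> k" "\<And>k x. hk k x \<le> 1"
    by metis
  note [measurable] = h' hk'
  have [measurable]: "h \<in> borel_measurable borel" "\<And>k. hk k \<in> borel_measurable borel"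
    using h' hk' by (auto simp: measurable_cong_sets[OF \<nu>(2) refl])
  have inc: "AE x in \<nu>. hk k x \<le> hk (Suc k) x" for k
  proof (rule \<nu>.AE_le_of_density_le[OF hk' hk'])
    fix S assume "S \<in> sets \<nu>"
    then show "emeasure (density \<nu> (hk k)) S \<le> emeasure (density \<nu> (hk (Suc k))) S"
      using \<gamma>(2) unfolding measures_increase_to_def hk(1) by (auto simp: \<nu>(2) incseq_Suc_iff)
  qed
  have sup: "AE x in \<nu>. (SUP k. hk k x) = 1"
  proof (rule \<nu>.density_unique)
    show "density \<nu> (\<lambda>x. SUP k. hk k x) = density \<nu> (\<lambda>_. 1)"
    proof (rule measure_eqI)
      fix S assume "S \<in> sets (density \<nu> (\<lambda>x. SUP k. hk k x))"
      then have S: "S \<in> sets \<nu>" "S \<in> sets borel" using \<nu>(2) by auto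
      have "emeasure (density \<nu> (\<lambda>x. SUP k. hk k x)) S = (\<integral>\<^sup>+x. (SUP k. hk k x * indicator S x) \<partial>\<nu>)"
        using S by (subst emeasure_density) (auto simp: SUP_mult_right_ennreal)
      also have "\<dots> = (SUP k. \<integral>\<^sup>+x. hk k x * indicator S x \<partial>\<nu>)"
        using S inc by (intro nn_integral_monotone_convergence_SUP_AE) (auto intro!: eventually_mono[OF inc] mult_right_mono)
      also have "\<dots> = (SUP k. emeasure (\<gamma> k) S)"
        using S by (simp add: emeasure_density flip: hk(1))
      also have "\<dots> = emeasure \<nu> S"
        using \<gamma>(2) S LIMSEQ_unique[OF LIMSEQ_SUP] unfolding measures_increase_to_def by blast
      finally show "emeasure (density \<nu> (\<lambda>x. SUP k. hk k x)) S = emeasure (density \<nu> (\<lambda>_. 1)) S"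
        by (simp add: density_1)
    qed simp
  qed auto
  \<comment> \<open>Off \<open>N\<close> the density \<open>h\<close> is positive and the
    \<open>hk k\<close> increase to one at every point, not merely almost everywhere.
    \<open>N\<close> is null for \<open>h . \<nu>\<close>, which is
    \<open>f . \<beta>\<close>.\<close>
  define N where "N = {x. h x = 0 \<or> (\<exists>k. \<not> hk k x \<le> hk (Suc k) x) \<or> (SUP k. hk k x) \<noteq> 1}"
  have N [measurable]: "N \<in> sets borel"
  proof -
    have "{x \<in> space borel. h x = 0 \<or> (\<exists>k. \<not> hk k x \<le> hk (Suc k) x) \<or> (SUP k. hk k x) \<noteq> 1} \<in> sets borel"
      by measurable
    then show ?thesis by (simp add: N_def)
  qed
  have offN: "h x \<noteq> 0" "incseq (\<lambda>k. hk k x)" "(SUP k. hk k x) = 1" if "x \<notin> N" for x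
    using that by (auto simp: N_def incseq_Suc_iff)
  \<comment> \<open>Off \<open>N\<close>, dividing by \<open>h\<close> and using that
    \<open>h . \<nu>\<close> equals \<open>f . \<beta>\<close> writes the measure with
    \<open>\<nu>\<close>-density \<open>min h (hk k)\<close> as
    \<open>F k . \<beta>\<close>.\<close>
  define F where "F k x = f x * inverse (h x) * min (h x) (hk k x) * indicator (- N) x" for k x
  have hfin: "h x < top" for x using h(2)[of x] by (auto intro: le_less_trans)
  have [measurable]: "F k \<in> borel_measurable borel" for k unfolding F_def by measurable
  have F_SUP: "(SUP k. F k x) = f x * indicator (- N) x" and F_inc: "incseq (\<lambda>k. F k x)" for x
  proof -
    show "incseq (\<lambda>k. F k x)"
      unfolding F_def using offN(2)[of x]
      by (cases "x \<in> N") (auto simp: incseq_def intro!: mult_left_mono min.mono)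
    show "(SUP k. F k x) = f x * indicator (- N) x"
    proof (cases "x \<in> N")
      case False
      have "(\<lambda>k. min (h x) (hk k x)) \<longlonglongrightarrow> min (h x) (SUP k. hk k x)"
        by (intro tendsto_min tendsto_const LIMSEQ_SUP offN(2) False)
      moreover have "incseq (\<lambda>k. min (h x) (hk k x))"
        using offN(2)[OF False] by (auto simp: incseq_def intro: min.coboundedI2)
      ultimately have "(SUP k. min (h x) (hk k x)) = min (h x) (SUP k. hk k x)"
        by (rule LIMSEQ_unique[OF LIMSEQ_SUP, rotated])
      also have "\<dots> = h x" using offN(3)[OF False] h(2)[of x] by (simp add: min_absorb1)
      finally have *: "(SUP k. min (h x) (hk k x)) = h x" .
      have "(SUP k. F k x) = f x * inverse (h x) * (SUP k. min (h x) (hk k x))"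
        using False by (simp add: F_def SUP_mult_left_ennreal)
      also have "\<dots> = f x * (inverse (h x) * h x)" unfolding * by (simp add: mult.assoc)
      also have "inverse (h x) * h x = 1"
        using offN(1)[OF False] hfin[of x] by (metis ennreal_divide_self divide_ennreal_def mult.commute less_top infinity_ennreal_def)
      finally show ?thesis using False by simp
    qed (simp add: F_def)
  qed
  have Fle: "F k x \<le> 1" for k x
  proof -
    have "F k x \<le> (SUP k. F k x)" by (rule SUP_upper) simp
    also have "\<dots> \<le> 1" unfolding F_SUP using f1[of x] by (auto simp: indicator_def)
    finally show ?thesis .
  qed
  have dens: "emeasure (density \<beta> (F k)) S \<le> emeasure (\<gamma> k) S" if S [measurable]: "S \<in> sets borel" for k S
  proof -
    have "emeasure (density \<beta> (F k)) S = (\<integral>\<^sup>+x. f x * (inverse (h x) * min (h x) (hk k x) * indicator (- N) x * indicator S x) \<partial>\<beta>)"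
      using S by (subst emeasure_density) (auto simp: F_def \<beta> mult.assoc)
    also have "\<dots> = (\<integral>\<^sup>+x. inverse (h x) * min (h x) (hk k x) * indicator (- N) x * indicator S x \<partial>density \<beta> f)"
      by (subst nn_integral_density) auto
    also have "\<dots> = (\<integral>\<^sup>+x. h x * (inverse (h x) * min (h x) (hk k x) * indicator (- N) x * indicator S x) \<partial>\<nu>)"
      unfolding h(1)[symmetric] by (subst nn_integral_density) auto
    also have "\<dots> \<le> (\<integral>\<^sup>+x. hk k x * indicator S x \<partial>\<nu>)"
    proof (rule nn_integral_mono)
      fix x
      have "h x * inverse (h x) = 1" if "x \<notin> N"
        using offN(1)[OF that] hfin[of x] by (metis ennreal_divide_self divide_ennreal_def less_top infinity_ennreal_def)
      then show "h x * (inverse (h x) * min (h x) (hk k x) * indicator (- N) x * indicator S x) \<le> hk k x * indicator S x"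
        by (cases "x \<in> N") (auto simp: mult.assoc[symmetric] intro!: mult_right_mono)
    qed
    also have "\<dots> = emeasure (\<gamma> k) S"
      unfolding hk(1)[symmetric] using S by (subst emeasure_density) (auto simp: \<nu>(2))
    finally show ?thesis .
  qed
  \<comment> \<open>The part of \<open>f\<close> on \<open>N\<close>, which the \<open>F k\<close>
    do not reach, has zero potential and is discarded.\<close>
  have zero: "AE \<omega> in law X (Some x). functional_up_to X A (\<lambda>x. f x * indicator N x) T \<omega> = 0"
  proof (rule functional_up_to_null[OF A _ _ T])
    fix y
    have "AE x in \<nu>. h x * (G y x * indicator N x) = 0"
      using AE_all_countable[THEN iffD2, rule_format, OF inc] sup
      by eventually_elim (auto simp: N_def indicator_def)
    then have "(\<integral>\<^sup>+x. h x * (G y x * indicator N x) \<partial>\<nu>) = (\<integral>\<^sup>+x. 0 \<partial>\<nu>)" by (rule nn_integral_cong_AE)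
    moreover have "(\<integral>\<^sup>+x. G y x * (f x * indicator N x) \<partial>\<beta>) = (\<integral>\<^sup>+x. G y x * indicator N x \<partial>density \<beta> f)"
      by (subst nn_integral_density) (auto intro!: nn_integral_cong simp: mult_ac)
    moreover have "\<dots> = (\<integral>\<^sup>+x. h x * (G y x * indicator N x) \<partial>\<nu>)"
      unfolding h(1)[symmetric] by (subst nn_integral_density) auto
    ultimately show "(\<integral>\<^sup>+x. G y x * (f x * indicator N x) \<partial>\<beta>) = 0" by simp
  qed measurable
  have "AE \<omega> in law X (Some x). \<forall>k. T \<in> alive X \<omega> \<longrightarrow> functional_up_to X A (F k) T \<omega> \<le> V k \<omega>"
    unfolding AE_all_countable
  proof
    fix k
    show "AE \<omega> in law X (Some x). T \<in> alive X \<omega> \<longrightarrow> functional_up_to X A (F k) T \<omega> \<le> V k \<omega>"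
      by (rule V) (simp_all add: Fle dens)
  qed
  with zero show ?thesis
  proof eventually_elim
    case (elim \<omega>)
    show ?case
    proof
      assume al: "T \<in> alive X \<omega>"
      have "functional_up_to X A f T \<omega> \<le>
          functional_up_to X A (\<lambda>x. SUP k. F k x) T \<omega> + functional_up_to X A (\<lambda>x. f x * indicator N x) T \<omega>"
        unfolding F_SUP by (rule functional_up_to_subadditive) (auto simp: indicator_def)
      also have "\<dots> = (SUP k. functional_up_to X A (F k) T \<omega>)"
        using elim(1) by (simp add: functional_up_to_SUP F_inc)
      also have "\<dots> \<le> (SUP k. V k \<omega>)" using elim(2) al by (intro SUP_mono) auto
      finally show "functional_up_to X A f T \<omega> \<le> (SUP k. V k \<omega>)" .
    qed
  qed
qed

end

section \<open>Convergence of the functionals\<close>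

definition approximated_by ::
    "'e::topological_space measure \<Rightarrow> ('e \<Rightarrow> real) set \<Rightarrow> (('e \<Rightarrow> real) \<Rightarrow> ('e \<Rightarrow> real) \<Rightarrow> real) \<Rightarrow>
     ('w, 'e) markov_process \<Rightarrow> ('e \<Rightarrow> 'e \<Rightarrow> ennreal) \<Rightarrow> 'e measure \<Rightarrow>
     (nat \<Rightarrow> 'e measure) \<Rightarrow> (nat \<Rightarrow> ennreal \<Rightarrow> 'w \<Rightarrow> ennreal) \<Rightarrow> bool" where
  "approximated_by m D \<E> X G \<nu> \<beta> B \<longleftrightarrow>
     (\<forall>n. strictly_smooth_measure m D \<E> G (\<beta> n)) \<and> measures_increase_to \<beta> \<nu> \<and>
     (\<forall>n. strict_pcaf X (B n) \<and> revuz_correspondence X G (B n) (\<beta> n))"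

lemma smooth_functionalE:
  assumes "smooth_functional m D \<E> X G \<nu> A"
  obtains \<beta> B where "approximated_by m D \<E> X G \<nu> \<beta> B" "A = (\<lambda>t \<omega>. SUP n. B n t \<omega>)"
  using assms unfolding smooth_functional_def approximated_by_def by blast

context green_process
begin

lemma AE_pcaf_path: "strict_pcaf X A \<Longrightarrow> AE \<omega> in law X x. pcaf_path X A \<omega> \<or> alive X \<omega> = {}"
  using strict_pcaf_good_set[of A] by (metis (mono_tags, lifting) eventually_mono)

text \<open>Measures below a single \<open>\<gamma> k\<close> are handled by comparing densities;
  \<open>functional_le_SUP\<close> then passes to the increasing limit \<open>\<nu>\<close>.\<close>

lemma pcaf_le_limit_functional:
  assumes A: "strict_pcaf X A" "revuz_correspondence X G A \<beta>" and \<beta>: "strictly_smooth_measure m D \<E> G \<beta>"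
    and \<nu>: "smooth_measure m D \<E> \<nu>" and B: "approximated_by m D \<E> X G \<nu> \<gamma> B"
    and f: "f \<in> borel_measurable borel" "\<And>x. f x \<le> 1"
    and le: "\<And>S. S \<in> sets borel \<Longrightarrow> emeasure (density \<beta> f) S \<le> emeasure \<nu> S" and T: "0 \<le> T"
  shows "AE \<omega> in law X (Some x). T \<in> alive X \<omega> \<longrightarrow> functional_up_to X A f T \<omega> \<le> (SUP k. B k (ennreal T) \<omega>)"
proof (rule functional_le_SUP[OF A _ _ _ _ _ f le T])
  have \<gamma>: "strictly_smooth_measure m D \<E> G (\<gamma> k)" "strict_pcaf X (B k)" "revuz_correspondence X G (B k) (\<gamma> k)" for k
    using B by (auto simp: approximated_by_def)
  have inc: "measures_increase_to \<gamma> \<nu>" using B by (simp add: approximated_by_def)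
  show "sets \<beta> = sets borel" by (rule smooth_measure_sets[OF strictly_smooth_smooth[OF \<beta>]])
  show "sigma_finite_measure \<nu>" by (rule smooth_measure_sigma_finite[OF locally_compact_space \<nu>])
  show "sets \<nu> = sets borel" by (rule smooth_measure_sets[OF \<nu>])
  show "sets (\<gamma> k) = sets borel" for k by (rule smooth_measure_sets[OF strictly_smooth_smooth[OF \<gamma>(1)]])
  show "measures_increase_to \<gamma> \<nu>" by (rule inc)
  fix k f' assume f': "f' \<in> borel_measurable borel" "\<And>x. f' x \<le> 1"
    "\<And>S. S \<in> sets borel \<Longrightarrow> emeasure (density \<beta> f') S \<le> emeasure (\<gamma> k) S"
  show "AE \<omega> in law X (Some x). T \<in> alive X \<omega> \<longrightarrow> functional_up_to X A f' T \<omega> \<le> B k (ennreal T) \<omega>"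
    by (rule functional_le_of_density_le[OF A \<beta> \<gamma>(2,3) strictly_smooth_smooth[OF \<gamma>(1)] f' T])
qed

lemma functional_up_to_one:
  "pcaf_path X A \<omega> \<or> alive X \<omega> = {} \<Longrightarrow> T \<in> alive X \<omega> \<Longrightarrow> functional_up_to X A (\<lambda>_. 1) T \<omega> = A (ennreal T) \<omega>"
  using functional_up_to_alive[of A \<omega> T "\<lambda>_. 1"] stieltjes_one[of A \<omega> T] by auto

text \<open>The supremum on the right need not be continuous in time, but it is increasing.
  Approximation of \<open>t\<close> from below by rationals therefore suffices: \<open>A\<close> is
  continuous, and the right side at earlier times is at most its value at \<open>t\<close>.\<close>

lemma AE_le_all_times:
  assumes A: "strict_pcaf X A" and V: "\<And>k. strict_pcaf X (V k)"
    and le: "\<And>T. 0 \<le> T \<Longrightarrow> AE \<omega> in law X x. T \<in> alive X \<omega> \<longrightarrow> A (ennreal T) \<omega> \<le> (SUP k::'k::countable. V k (ennreal T) \<omega>)"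
  shows "AE \<omega> in law X x. \<forall>t\<in>alive X \<omega>. A (ennreal t) \<omega> \<le> (SUP k. V k (ennreal t) \<omega>)"
proof -
  have "AE \<omega> in law X x. \<forall>q\<in>\<rat> \<inter> {0..}. q \<in> alive X \<omega> \<longrightarrow> A (ennreal q) \<omega> \<le> (SUP k. V k (ennreal q) \<omega>)"
    using le by (subst AE_ball_countable) (auto intro: countable_Int1 countable_rat)
  moreover have "AE \<omega> in law X x. \<forall>k. pcaf_path X (V k) \<omega> \<or> alive X \<omega> = {}"
    unfolding AE_all_countable using AE_pcaf_path[OF V] by blast
  ultimately show ?thesis using AE_pcaf_path[OF A, of x]
  proof eventually_elim
    case (elim \<omega>)
    show ?case
    proof
      fix t assume t: "t \<in> alive X \<omega>"
      then have path: "pcaf_path X A \<omega>" "\<And>k. pcaf_path X (V k) \<omega>" and t0: "0 \<le> t"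
        using elim by (auto simp: alive_def)
      \<comment> \<open>Rounding down gives rational times not exceeding \<open>t\<close>, at which
        the path is still alive.\<close>
      define q where "q n = real_of_int \<lfloor>t * real (Suc n)\<rfloor> / real (Suc n)" for n
      have q: "0 \<le> q n" "q n \<le> t" "q n \<in> \<rat>" "t - 1 / real (Suc n) \<le> q n" for n
      proof -
        show "0 \<le> q n" using t0 by (simp add: q_def)
        have "real_of_int \<lfloor>t * real (Suc n)\<rfloor> / real (Suc n) \<le> t * real (Suc n) / real (Suc n)"
          by (intro divide_right_mono) auto
        then show "q n \<le> t" by (simp add: q_def)
        show "q n \<in> \<rat>" by (simp add: q_def)
        have "(t * real (Suc n) - 1) / real (Suc n) \<le> real_of_int \<lfloor>t * real (Suc n)\<rfloor> / real (Suc n)"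
          by (intro divide_right_mono) (linarith, simp)
        then show "t - 1 / real (Suc n) \<le> q n" by (simp add: q_def field_simps)
      qed
      have "q \<longlonglongrightarrow> t"
      proof (rule tendsto_sandwich)
        show "(\<lambda>n. t - 1 / real (Suc n)) \<longlonglongrightarrow> t"
          using tendsto_diff[OF tendsto_const LIMSEQ_Suc[OF lim_1_over_n], of t] by simp
      qed (use q in auto)
      then have "(\<lambda>n. A (ennreal (q n)) \<omega>) \<longlonglongrightarrow> A (ennreal t) \<omega>"
        using path(1) unfolding pcaf_path_def
        by (intro continuous_on_tendsto_compose[of "{..<\<infinity>}" "\<lambda>t. A t \<omega>"] tendsto_ennrealI) auto
      moreover have "A (ennreal (q n)) \<omega> \<le> (SUP k. V k (ennreal t) \<omega>)" for n
      proof -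
        have "A (ennreal (q n)) \<omega> \<le> (SUP k. V k (ennreal (q n)) \<omega>)"
          using elim(1) q[of n] alive_downward[OF t, of "q n"] by blast
        also have "\<dots> \<le> (SUP k. V k (ennreal t) \<omega>)"
          using q[of n] by (intro SUP_mono' pcaf_path_mono[OF path(2)] ennreal_leI) auto
        finally show ?thesis .
      qed
      ultimately show "A (ennreal t) \<omega> \<le> (SUP k. V k (ennreal t) \<omega>)"
        by (intro LIMSEQ_le_const2) auto
    qed
  qed
qed

text \<open>Each approximating \<open>\<beta> j\<close> lies below \<open>\<nu>\<close>, so its
  functional is dominated by the limit functional of \<open>\<nu>\<close>. Used in both directions
  for one smooth measure, this is the independence of the limit functional from the approximating
  sequence.\<close>

lemma limit_functional_mono:
  assumes \<nu>: "smooth_measure m D \<E> \<nu>" and A: "approximated_by m D \<E> X G \<nu>' \<beta> A"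
    and B: "approximated_by m D \<E> X G \<nu> \<gamma> B"
    and le: "\<And>S. S \<in> sets borel \<Longrightarrow> emeasure \<nu>' S \<le> emeasure \<nu> S"
  shows "AE \<omega> in law X (Some x). \<forall>t\<in>alive X \<omega>. (SUP k. A k (ennreal t) \<omega>) \<le> (SUP k. B k (ennreal t) \<omega>)"
proof -
  have \<beta>: "strictly_smooth_measure m D \<E> G (\<beta> k)" "strict_pcaf X (A k)" "revuz_correspondence X G (A k) (\<beta> k)" for k
    using A by (auto simp: approximated_by_def)
  have inc: "measures_increase_to \<beta> \<nu>'" using A by (simp add: approximated_by_def)
  have "AE \<omega> in law X (Some x). \<forall>t\<in>alive X \<omega>. A j (ennreal t) \<omega> \<le> (SUP k. B k (ennreal t) \<omega>)" for j
  proof (rule AE_le_all_times[OF \<beta>(2)])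
    show "strict_pcaf X (B k)" for k using B by (simp add: approximated_by_def)
    fix T :: real assume T: "0 \<le> T"
    have "emeasure (density (\<beta> j) (\<lambda>_. 1)) S \<le> emeasure \<nu> S" if "S \<in> sets borel" for S
      using measures_increase_to_le[OF inc that, of j] le[OF that] by (simp add: density_1)
    from pcaf_le_limit_functional[OF \<beta>(2,3,1) \<nu> B _ _ this T, of x] AE_pcaf_path[OF \<beta>(2)[of j], of "Some x"]
    show "AE \<omega> in law X (Some x). T \<in> alive X \<omega> \<longrightarrow> A j (ennreal T) \<omega> \<le> (SUP k. B k (ennreal T) \<omega>)"
      by (auto simp: functional_up_to_one elim!: eventually_elim2)
  qed
  then have "AE \<omega> in law X (Some x). \<forall>j. \<forall>t\<in>alive X \<omega>. A j (ennreal t) \<omega> \<le> (SUP k. B k (ennreal t) \<omega>)"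
    unfolding AE_all_countable by blast
  then show ?thesis by eventually_elim (auto intro: SUP_least)
qed

text \<open>The passage from \<open>\<nu>n n\<close> to \<open>\<nu>\<close> is again an increasing
  limit of measures, so \<open>functional_le_SUP\<close> is used once more, with the limit
  functionals of the \<open>\<nu>n n\<close> as bounds. The two indices are merged into pairs
  because \<open>AE_le_all_times\<close> takes one countable family of strict functionals.\<close>

lemma limit_functional_le_SUP:
  assumes \<nu>: "smooth_measure m D \<E> \<nu>" and \<nu>n: "\<And>n. smooth_measure m D \<E> (\<nu>n n)" "measures_increase_to \<nu>n \<nu>"
    and B: "approximated_by m D \<E> X G \<nu> \<gamma> B" and A: "\<And>n. approximated_by m D \<E> X G (\<nu>n n) (\<beta> n) (A n)"
  shows "AE \<omega> in law X (Some x). \<forall>t\<in>alive X \<omega>. (SUP k. B k (ennreal t) \<omega>) \<le> (SUP n. SUP k. A n k (ennreal t) \<omega>)"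
proof -
  have \<gamma>: "strictly_smooth_measure m D \<E> G (\<gamma> k)" "strict_pcaf X (B k)" "revuz_correspondence X G (B k) (\<gamma> k)" for k
    using B by (auto simp: approximated_by_def)
  have inc: "measures_increase_to \<gamma> \<nu>" using B by (simp add: approximated_by_def)
  have Apcaf: "strict_pcaf X (A n k)" for n k using A[of n] by (simp add: approximated_by_def)
  have "AE \<omega> in law X (Some x). \<forall>t\<in>alive X \<omega>. B j (ennreal t) \<omega> \<le> (SUP p. (\<lambda>(n, k). A n k) p (ennreal t) \<omega>)" for j
  proof (rule AE_le_all_times[OF \<gamma>(2)])
    show "strict_pcaf X (case p of (n, k) \<Rightarrow> A n k)" for p using Apcaf by (cases p) simp
    fix T :: real assume T: "0 \<le> T"
    have "AE \<omega> in law X (Some x). T \<in> alive X \<omega> \<longrightarrow> functional_up_to X (B j) (\<lambda>_. 1) T \<omega> \<le> (SUP n. SUP k. A n k (ennreal T) \<omega>)"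
    proof (rule functional_le_SUP[OF \<gamma>(2,3) _ _ _ _ \<nu>n(2) _ _ _ T])
      show "sets (\<gamma> j) = sets borel" by (rule smooth_measure_sets[OF strictly_smooth_smooth[OF \<gamma>(1)]])
      show "sigma_finite_measure \<nu>" by (rule smooth_measure_sigma_finite[OF locally_compact_space \<nu>])
      show "sets \<nu> = sets borel" by (rule smooth_measure_sets[OF \<nu>])
      show "sets (\<nu>n k) = sets borel" for k by (rule smooth_measure_sets[OF \<nu>n(1)])
      show "emeasure (density (\<gamma> j) (\<lambda>_. 1)) S \<le> emeasure \<nu> S" if "S \<in> sets borel" for S
        using measures_increase_to_le[OF inc that, of j] by (simp add: density_1)
      fix n f' assume f': "f' \<in> borel_measurable borel" "\<And>x. f' x \<le> 1"
        "\<And>S. S \<in> sets borel \<Longrightarrow> emeasure (density (\<gamma> j) f') S \<le> emeasure (\<nu>n n) S"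
      show "AE \<omega> in law X (Some x). T \<in> alive X \<omega> \<longrightarrow> functional_up_to X (B j) f' T \<omega> \<le> (SUP k. A n k (ennreal T) \<omega>)"
        by (rule pcaf_le_limit_functional[OF \<gamma>(2,3,1) \<nu>n(1) A f' T])
    qed auto
    with AE_pcaf_path[OF \<gamma>(2)[of j], of "Some x"]
    have "AE \<omega> in law X (Some x). T \<in> alive X \<omega> \<longrightarrow> B j (ennreal T) \<omega> \<le> (SUP n. SUP k. A n k (ennreal T) \<omega>)"
      by eventually_elim (simp add: functional_up_to_one)
    then show "AE \<omega> in law X (Some x). T \<in> alive X \<omega> \<longrightarrow> B j (ennreal T) \<omega> \<le> (SUP p. (\<lambda>(n, k). A n k) p (ennreal T) \<omega>)"
    proof eventually_elim
      case (elim \<omega>)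
      have "(SUP n. SUP k. A n k (ennreal T) \<omega>) \<le> (SUP p. (\<lambda>(n, k). A n k) p (ennreal T) \<omega>)"
      proof (intro SUP_least)
        fix n k show "A n k (ennreal T) \<omega> \<le> (SUP p. (\<lambda>(n, k). A n k) p (ennreal T) \<omega>)"
          by (rule SUP_upper2[of "(n, k)"]) auto
      qed
      with elim show ?case by (auto intro: order_trans)
    qed
  qed
  then have "AE \<omega> in law X (Some x). \<forall>j. \<forall>t\<in>alive X \<omega>. B j (ennreal t) \<omega> \<le> (SUP p. (\<lambda>(n, k). A n k) p (ennreal t) \<omega>)"
    unfolding AE_all_countable by blast
  then show ?thesis
  proof eventually_elim
    case (elim \<omega>)
    show ?case
    proof
      fix t assume t: "t \<in> alive X \<omega>"
      have "(SUP p. (\<lambda>(n, k). A n k) p (ennreal t) \<omega>) \<le> (SUP n. SUP k. A n k (ennreal t) \<omega>)"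
      proof (rule SUP_least)
        fix p :: "nat \<times> nat"
        obtain n k where p: "p = (n, k)" by (cases p)
        have "A n k (ennreal t) \<omega> \<le> (SUP k. A n k (ennreal t) \<omega>)" by (rule SUP_upper) simp
        also have "\<dots> \<le> (SUP n. SUP k. A n k (ennreal t) \<omega>)" by (rule SUP_upper) simp
        finally show "(\<lambda>(n, k). A n k) p (ennreal t) \<omega> \<le> (SUP n. SUP k. A n k (ennreal t) \<omega>)" by (simp add: p)
      qed
      then show "(SUP k. B k (ennreal t) \<omega>) \<le> (SUP n. SUP k. A n k (ennreal t) \<omega>)"
        using elim t by (intro SUP_least) (auto intro: order_trans)
    qed
  qed
qed

text \<open>Domination by \<open>A\<close>, monotonicity in \<open>n\<close> and the bound of
  \<open>A\<close> by the supremum hold at all alive times outside one null set, whichever versions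
  of the functionals are given.\<close>

theorem smooth_functional_increasing_limit:
  assumes \<nu>: "smooth_measure m D \<E> \<nu>" and \<nu>n: "\<And>n. smooth_measure m D \<E> (\<nu>n n)" "measures_increase_to \<nu>n \<nu>"
    and A: "smooth_functional m D \<E> X G \<nu> A" and An: "\<And>n. smooth_functional m D \<E> X G (\<nu>n n) (An n)"
  shows "AE \<omega> in law X (Some x). \<forall>t\<in>alive X \<omega>. (\<forall>n. An n (ennreal t) \<omega> \<le> A (ennreal t) \<omega>) \<and>
    (\<lambda>n. An n (ennreal t) \<omega>) \<longlonglongrightarrow> A (ennreal t) \<omega>"
proof -
  obtain \<gamma> B where B: "approximated_by m D \<E> X G \<nu> \<gamma> B" "A = (\<lambda>t \<omega>. SUP n. B n t \<omega>)"
    using smooth_functionalE[OF A] .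
  have "\<exists>\<beta> C. approximated_by m D \<E> X G (\<nu>n n) \<beta> C \<and> An n = (\<lambda>t \<omega>. SUP n. C n t \<omega>)" for n
    using smooth_functionalE[OF An[of n]] by metis
  then obtain \<beta> C where C: "\<And>n. approximated_by m D \<E> X G (\<nu>n n) (\<beta> n) (C n)" "\<And>n. An n = (\<lambda>t \<omega>. SUP k. C n k t \<omega>)"
    by metis
  have "AE \<omega> in law X (Some x). \<forall>n. \<forall>t\<in>alive X \<omega>. An n (ennreal t) \<omega> \<le> A (ennreal t) \<omega>"
    unfolding AE_all_countable B(2) C(2) using limit_functional_mono[OF \<nu> C(1) B(1) measures_increase_to_le[OF \<nu>n(2)]] by blast
  moreover have "AE \<omega> in law X (Some x). \<forall>n. \<forall>t\<in>alive X \<omega>. An n (ennreal t) \<omega> \<le> An (Suc n) (ennreal t) \<omega>"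
    unfolding AE_all_countable C(2)
  proof
    fix n
    show "AE \<omega> in law X (Some x). \<forall>t\<in>alive X \<omega>. (SUP k. C n k (ennreal t) \<omega>) \<le> (SUP k. C (Suc n) k (ennreal t) \<omega>)"
      using \<nu>n(2) by (intro limit_functional_mono[OF \<nu>n(1) C(1) C(1)]) (auto simp: measures_increase_to_def incseq_Suc_iff)
  qed
  moreover have "AE \<omega> in law X (Some x). \<forall>t\<in>alive X \<omega>. A (ennreal t) \<omega> \<le> (SUP n. An n (ennreal t) \<omega>)"
    unfolding B(2) C(2) by (rule limit_functional_le_SUP[OF \<nu> \<nu>n B(1) C(1)])
  ultimately show ?thesis
  proof eventually_elim
    case (elim \<omega>)
    show ?case
    proof (intro ballI conjI allI)
      fix t assume t: "t \<in> alive X \<omega>"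
      then show "An n (ennreal t) \<omega> \<le> A (ennreal t) \<omega>" for n using elim(1) by blast
      have "(\<lambda>n. An n (ennreal t) \<omega>) \<longlonglongrightarrow> (SUP n. An n (ennreal t) \<omega>)"
        using elim(2) t by (intro LIMSEQ_SUP) (auto simp: incseq_Suc_iff)
      also have "(SUP n. An n (ennreal t) \<omega>) = A (ennreal t) \<omega>"
        using elim(1,3) t by (intro antisym SUP_least) auto
      finally show "(\<lambda>n. An n (ennreal t) \<omega>) \<longlonglongrightarrow> A (ennreal t) \<omega>" .
    qed
  qed
qed

end

section \<open>Killed potentials\<close>

lemma exp_minus_le_1: "exp_minus a \<le> 1"
  by (simp add: exp_minus_def ennreal_le_1)

lemma exp_minus_antimono: "a \<le> b \<Longrightarrow> exp_minus b \<le> exp_minus a"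
  unfolding exp_minus_def by (auto intro!: ennreal_leI enn2real_mono simp: less_top top_unique)

lemma measurable_exp_minus [measurable]: "exp_minus \<in> borel_measurable borel"
  unfolding exp_minus_def[abs_def] by measurable

text \<open>At infinity the limit is zero, since a value above \<open>- ln e\<close> makes the
  exponential at most \<open>e\<close>; at finite points the real exponential is continuous.\<close>

lemma tendsto_exp_minus:
  assumes "(a \<longlongrightarrow> b) F"
  shows "((\<lambda>n. exp_minus (a n)) \<longlongrightarrow> exp_minus b) F"
proof (cases "b = \<infinity>")
  case False
  then have b: "b = ennreal (enn2real b)" by (simp add: less_top)
  have ev: "\<forall>\<^sub>F n in F. a n < \<infinity>" using False by (intro order_tendstoD(2)[OF assms]) (simp add: less_top)
  have "(a \<longlongrightarrow> ennreal (enn2real b)) F" unfolding b[symmetric] by (rule assms)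
  then have "((\<lambda>n. enn2real (a n)) \<longlongrightarrow> enn2real b) F"
    by (rule tendsto_enn2real) simp
  then have "((\<lambda>n. ennreal (exp (- enn2real (a n)))) \<longlongrightarrow> ennreal (exp (- enn2real b))) F"
    by (intro tendsto_ennrealI tendsto_exp tendsto_minus)
  then have "((\<lambda>n. exp_minus (a n)) \<longlongrightarrow> ennreal (exp (- enn2real b))) F"
    by (rule Lim_transform_eventually) (use ev in \<open>eventually_elim, auto simp: exp_minus_def\<close>)
  then show ?thesis using False by (simp add: exp_minus_def)
next
  case True
  show ?thesis
  proof (rule order_tendstoI)
    fix l assume "l < exp_minus b"
    then show "\<forall>\<^sub>F n in F. l < exp_minus (a n)" using True by (simp add: exp_minus_def)
  next
    fix u assume "exp_minus b < u"
    then have "0 < u" using True by (simp add: exp_minus_def)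
    then obtain z where z: "0 < z" "z < u" using dense by blast
    then obtain e where "z = ennreal e" "0 \<le> e" by (cases z) auto
    with z have e: "0 < e" "ennreal e < u" by auto
    have "\<forall>\<^sub>F n in F. ennreal (max 0 (- ln e)) < a n" using True by (intro order_tendstoD(1)[OF assms]) simp
    then show "\<forall>\<^sub>F n in F. exp_minus (a n) < u"
    proof eventually_elim
      case (elim n)
      have "exp_minus (a n) \<le> exp_minus (ennreal (max 0 (- ln e)))"
        using elim by (intro exp_minus_antimono) simp
      also have "\<dots> = ennreal (exp (- max 0 (- ln e)))" unfolding exp_minus_def by (subst enn2real_ennreal) auto
      also have "\<dots> \<le> ennreal (exp (ln e))" by (intro ennreal_leI) simp
      also have "\<dots> = ennreal e" using e(1) by simp
      finally show ?case using e(2) by (rule le_less_trans)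
    qed
  qed
qed

section \<open>Measurability and convergence of killed potentials\<close>

context lc_hunt_process
begin

text \<open>Good paths are continuous, so right limits along \<open>round_up\<close> exist on
  \<open>\<Lambda>\<close>, and off \<open>\<Lambda>\<close> the value is constantly zero. The
  horizons \<open>nat \<lceil>s\<rceil>\<close> exhaust the half-line.\<close>

lemma measurable_pcaf_joint:
  assumes pcaf: "strict_pcaf X A" and \<Lambda>: "\<Lambda> \<in> sets (completed_filtration X \<infinity>)"
    and path: "\<And>\<omega>. \<omega> \<in> \<Lambda> \<Longrightarrow> pcaf_path X A \<omega>"
  shows "(\<lambda>(\<omega>, s). if \<omega> \<in> \<Lambda> then A (ennreal s) \<omega> else 0) \<in> borel_measurable (completed_filtration X \<infinity> \<Otimes>\<^sub>M borel)"
proof -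
  let ?F = "completed_filtration X \<infinity>"
  let ?g = "\<lambda>r \<omega>. if \<omega> \<in> \<Lambda> then A (ennreal r) \<omega> else 0"
  have step: "(\<lambda>(\<omega>, s). ?g (min (max 0 s) (real i)) \<omega>) \<in> borel_measurable (?F \<Otimes>\<^sub>M borel)" for i
  proof (rule measurable_right_limit)
    fix r :: real
    have "A (ennreal r) \<in> borel_measurable ?F"
      by (rule measurable_completed_mono[OF strict_pcaf_measurable[OF pcaf]]) auto
    then show "?g r \<in> borel_measurable ?F" using \<Lambda> by (intro measurable_If_set) auto
  next
    fix \<omega> s assume s: "0 \<le> s" "s < real i"
    show "(\<lambda>n. ?g (round_up n (real i) s) \<omega>) \<longlonglongrightarrow> ?g s \<omega>"
    proof (cases "\<omega> \<in> \<Lambda>")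
      case True
      have "(\<lambda>n. A (ennreal (round_up n (real i) s)) \<omega>) \<longlonglongrightarrow> A (ennreal s) \<omega>"
        using path[OF True] unfolding pcaf_path_def
        by (intro continuous_on_tendsto_compose[of "{..<\<infinity>}" "\<lambda>t. A t \<omega>"] tendsto_ennrealI round_up_tendsto s) auto
      then show ?thesis using True by simp
    qed simp
  qed simp
  have "(\<lambda>x. (\<lambda>i (\<omega>, s). ?g (min (max 0 s) (real i)) \<omega>) (nat \<lceil>snd x\<rceil>) x) \<in> borel_measurable (?F \<Otimes>\<^sub>M borel)"
    by (rule measurable_compose_countable[where f="\<lambda>i (\<omega>, s). ?g (min (max 0 s) (real i)) \<omega>", OF step]) measurable
  moreover have "ennreal (min (max 0 s) (real (nat \<lceil>s\<rceil>))) = ennreal s" for s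
    using real_nat_ceiling_ge[of s] by (auto simp: min_def max_def ennreal_neg)
  ultimately show ?thesis by (simp only: case_prod_beta')
qed

text \<open>Joint measurability in path and time after setting the functional to zero off a good
  set. A path outside that set is almost surely dead from the start, so killed potentials do not see
  the change.\<close>

definition measurable_functional :: "(ennreal \<Rightarrow> 'w \<Rightarrow> ennreal) \<Rightarrow> bool" where
  "measurable_functional A \<longleftrightarrow> (\<exists>\<Lambda>\<in>sets (completed_filtration X \<infinity>).
     (\<forall>x. AE \<omega> in law X x. \<omega> \<in> \<Lambda> \<or> alive X \<omega> = {}) \<and>
     (\<lambda>(\<omega>, s). if \<omega> \<in> \<Lambda> then A (ennreal s) \<omega> else 0) \<in> borel_measurable (completed_filtration X \<infinity> \<Otimes>\<^sub>M borel))"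

lemma measurable_functional_SUP:
  assumes "\<And>k::nat. strict_pcaf X (B k)"
  shows "measurable_functional (\<lambda>t \<omega>. SUP k. B k t \<omega>)"
proof -
  let ?F = "completed_filtration X \<infinity>"
  have "\<exists>\<Lambda>. \<Lambda> \<in> sets ?F \<and> (\<forall>x. AE \<omega> in law X x. \<omega> \<in> \<Lambda>) \<and> (\<forall>\<omega>\<in>\<Lambda>. pcaf_path X (B k) \<omega> \<or> alive X \<omega> = {})" for k
    using strict_pcaf_good_set[OF assms[of k]] by metis
  then obtain L where L: "\<And>k. L k \<in> sets ?F" "\<And>k x. AE \<omega> in law X x. \<omega> \<in> L k"
    "\<And>k \<omega>. \<omega> \<in> L k \<Longrightarrow> pcaf_path X (B k) \<omega> \<or> alive X \<omega> = {}" by metis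
  have D: "coord X 0 -` {None} \<in> sets ?F"
    using measurable_sets[OF measurable_coord[of 0 \<infinity> X] None_in_borel_cemetery] natural_subset_completed[of \<infinity>] by auto
  define \<Lambda> where "\<Lambda> = (\<Inter>k. L k) - coord X 0 -` {None}"
  have \<Lambda>: "\<Lambda> \<in> sets ?F" unfolding \<Lambda>_def using L(1) D by (intro sets.Diff sets.countable_INT) auto
  have path: "pcaf_path X (B k) \<omega>" if "\<omega> \<in> \<Lambda>" for k \<omega>
    using that L(3)[of \<omega> k] by (auto simp: \<Lambda>_def alive_empty_iff)
  show ?thesis
    unfolding measurable_functional_def
  proof (intro bexI[OF _ \<Lambda>] conjI allI)
    fix x
    have "AE \<omega> in law X x. \<forall>k. \<omega> \<in> L k" unfolding AE_all_countable using L(2) by blast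
    then show "AE \<omega> in law X x. \<omega> \<in> \<Lambda> \<or> alive X \<omega> = {}"
      by eventually_elim (auto simp: \<Lambda>_def alive_empty_iff)
    have "(\<lambda>x. SUP k. (\<lambda>(\<omega>, s). if \<omega> \<in> \<Lambda> then B k (ennreal s) \<omega> else 0) x) \<in> borel_measurable (?F \<Otimes>\<^sub>M borel)"
      by (intro borel_measurable_SUP measurable_pcaf_joint assms \<Lambda> path) auto
    moreover have "(\<lambda>(\<omega>, s). if \<omega> \<in> \<Lambda> then SUP k. B k (ennreal s) \<omega> else 0) =
        (\<lambda>x. SUP k. (\<lambda>(\<omega>, s). if \<omega> \<in> \<Lambda> then B k (ennreal s) \<omega> else 0) x)"
      by (auto simp: fun_eq_iff)
    ultimately show "(\<lambda>(\<omega>, s). if \<omega> \<in> \<Lambda> then SUP k. B k (ennreal s) \<omega> else 0) \<in> borel_measurable (?F \<Otimes>\<^sub>M borel)"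
      by simp
  qed
qed

definition killed_integral :: "(ennreal \<Rightarrow> 'w \<Rightarrow> ennreal) \<Rightarrow> ('e \<Rightarrow> ennreal) \<Rightarrow> 'w \<Rightarrow> ennreal" where
  "killed_integral A f \<omega> = (\<integral>\<^sup>+t\<in>alive X \<omega>. exp_minus (A (ennreal t) \<omega>) * case_option 0 f (coord X (ennreal t) \<omega>) \<partial>lborel)"

lemma killed_potential_eq: "killed_potential X A f x = (\<integral>\<^sup>+\<omega>. killed_integral A f \<omega> \<partial>law X (Some x))"
  by (simp add: killed_potential_def killed_integral_def)

lemma measurable_functional_path:
  assumes "measurable_functional A"
  shows "AE \<omega> in law X x. (\<lambda>t. A (ennreal t) \<omega>) \<in> borel_measurable borel \<or> alive X \<omega> = {}"
proof -
  obtain \<Lambda> where "\<forall>x. AE \<omega> in law X x. \<omega> \<in> \<Lambda> \<or> alive X \<omega> = {}"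
    and m: "(\<lambda>(\<omega>, s). if \<omega> \<in> \<Lambda> then A (ennreal s) \<omega> else 0) \<in> borel_measurable (completed_filtration X \<infinity> \<Otimes>\<^sub>M borel)"
    using assms unfolding measurable_functional_def by blast
  then have "AE \<omega> in law X x. \<omega> \<in> \<Lambda> \<or> alive X \<omega> = {}" by blast
  then show ?thesis
  proof eventually_elim
    case (elim \<omega>)
    have "(\<lambda>s. if \<omega> \<in> \<Lambda> then A (ennreal s) \<omega> else 0) \<in> borel_measurable borel"
      using measurable_compose[OF measurable_Pair1' m, of \<omega>] by simp
    then show ?case using elim by auto
  qed
qed

text \<open>The time integral of the jointly measurable version is measurable, and it agrees with
  the killed integral on a set that is full under every initial law.\<close>

lemma measurable_killed_integral:
  assumes A: "measurable_functional A" and f: "f \<in> borel_measurable borel"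
  shows "killed_integral A f \<in> borel_measurable (completed_filtration X \<infinity>)"
proof -
  let ?F = "completed_filtration X \<infinity>"
  obtain \<Lambda> where \<Lambda>: "\<Lambda> \<in> sets ?F" "\<And>x. AE \<omega> in law X x. \<omega> \<in> \<Lambda> \<or> alive X \<omega> = {}"
    and m: "(\<lambda>(\<omega>, s). if \<omega> \<in> \<Lambda> then A (ennreal s) \<omega> else 0) \<in> borel_measurable (?F \<Otimes>\<^sub>M borel)"
    using A unfolding measurable_functional_def by blast
  have D: "coord X 0 -` {None} \<in> sets ?F"
    using measurable_sets[OF measurable_coord[of 0 \<infinity> X] None_in_borel_cemetery] natural_subset_completed[of \<infinity>] by auto
  let ?G = "\<Lambda> \<union> coord X 0 -` {None}"
  have full: "AE \<omega> in law_from X \<mu>. \<omega> \<in> ?G" if "\<mu> \<in> space (prob_algebra borel_cemetery)" for \<mu>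
    by (rule AE_law_from[OF _ _ that]) (use \<Lambda> D in \<open>auto simp: alive_empty_iff\<close>)
  have X: "(\<lambda>(\<omega>, s). coord X (ennreal s) \<omega>) \<in> ?F \<Otimes>\<^sub>M borel \<rightarrow>\<^sub>M borel_cemetery"
  proof -
    have "(\<lambda>\<omega>. \<omega>) \<in> ?F \<rightarrow>\<^sub>M natural_filtration X \<infinity>"
      using natural_subset_completed[of \<infinity>] by (intro measurableI) auto
    from measurable_compose[OF measurable_fst this, of "borel :: real measure"]
    have "(\<lambda>x. (fst x, snd x)) \<in> ?F \<Otimes>\<^sub>M (borel :: real measure) \<rightarrow>\<^sub>M natural_filtration X \<infinity> \<Otimes>\<^sub>M borel"
      by (intro measurable_Pair measurable_snd)
    from measurable_compose[OF this measurable_coord_joint] show ?thesis by (simp add: case_prod_beta')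
  qed
  let ?h = "\<lambda>\<omega> s. (if \<omega> \<in> \<Lambda> then 1 else 0) * (exp_minus (if \<omega> \<in> \<Lambda> then A (ennreal s) \<omega> else 0) *
      (case_option 0 f (coord X (ennreal s) \<omega>)) * indicator {0..} s)"
  have i: "(\<lambda>x. if fst x \<in> \<Lambda> then 1 else 0 :: ennreal) \<in> borel_measurable (?F \<Otimes>\<^sub>M (borel :: real measure))"
  proof -
    have "(\<lambda>\<omega>. if \<omega> \<in> \<Lambda> then 1 else 0 :: ennreal) \<in> borel_measurable ?F" using \<Lambda>(1) by (intro measurable_If_set) auto
    from measurable_compose[OF measurable_fst this] show ?thesis .
  qed
  have e: "(\<lambda>x. exp_minus (if fst x \<in> \<Lambda> then A (ennreal (snd x)) (fst x) else 0)) \<in> borel_measurable (?F \<Otimes>\<^sub>M borel)"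
    using measurable_compose[OF m measurable_exp_minus] by (simp add: case_prod_beta')
  have c: "(\<lambda>x. case_option 0 f (coord X (ennreal (snd x)) (fst x))) \<in> borel_measurable (?F \<Otimes>\<^sub>M borel)"
    using measurable_compose[OF X measurable_case_option_zero[OF f]] by (simp add: case_prod_beta')
  have "(\<lambda>(\<omega>, s). ?h \<omega> s) \<in> borel_measurable (?F \<Otimes>\<^sub>M lborel)"
    unfolding case_prod_beta' using i e c by measurable
  from lborel.borel_measurable_nn_integral[OF this]
  have "(\<lambda>\<omega>. \<integral>\<^sup>+s. ?h \<omega> s \<partial>lborel) \<in> borel_measurable ?F" .
  then show ?thesis
  proof (rule measurable_completed_AE)
    fix \<mu> :: "'e option measure" assume "\<mu> \<in> space (prob_algebra borel_cemetery)"
    from full[OF this] show "AE \<omega> in law_from X \<mu>. killed_integral A f \<omega> = (\<integral>\<^sup>+s. ?h \<omega> s \<partial>lborel)"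
    proof eventually_elim
      case (elim \<omega>)
      have al: "s \<in> alive X \<omega> \<longleftrightarrow> 0 \<le> s \<and> coord X (ennreal s) \<omega> \<noteq> None" for s by (rule alive_iff)
      show ?case
      proof (cases "\<omega> \<in> \<Lambda>")
        case True
        then show ?thesis unfolding killed_integral_def
          by (intro nn_integral_cong) (auto simp: indicator_def al)
      next
        case False
        then have "alive X \<omega> = {}" using elim by (auto simp: alive_empty_iff)
        then show ?thesis using False by (simp add: killed_integral_def)
      qed
    qed
  qed
qed

lemma AE_killed_integrand_measurable:
  assumes A: "measurable_functional A" and f: "f \<in> borel_measurable borel"
  shows "AE \<omega> in law X x. (\<lambda>t. exp_minus (A (ennreal t) \<omega>) * case_option 0 f (coord X (ennreal t) \<omega>) * indicator (alive X \<omega>) t)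
    \<in> borel_measurable lborel"
  using measurable_functional_path[OF A, of x]
proof eventually_elim
  case (elim \<omega>)
  note [measurable] = f
  show ?case
  proof (cases "alive X \<omega> = {}")
    case False
    then have [measurable]: "(\<lambda>t. A (ennreal t) \<omega>) \<in> borel_measurable borel" using elim by blast
    show ?thesis by measurable
  qed simp
qed

text \<open>Additivity of the time integral needs integrands measurable in time, which is available
  on almost every path only.\<close>

lemma killed_potential_add:
  assumes A: "measurable_functional A" and f: "f \<in> borel_measurable borel" and g: "g \<in> borel_measurable borel"
  shows "killed_potential X A (\<lambda>y. f y + g y) x = killed_potential X A f x + killed_potential X A g x"
proof -
  let ?M = "completion (law X (Some x))"
  have "AE \<omega> in law X (Some x). killed_integral A (\<lambda>y. f y + g y) \<omega> = killed_integral A f \<omega> + killed_integral A g \<omega>"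
    using AE_killed_integrand_measurable[OF A f] AE_killed_integrand_measurable[OF A g]
  proof eventually_elim
    case (elim \<omega>)
    have *: "case_option 0 (\<lambda>y. f y + g y) z = case_option 0 f z + case_option 0 g z" for z by (cases z) auto
    show ?case
      unfolding killed_integral_def * nn_integral_add[OF elim, symmetric]
      by (simp add: distrib_left distrib_right)
  qed
  then have "killed_potential X A (\<lambda>y. f y + g y) x = (\<integral>\<^sup>+\<omega>. killed_integral A f \<omega> + killed_integral A g \<omega> \<partial>?M)"
    unfolding killed_potential_eq nn_integral_completion by (rule nn_integral_cong_AE)
  also have "\<dots> = (\<integral>\<^sup>+\<omega>. killed_integral A f \<omega> \<partial>?M) + (\<integral>\<^sup>+\<omega>. killed_integral A g \<omega> \<partial>?M)"
    by (intro nn_integral_add measurable_completion_law[OF measurable_killed_integral] A f g)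
  finally show ?thesis unfolding killed_potential_eq nn_integral_completion .
qed

lemma killed_potential_antimono:
  assumes "AE \<omega> in law X (Some x). \<forall>t\<in>alive X \<omega>. B (ennreal t) \<omega> \<le> A (ennreal t) \<omega>"
  shows "killed_potential X A f x \<le> killed_potential X B f x"
  unfolding killed_potential_def
proof (rule nn_integral_mono_AE)
  show "AE \<omega> in law X (Some x).
      (\<integral>\<^sup>+t\<in>alive X \<omega>. exp_minus (A (ennreal t) \<omega>) * case_option 0 f (coord X (ennreal t) \<omega>) \<partial>lborel) \<le>
      (\<integral>\<^sup>+t\<in>alive X \<omega>. exp_minus (B (ennreal t) \<omega>) * case_option 0 f (coord X (ennreal t) \<omega>) \<partial>lborel)"
    using assms
  proof eventually_elim
    case (elim \<omega>)
    show ?case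
    proof (rule nn_integral_mono)
      fix t :: real
      show "exp_minus (A (ennreal t) \<omega>) * case_option 0 f (coord X (ennreal t) \<omega>) * indicator (alive X \<omega>) t \<le>
          exp_minus (B (ennreal t) \<omega>) * case_option 0 f (coord X (ennreal t) \<omega>) * indicator (alive X \<omega>) t"
        using elim by (cases "t \<in> alive X \<omega>") (auto intro!: mult_right_mono exp_minus_antimono)
    qed
  qed
qed

lemma killed_potential_le_resolvent: "killed_potential X A f x \<le> resolvent X 0 f x"
  unfolding killed_potential_def resolvent_def
  by (intro nn_integral_mono mult_right_mono) (auto intro: exp_minus_le_1)

text \<open>A nonzero finite measure is normalised to an initial law on \<open>E\<close>, for which
  expectations have Borel versions. The zero measure cannot be normalised, but its completion makes
  every function measurable.\<close>

lemma measurable_killed_potential: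
  assumes A: "measurable_functional A" and f: "f \<in> borel_measurable borel"
    and L: "finite_measure L" "sets L = sets borel"
  shows "killed_potential X A f \<in> borel_measurable (completion L)"
proof (cases "emeasure L UNIV = 0")
  case True
  have sp: "space L = UNIV" using sets_eq_imp_space_eq[OF L(2)] by simp
  have "AE x in L. killed_potential X A f x = 0"
    using True sp L(2) by (intro AE_I[of _ _ UNIV]) auto
  then show ?thesis by (rule measurable_completion_AE[rotated]) auto
next
  case False
  interpret L: finite_measure L by fact
  note [measurable_cong] = L(2)
  have sp: "space L = UNIV" using sets_eq_imp_space_eq[OF L(2)] by simp
  let ?c = "inverse (emeasure L UNIV)"
  have fin: "emeasure L UNIV < top" using L.emeasure_finite[of UNIV] by (simp add: less_top[symmetric])
  have c: "?c * emeasure L UNIV = 1"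
    using False fin by (metis ennreal_divide_self divide_ennreal_def mult.commute less_top infinity_ennreal_def)
  then have c0: "0 < ?c" by (metis gr_zeroI mult_zero_left zero_neq_one)
  let ?d = "density L (\<lambda>_. ?c)"
  have pd: "prob_space ?d"
    using c by (intro prob_spaceI) (simp add: emeasure_density sp)
  define \<mu> where "\<mu> = distr ?d borel_cemetery Some"
  have \<mu>: "\<mu> \<in> space (prob_algebra borel_cemetery)"
    unfolding \<mu>_def by (auto simp: space_prob_algebra intro!: prob_space.prob_space_distr[OF pd])
  obtain H' where "H' \<in> borel_measurable (natural_filtration X \<infinity>)"
    "AE \<omega> in law_from X \<mu>. killed_integral A f \<omega> = H' \<omega>"
    and H2: "AE z in \<mu>. (\<integral>\<^sup>+\<omega>. killed_integral A f \<omega> \<partial>law X z) = (\<integral>\<^sup>+\<omega>. H' \<omega> \<partial>law X z)"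
    and H1: "(\<lambda>z. \<integral>\<^sup>+\<omega>. H' \<omega> \<partial>law X z) \<in> borel_measurable borel_cemetery"
    by (rule measurable_expectation_version[OF measurable_killed_integral[OF A f] \<mu>])
  have "AE x in ?d. (\<integral>\<^sup>+\<omega>. killed_integral A f \<omega> \<partial>law X (Some x)) = (\<integral>\<^sup>+\<omega>. H' \<omega> \<partial>law X (Some x))"
    using H2 unfolding \<mu>_def by (rule AE_distrD[rotated]) measurable
  then have ae: "AE x in L. killed_potential X A f x = (\<integral>\<^sup>+\<omega>. H' \<omega> \<partial>law X (Some x))"
    using c0 by (simp add: AE_density killed_potential_eq)
  have m: "(\<lambda>x. \<integral>\<^sup>+\<omega>. H' \<omega> \<partial>law X (Some x)) \<in> borel_measurable (completion L)"
  proof (rule measurable_completion)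
    show "(\<lambda>x. \<integral>\<^sup>+\<omega>. H' \<omega> \<partial>law X (Some x)) \<in> borel_measurable L"
      using measurable_compose[OF measurable_Some H1] by (simp add: measurable_cong_sets[OF L(2) refl])
  qed
  show ?thesis by (rule measurable_completion_AE[OF m ae]) simp
qed

text \<open>Dominated convergence is used twice, in time on almost every path and then over the
  paths. The dominating function is the integral without killing, obtained from the zero functional;
  its mean is at most \<open>resolvent X 0 f x\<close>.\<close>

lemma killed_potential_tendsto:
  assumes A: "measurable_functional A" and An: "\<And>n. measurable_functional (An n)"
    and f: "f \<in> borel_measurable borel" and fin: "resolvent X 0 f x < \<infinity>"
    and lim: "AE \<omega> in law X (Some x). \<forall>t\<in>alive X \<omega>. (\<lambda>n. An n (ennreal t) \<omega>) \<longlonglongrightarrow> A (ennreal t) \<omega>"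
  shows "(\<lambda>n. killed_potential X (An n) f x) \<longlonglongrightarrow> killed_potential X A f x"
proof -
  let ?M = "completion (law X (Some x))"
  let ?w = "killed_integral (\<lambda>_ _. 0) f"
  have zero: "measurable_functional (\<lambda>_ _. 0)"
    unfolding measurable_functional_def
    by (rule bexI[of _ UNIV]) (use sets.top[of "completed_filtration X \<infinity>"] in auto)
  have w: "?w \<in> borel_measurable ?M" by (rule measurable_completion_law[OF measurable_killed_integral[OF zero f]])
  have wfin: "(\<integral>\<^sup>+\<omega>. ?w \<omega> \<partial>?M) < \<infinity>"
    using killed_potential_le_resolvent[of "\<lambda>_ _. 0" f x] fin
    unfolding nn_integral_completion killed_potential_eq by (rule le_less_trans)
  have AEfin: "AE \<omega> in ?M. ?w \<omega> \<noteq> \<infinity>" using w wfin by (intro nn_integral_noteq_infinite) auto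
  have bnd: "killed_integral B f \<omega> \<le> ?w \<omega>" for B \<omega>
    unfolding killed_integral_def
    by (intro nn_integral_mono mult_right_mono) (auto intro: exp_minus_antimono)
  have "AE \<omega> in law X (Some x). \<forall>n. (\<lambda>t. exp_minus (An n (ennreal t) \<omega>) * case_option 0 f (coord X (ennreal t) \<omega>) * indicator (alive X \<omega>) t)
    \<in> borel_measurable lborel"
    unfolding AE_all_countable using AE_killed_integrand_measurable[OF An f] by blast
  then have "AE \<omega> in law X (Some x). (\<lambda>n. killed_integral (An n) f \<omega>) \<longlonglongrightarrow> killed_integral A f \<omega>"
    using AE_killed_integrand_measurable[OF A f, of "Some x"] AE_killed_integrand_measurable[OF zero f, of "Some x"]
      lim AEfin[unfolded AE_completion_iff]
  proof eventually_elim
    case (elim \<omega>)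
    show ?case
      unfolding killed_integral_def
    proof (rule nn_integral_dominated_convergence[OF elim(1)[rule_format] elim(2,3)])
      show "AE t in lborel. exp_minus (An j (ennreal t) \<omega>) * case_option 0 f (coord X (ennreal t) \<omega>) * indicator (alive X \<omega>) t
          \<le> exp_minus 0 * case_option 0 f (coord X (ennreal t) \<omega>) * indicator (alive X \<omega>) t" for j
        by (intro AE_I2 mult_right_mono exp_minus_antimono) auto
      show "(\<integral>\<^sup>+t. exp_minus 0 * case_option 0 f (coord X (ennreal t) \<omega>) * indicator (alive X \<omega>) t \<partial>lborel) < \<infinity>"
        using elim(5) unfolding killed_integral_def by (simp add: less_top)
      then have "AE t in lborel. exp_minus 0 * case_option 0 f (coord X (ennreal t) \<omega>) * indicator (alive X \<omega>) t \<noteq> \<infinity>"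
        by (intro nn_integral_noteq_infinite elim(3)) auto
      then show "AE t in lborel. (\<lambda>n. exp_minus (An n (ennreal t) \<omega>) * case_option 0 f (coord X (ennreal t) \<omega>) * indicator (alive X \<omega>) t)
          \<longlonglongrightarrow> exp_minus (A (ennreal t) \<omega>) * case_option 0 f (coord X (ennreal t) \<omega>) * indicator (alive X \<omega>) t"
      proof eventually_elim
        case (elim t)
        let ?v = "case_option 0 f (coord X (ennreal t) \<omega>) * indicator (alive X \<omega>) t"
        \<comment> \<open>The product of limits needs a finite factor. \<open>f\<close> may be
          infinite, but finiteness of the dominating integral confines this to a null set of
          times.\<close>
        have v: "?v \<noteq> \<infinity>" using elim by (simp add: exp_minus_def mult.assoc)
        show ?case
        proof (cases "t \<in> alive X \<omega>")
          case True
          then have "(\<lambda>n. exp_minus (An n (ennreal t) \<omega>)) \<longlonglongrightarrow> exp_minus (A (ennreal t) \<omega>)"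
            using \<open>\<forall>t\<in>alive X \<omega>. _\<close> by (intro tendsto_exp_minus) blast
          then have "(\<lambda>n. exp_minus (An n (ennreal t) \<omega>) * ?v) \<longlonglongrightarrow> exp_minus (A (ennreal t) \<omega>) * ?v"
            using v exp_minus_le_1[of "A (ennreal t) \<omega>"]
            by (intro tendsto_mult_ennreal tendsto_const) (auto simp: top_unique)
          then show ?thesis by (simp add: mult.assoc)
        qed simp
      qed
    qed
  qed
  then have "AE \<omega> in ?M. (\<lambda>n. killed_integral (An n) f \<omega>) \<longlonglongrightarrow> killed_integral A f \<omega>" unfolding AE_completion_iff .
  then have "(\<lambda>n. \<integral>\<^sup>+\<omega>. killed_integral (An n) f \<omega> \<partial>?M) \<longlonglongrightarrow> (\<integral>\<^sup>+\<omega>. killed_integral A f \<omega> \<partial>?M)"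
    by (intro nn_integral_dominated_convergence[OF _ _ w _ wfin])
       (auto intro!: measurable_completion_law[OF measurable_killed_integral] A An f bnd AE_I2)
  then show ?thesis unfolding killed_potential_eq nn_integral_completion .
qed

end

section \<open>Convergence of the duality solutions\<close>

text \<open>\<open>measure_of\<close> yields either the displayed set function or, should that fail
  to be a measure, zero on every set. In both cases the total mass is at most
  \<open>ennreal c\<close>, so the bound alone gives finiteness.\<close>

lemma finite_positive_variation:
  fixes \<mu> :: "'e::topological_space set \<Rightarrow> real"
  assumes bound: "\<And>C. C \<in> sets borel \<Longrightarrow> \<mu> C \<le> c"
  shows "finite_measure (positive_variation \<mu>)" "sets (positive_variation \<mu>) = sets borel"
proof -
  show s: "sets (positive_variation \<mu>) = sets borel"
    unfolding positive_variation_def using sets.sigma_sets_eq[of "borel :: 'e measure"] by (subst sets_measure_of) auto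
  have "(SUP C\<in>{C \<in> sets borel. C \<subseteq> UNIV}. ennreal (\<mu> C)) \<le> ennreal c"
    by (intro SUP_least ennreal_leI) (simp add: bound)
  then have "emeasure (positive_variation \<mu>) UNIV \<le> ennreal c"
    unfolding positive_variation_def emeasure_measure_of_conv by auto
  then show "finite_measure (positive_variation \<mu>)"
    using sets_eq_imp_space_eq[OF s] by (intro finite_measureI) (auto simp: top_unique)
qed

lemma bounded_borel_measure_bound:
  assumes "bounded_borel_measure \<mu>"
  obtains c where "\<And>C. C \<in> sets borel \<Longrightarrow> \<bar>\<mu> C\<bar> \<le> c"
proof -
  obtain c where c: "\<And>\<A>. finite \<A> \<Longrightarrow> \<A> \<subseteq> sets borel \<Longrightarrow> disjoint \<A> \<Longrightarrow> (\<Sum>B\<in>\<A>. \<bar>\<mu> B\<bar>) \<le> c"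
    using assms unfolding bounded_borel_measure_def by blast
  show thesis
  proof (rule that)
    fix C :: "'a set" assume "C \<in> sets borel"
    then show "\<bar>\<mu> C\<bar> \<le> c" using c[of "{C}"] by simp
  qed
qed

lemma completion_integral_bounded:
  assumes F: "F \<in> borel_measurable (completion L)" "\<And>x. \<bar>F x\<bar> \<le> c" and L: "finite_measure L"
  shows "integrable (completion L) F" "\<bar>\<integral>x. F x \<partial>completion L\<bar> \<le> c * measure L (space L)"
proof -
  interpret L: finite_measure L by fact
  have "emeasure (completion L) (space L) = emeasure L (space L)" by simp
  then interpret c: finite_measure "completion L"
    by (intro finite_measureI) (simp del: emeasure_completion)
  show i: "integrable (completion L) F" by (rule c.integrable_const_bound[of _ c]) (use F in auto)
  have "\<bar>\<integral>x. F x \<partial>completion L\<bar> \<le> (\<integral>x. \<bar>F x\<bar> \<partial>completion L)" by (rule integral_abs_bound)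
  also have "\<dots> \<le> (\<integral>x. c \<partial>completion L)" using i F by (intro integral_mono) auto
  finally show "\<bar>\<integral>x. F x \<partial>completion L\<bar> \<le> c * measure L (space L)" by (simp add: mult.commute)
qed

lemma integral_dominated_by_zero_sequence:
  assumes L: "finite_measure L" and d: "\<And>n::nat. d n \<in> borel_measurable (completion L)"
    and c: "\<And>n x. \<bar>d n x\<bar> \<le> c" and lim: "\<And>x. (\<lambda>n. d n x) \<longlonglongrightarrow> 0"
  shows "(\<lambda>n. \<integral>x. d n x \<partial>completion L) \<longlonglongrightarrow> (0 :: real)"
proof -
  have "(\<lambda>n. \<integral>x. d n x \<partial>completion L) \<longlonglongrightarrow> (\<integral>x. 0 \<partial>completion L)"
    by (rule integral_dominated_convergence[where w="\<lambda>_. c"])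
       (use d c lim completion_integral_bounded[OF _ _ L, of "\<lambda>_. c" "\<bar>c\<bar>"] in auto)
  then show ?thesis by simp
qed

lemma enn2real_bound: "a \<le> ennreal c \<Longrightarrow> 0 \<le> c \<Longrightarrow> enn2real a \<le> c"
  using enn2real_mono[of a "ennreal c"] by simp

section \<open>Signed test functions dominated by \<open>\<rho>\<close>\<close>

context lc_hunt_process
begin

lemma killed_potential_real:
  assumes "\<And>x. resolvent X 0 f x \<le> ennreal c" "0 \<le> c"
  shows "killed_potential X A f x = ennreal (enn2real (killed_potential X A f x))"
    and "enn2real (killed_potential X A f x) \<le> c"
proof -
  have le: "killed_potential X A f x \<le> ennreal c"
    using killed_potential_le_resolvent assms(1) by (rule order_trans)
  then show "enn2real (killed_potential X A f x) \<le> c" using assms(2) by (rule enn2real_bound)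
  show "killed_potential X A f x = ennreal (enn2real (killed_potential X A f x))"
    using le by (simp add: le_less_trans)
qed

lemma resolvent_mono: "(\<And>y. f y \<le> g y) \<Longrightarrow> resolvent X \<alpha> f x \<le> resolvent X \<alpha> g x"
  unfolding resolvent_def
  by (intro nn_integral_mono mult_right_mono mult_left_mono) (auto split: option.split)

text \<open>The potentials of the positive and the negative part both lie between zero and
  \<open>c\<close>, so their difference is bounded by \<open>c\<close> itself.\<close>

lemma killed_potential_signed_bound:
  assumes \<rho>: "\<And>x. resolvent X 0 \<rho> x \<le> ennreal c" "0 \<le> c" and \<eta>: "\<And>x. ennreal \<bar>\<eta> x\<bar> \<le> \<rho> x"
  shows "\<bar>killed_potential_signed X A \<eta> x\<bar> \<le> c"
proof -
  have le: "ennreal (\<eta> y) \<le> \<rho> y" "ennreal (- \<eta> y) \<le> \<rho> y" for y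
    by (rule order_trans[OF ennreal_leI \<eta>], simp)+
  have "enn2real (killed_potential X A (\<lambda>y. ennreal (\<eta> y)) x) \<le> c"
    "enn2real (killed_potential X A (\<lambda>y. ennreal (- \<eta> y)) x) \<le> c"
    by (rule killed_potential_real(2)[OF order_trans[OF resolvent_mono[OF le(1)] \<rho>(1)] \<rho>(2)],
        rule killed_potential_real(2)[OF order_trans[OF resolvent_mono[OF le(2)] \<rho>(1)] \<rho>(2)])
  then show ?thesis unfolding killed_potential_signed_def
    using enn2real_nonneg[of "killed_potential X A (\<lambda>y. ennreal (\<eta> y)) x"]
      enn2real_nonneg[of "killed_potential X A (\<lambda>y. ennreal (- \<eta> y)) x"] by linarith
qed

lemma measurable_killed_potential_signed:
  assumes A: "measurable_functional A" and \<eta> [measurable]: "\<eta> \<in> borel_measurable borel"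
    and L: "finite_measure L" "sets L = sets borel"
  shows "killed_potential_signed X A \<eta> \<in> borel_measurable (completion L)"
proof -
  have [measurable]: "killed_potential X A (\<lambda>y. ennreal (\<eta> y)) \<in> borel_measurable (completion L)"
    "killed_potential X A (\<lambda>y. ennreal (- \<eta> y)) \<in> borel_measurable (completion L)"
    by (intro measurable_killed_potential[OF A _ L], measurable)+
  show ?thesis unfolding killed_potential_signed_def[abs_def] by measurable
qed

text \<open>The weight \<open>exp (- B) - exp (- A)\<close> is non-negative, so only the bound \<open>\<rho>\<close> of \<open>\<eta>\<close> matters.\<close>

lemma killed_potential_signed_diff:
  assumes A: "measurable_functional A" and B: "measurable_functional B"
    and le: "AE \<omega> in law X (Some x). \<forall>t\<in>alive X \<omega>. B (ennreal t) \<omega> \<le> A (ennreal t) \<omega>"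
    and \<rho>: "\<rho> \<in> borel_measurable borel" "\<And>x. resolvent X 0 \<rho> x \<le> ennreal c" "0 \<le> c"
    and \<eta>: "\<eta> \<in> borel_measurable borel" "\<And>x. ennreal \<bar>\<eta> x\<bar> \<le> \<rho> x"
  shows "\<bar>killed_potential_signed X B \<eta> x - killed_potential_signed X A \<eta> x\<bar> \<le>
    enn2real (killed_potential X B \<rho> x) - enn2real (killed_potential X A \<rho> x)"
proof -
  let ?p = "\<lambda>y. ennreal (\<eta> y)" and ?q = "\<lambda>y. ennreal (- \<eta> y)"
  \<comment> \<open>\<open>\<rho>\<close> is the sum of the two parts of \<open>\<eta>\<close> and
    this remainder. Passing from \<open>A\<close> to the smaller \<open>B\<close> does not decrease
    the potential of any of the three, so the signed change for \<open>\<eta>\<close> is at most the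
    change for \<open>\<rho>\<close>.\<close>
  let ?r = "\<lambda>y. \<rho> y - (?p y + ?q y)"
  have pq: "?p y + ?q y = ennreal \<bar>\<eta> y\<bar>" for y by (cases "0 \<le> \<eta> y") (auto simp: ennreal_neg)
  have sum: "\<rho> y = ?p y + ?q y + ?r y" for y
    using \<eta>(2)[of y] unfolding pq by (simp add: add_diff_inverse_ennreal)
  have [measurable]: "?p \<in> borel_measurable borel" "?q \<in> borel_measurable borel" using \<eta>(1) by measurable
  have [measurable]: "?r \<in> borel_measurable borel" using \<rho>(1) by measurable
  have split: "killed_potential X C \<rho> x = killed_potential X C ?p x + killed_potential X C ?q x + killed_potential X C ?r x"
    if C: "measurable_functional C" for C
  proof -
    have "killed_potential X C (\<lambda>y. (?p y + ?q y) + ?r y) x = killed_potential X C (\<lambda>y. ?p y + ?q y) x + killed_potential X C ?r x"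
      by (rule killed_potential_add[OF C]) measurable
    also have "killed_potential X C (\<lambda>y. ?p y + ?q y) x = killed_potential X C ?p x + killed_potential X C ?q x"
      by (rule killed_potential_add[OF C]) measurable
    finally show ?thesis using sum by simp
  qed
  have le_\<rho>: "?p y \<le> \<rho> y" "?q y \<le> \<rho> y" "?r y \<le> \<rho> y" for y
    by (rule order_trans[OF ennreal_leI \<eta>(2)], simp)+ (rule diff_le_self_ennreal)
  have real: "killed_potential X C g x = ennreal (enn2real (killed_potential X C g x))" if "\<And>y. g y \<le> \<rho> y" for C g
    by (rule killed_potential_real(1)[OF order_trans[OF resolvent_mono[OF that] \<rho>(2)] \<rho>(3)])
  let ?K = "\<lambda>C g. enn2real (killed_potential X C g x)"
  have splitr: "?K C \<rho> = ?K C ?p + ?K C ?q + ?K C ?r" if C: "measurable_functional C" for C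
  proof -
    have "killed_potential X C \<rho> x = ennreal (?K C ?p) + ennreal (?K C ?q) + ennreal (?K C ?r)"
      using split[OF C] real[of ?p C] real[of ?q C] real[of ?r C] le_\<rho> by metis
    also have "\<dots> = ennreal (?K C ?p + ?K C ?q + ?K C ?r)" by simp
    finally have *: "killed_potential X C \<rho> x = ennreal (?K C ?p + ?K C ?q + ?K C ?r)" .
    show ?thesis unfolding * by (rule enn2real_ennreal) simp
  qed
  have mono: "?K A g \<le> ?K B g" if "\<And>y. g y \<le> \<rho> y" for g
  proof (rule enn2real_mono)
    show "killed_potential X A g x \<le> killed_potential X B g x" by (rule killed_potential_antimono[OF le])
    show "killed_potential X B g x < top" using real[of g B] that by (metis ennreal_less_top)
  qed
  show ?thesis
    unfolding splitr[OF A] splitr[OF B] killed_potential_signed_def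
    using mono[of ?p] mono[of ?q] mono[of ?r] le_\<rho> by (simp add: abs_le_iff) 
qed

end

context green_process
begin

definition dual_representation ::
    "('e set \<Rightarrow> real) \<Rightarrow> (ennreal \<Rightarrow> 'w \<Rightarrow> ennreal) \<Rightarrow> ('e \<Rightarrow> real) \<Rightarrow> bool" where
  "dual_representation \<mu> A u \<longleftrightarrow>
     (\<forall>\<eta>\<in>borel_measurable borel. (SUP x. resolvent X 0 (\<lambda>y. ennreal \<bar>\<eta> y\<bar>) x) < \<infinity> \<longrightarrow>
        integrable m (\<lambda>x. u x * \<eta> x) \<and>
        (\<integral>x. u x * \<eta> x \<partial>m) = signed_integral \<mu> (killed_potential_signed X A \<eta>))"

lemma duality_solution_representation:
  assumes "duality_solution m D \<E> X G \<nu> \<mu> u"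
  shows "u \<in> borel_measurable borel"
    and "\<exists>A. smooth_functional m D \<E> X G \<nu> A \<and> measurable_functional A \<and> dual_representation \<mu> A u"
proof -
  show "u \<in> borel_measurable borel" using assms by (simp add: duality_solution_def)
  obtain A where A: "smooth_functional m D \<E> X G \<nu> A" "dual_representation \<mu> A u"
    using assms unfolding duality_solution_def dual_representation_def by blast
  moreover have "measurable_functional A"
  proof -
    obtain \<gamma> B where "approximated_by m D \<E> X G \<nu> \<gamma> B" "A = (\<lambda>t \<omega>. SUP n. B n t \<omega>)"
      using smooth_functionalE[OF A(1)] .
    then show ?thesis by (simp add: approximated_by_def measurable_functional_SUP)
  qed
  ultimately show "\<exists>A. smooth_functional m D \<E> X G \<nu> A \<and> measurable_functional A \<and> dual_representation \<mu> A u"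
    by blast
qed

lemma dual_representationD:
  assumes "dual_representation \<mu> A u" "\<eta> \<in> borel_measurable borel"
    "(SUP x. resolvent X 0 (\<lambda>y. ennreal \<bar>\<eta> y\<bar>) x) < \<infinity>"
  shows "integrable m (\<lambda>x. u x * \<eta> x)" "(\<integral>x. u x * \<eta> x \<partial>m) = signed_integral \<mu> (killed_potential_signed X A \<eta>)"
  using assms unfolding dual_representation_def by auto

end

text \<open>Where \<open>\<rho>\<close> is infinite, \<open>u\<close> vanishes almost everywhere and
  the product is zero by convention; elsewhere \<open>\<rho>\<close> equals its real part.\<close>

lemma density_real_part:
  fixes u :: "'e \<Rightarrow> real" and \<rho> :: "'e \<Rightarrow> ennreal"
  assumes [measurable]: "u \<in> borel_measurable M" "\<rho> \<in> borel_measurable M"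
    and zero: "AE x in M. \<rho> x = \<infinity> \<longrightarrow> u x = 0" and int: "integrable M (\<lambda>x. u x * enn2real (\<rho> x))"
  shows "integrable (density M \<rho>) u" "(\<integral>x. \<bar>u x\<bar> \<partial>density M \<rho>) = (\<integral>x. \<bar>u x\<bar> * enn2real (\<rho> x) \<partial>M)"
proof -
  have "(\<integral>\<^sup>+x. ennreal \<bar>u x\<bar> \<partial>density M \<rho>) = (\<integral>\<^sup>+x. \<rho> x * ennreal \<bar>u x\<bar> \<partial>M)"
    by (rule nn_integral_density) measurable
  also have "\<dots> = (\<integral>\<^sup>+x. ennreal (\<bar>u x\<bar> * enn2real (\<rho> x)) \<partial>M)"
    using zero
  proof (intro nn_integral_cong_AE, eventually_elim)
    case (elim x)
    then show ?case by (cases "\<rho> x") (auto simp: ennreal_mult mult.commute)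
  qed
  finally have eq: "(\<integral>\<^sup>+x. ennreal \<bar>u x\<bar> \<partial>density M \<rho>) = (\<integral>\<^sup>+x. ennreal (\<bar>u x\<bar> * enn2real (\<rho> x)) \<partial>M)" .
  have i: "integrable M (\<lambda>x. \<bar>u x\<bar> * enn2real (\<rho> x))"
    using integrable_abs[OF int] by (simp add: abs_mult)
  then have "(\<integral>\<^sup>+x. ennreal \<bar>u x\<bar> \<partial>density M \<rho>) < \<infinity>"
    unfolding eq by (subst nn_integral_eq_integral) auto
  then show "integrable (density M \<rho>) u" by (intro integrableI_bounded) auto
  show "(\<integral>x. \<bar>u x\<bar> \<partial>density M \<rho>) = (\<integral>x. \<bar>u x\<bar> * enn2real (\<rho> x) \<partial>M)"
    by (subst (1 2) integral_eq_nn_integral) (auto simp: eq)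
qed

theorem proposition4p7:
  fixes m :: "'e::{metric_space, second_countable_topology} measure"
    and DA :: "('e \<Rightarrow> real) set" and A :: "('e \<Rightarrow> real) \<Rightarrow> 'e \<Rightarrow> real"
    and T :: "real \<Rightarrow> ('e \<Rightarrow> real) \<Rightarrow> 'e \<Rightarrow> real"
    and DE :: "('e \<Rightarrow> real) set" and \<E> :: "('e \<Rightarrow> real) \<Rightarrow> ('e \<Rightarrow> real) \<Rightarrow> real"
    and X :: "('w, 'e) markov_process" and G :: "'e \<Rightarrow> 'e \<Rightarrow> ennreal"
    and \<mu> :: "'e set \<Rightarrow> real" and \<nu> :: "'e measure" and \<nu>n :: "nat \<Rightarrow> 'e measure"
    and u :: "'e \<Rightarrow> real" and un :: "nat \<Rightarrow> 'e \<Rightarrow> real" and \<rho> :: "'e \<Rightarrow> ennreal"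
  assumes setting: "green_setting m DA A T DE \<E> X G"
    and \<mu>: "bounded_borel_measure \<mu>"
    and \<nu>: "smooth_measure m DE \<E> \<nu>"
    and \<nu>n: "\<And>n. strictly_smooth_measure m DE \<E> G (\<nu>n n)"
    and \<nu>n_increasing: "measures_increase_to \<nu>n \<nu>"
    and u: "duality_solution m DE \<E> X G \<nu> \<mu> u"
    and un: "\<And>n. duality_solution m DE \<E> X G (\<nu>n n) \<mu> (un n)"
    and \<rho>: "\<rho> \<in> borel_measurable borel" "(SUP x. resolvent X 0 \<rho> x) < \<infinity>"
  shows "integrable (density m \<rho>) u \<and> (\<forall>n. integrable (density m \<rho>) (un n)) \<and>
    (\<lambda>n. \<integral>x. \<bar>un n x - u x\<bar> \<partial>density m \<rho>) \<longlonglongrightarrow> 0"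
proof -
  interpret green_setting m DA A T DE \<E> X G by fact
  interpret green_process X m DE \<E> G
    by unfold_locales (use locally_compact green_excessive_right in \<open>auto simp: excessive_def\<close>)
  obtain a where a: "\<And>C. C \<in> sets borel \<Longrightarrow> \<bar>\<mu> C\<bar> \<le> a" using bounded_borel_measure_bound[OF \<mu>] by blast
  define P where "P = positive_variation \<mu>"
  define Q where "Q = positive_variation (\<lambda>B. - \<mu> B)"
  have P: "finite_measure P" "sets P = sets borel" and Q: "finite_measure Q" "sets Q = sets borel"
    unfolding P_def Q_def using a by (auto intro!: finite_positive_variation[of _ a] dest: abs_le_D1 abs_le_D2)
  have signed: "signed_integral \<mu> F = (\<integral>x. F x \<partial>completion P) - (\<integral>x. F x \<partial>completion Q)" for F
    by (simp add: signed_integral_def P_def Q_def)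
  define c where "c = enn2real (SUP x. resolvent X 0 \<rho> x)"
  have c: "resolvent X 0 \<rho> x \<le> ennreal c" "0 \<le> c" for x
    unfolding c_def using \<rho>(2) by (auto intro: SUP_upper)
  note u_meas = duality_solution_representation(1)[OF u] and un_meas = duality_solution_representation(1)[OF un]
  obtain B where B: "smooth_functional m DE \<E> X G \<nu> B" "measurable_functional B" "dual_representation \<mu> B u"
    using duality_solution_representation(2)[OF u] by blast
  obtain C where C: "\<And>n. smooth_functional m DE \<E> X G (\<nu>n n) (C n)" "\<And>n. measurable_functional (C n)"
    "\<And>n. dual_representation \<mu> (C n) (un n)"
    using duality_solution_representation(2)[OF un] by metis
  note repB = dual_representationD[OF B(3)] and repC = dual_representationD[OF C(3)]
  note [measurable_cong] = sets_m
  note [measurable] = \<rho>(1) u_meas un_meas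
  have lim: "AE \<omega> in law X (Some x). \<forall>t\<in>alive X \<omega>. (\<forall>n. C n (ennreal t) \<omega> \<le> B (ennreal t) \<omega>) \<and>
      (\<lambda>n. C n (ennreal t) \<omega>) \<longlonglongrightarrow> B (ennreal t) \<omega>" for x
    by (rule smooth_functional_increasing_limit[OF \<nu> strictly_smooth_smooth[OF \<nu>n] \<nu>n_increasing B(1) C(1)])
  \<comment> \<open>This difference bounds the change of the potential of every test function
    dominated by \<open>\<rho>\<close>. In \<open>err\<close> the contributions of the two
    variations of \<open>\<mu>\<close> are added, since a bound with respect to the total variation
    is wanted.\<close>
  define d where "d n x = enn2real (killed_potential X (C n) \<rho> x) - enn2real (killed_potential X B \<rho> x)" for n x
  define err where "err n = (\<integral>x. d n x \<partial>completion P) + (\<integral>x. d n x \<partial>completion Q)" for n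
  have d_meas: "d n \<in> borel_measurable (completion L)" if L: "finite_measure L" "sets L = sets borel" for n and L :: "'e measure"
    unfolding d_def[abs_def]
    using measurable_killed_potential[OF C(2) \<rho>(1) L] measurable_killed_potential[OF B(2) \<rho>(1) L] by measurable
  have d_bound: "\<bar>d n x\<bar> \<le> c" for n x
    unfolding d_def using killed_potential_real(2)[of \<rho> c, OF c]
      enn2real_nonneg[of "killed_potential X (C n) \<rho> x"] enn2real_nonneg[of "killed_potential X B \<rho> x"]
    by (smt (verit))
  have d_lim: "(\<lambda>n. d n x) \<longlonglongrightarrow> 0" for x
  proof -
    have "(\<lambda>n. killed_potential X (C n) \<rho> x) \<longlonglongrightarrow> killed_potential X B \<rho> x"
      using c(1)[of x] lim[of x]
      by (intro killed_potential_tendsto[OF B(2) C(2) \<rho>(1)]) (auto elim!: eventually_mono intro: le_less_trans)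
    then have "(\<lambda>n. enn2real (killed_potential X (C n) \<rho> x)) \<longlonglongrightarrow> enn2real (killed_potential X B \<rho> x)"
      by (intro tendsto_enn2real) (use killed_potential_real(1)[of \<rho> c, OF c, symmetric] in auto)
    from tendsto_diff[OF this tendsto_const[of "enn2real (killed_potential X B \<rho> x)"]]
    show ?thesis by (simp add: d_def)
  qed
  have err: "err \<longlonglongrightarrow> 0"
    unfolding err_def[abs_def] using tendsto_add[OF
      integral_dominated_by_zero_sequence[OF P(1) d_meas[OF P] d_bound d_lim]
      integral_dominated_by_zero_sequence[OF Q(1) d_meas[OF Q] d_bound d_lim]] by simp
  have test: "(SUP x. resolvent X 0 (\<lambda>y. ennreal \<bar>\<eta> y\<bar>) x) < \<infinity>" if "\<And>x. ennreal \<bar>\<eta> x\<bar> \<le> \<rho> x" for \<eta>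
    using \<rho>(2) by (rule le_less_trans[rotated]) (rule SUP_mono', rule resolvent_mono, rule that)
  have diff: "\<bar>(\<integral>x. un n x * \<eta> x \<partial>m) - (\<integral>x. u x * \<eta> x \<partial>m)\<bar> \<le> err n"
    if \<eta> [measurable]: "\<eta> \<in> borel_measurable borel" and le: "\<And>x. ennreal \<bar>\<eta> x\<bar> \<le> \<rho> x" for n \<eta>
  proof -
    let ?F = "killed_potential_signed X B \<eta>" and ?Fn = "killed_potential_signed X (C n) \<eta>"
    have one: "\<bar>(\<integral>x. ?Fn x \<partial>completion L) - (\<integral>x. ?F x \<partial>completion L)\<bar> \<le> (\<integral>x. d n x \<partial>completion L)"
      if L: "finite_measure L" "sets L = sets borel" for L :: "'e measure"
    proof -
      have i: "integrable (completion L) ?Fn" "integrable (completion L) ?F" "integrable (completion L) (d n)"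
        using killed_potential_signed_bound[of \<rho> c \<eta>, OF c le] d_bound
        by (auto intro!: completion_integral_bounded(1)[OF _ _ L(1)] measurable_killed_potential_signed B(2) C(2) \<eta> L d_meas)
      have "\<bar>(\<integral>x. ?Fn x \<partial>completion L) - (\<integral>x. ?F x \<partial>completion L)\<bar> = \<bar>\<integral>x. ?Fn x - ?F x \<partial>completion L\<bar>"
        using i by simp
      also have "\<dots> \<le> (\<integral>x. \<bar>?Fn x - ?F x\<bar> \<partial>completion L)" by (rule integral_abs_bound)
      also have "\<dots> \<le> (\<integral>x. d n x \<partial>completion L)"
      proof (rule integral_mono)
        show "integrable (completion L) (\<lambda>x. \<bar>?Fn x - ?F x\<bar>)" using i by auto
        fix x
        have "AE \<omega> in law X (Some x). \<forall>t\<in>alive X \<omega>. C n (ennreal t) \<omega> \<le> B (ennreal t) \<omega>"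
          using lim[of x] by (auto elim: eventually_mono)
        from killed_potential_signed_diff[OF B(2) C(2) this \<rho>(1) c \<eta> le]
        show "\<bar>?Fn x - ?F x\<bar> \<le> d n x" unfolding d_def .
      qed (rule i)
      finally show ?thesis .
    qed
    have "\<bar>signed_integral \<mu> ?Fn - signed_integral \<mu> ?F\<bar> \<le> err n"
      unfolding signed err_def using one[OF P] one[OF Q] by linarith
    then show ?thesis using repB(2)[OF \<eta> test[OF le]] repC(2)[OF \<eta> test[OF le], of n] by simp
  qed
  \<comment> \<open>On the set where \<open>\<rho>\<close> is infinite every multiple of
    \<open>sgn v\<close> is a test function dominated by \<open>\<rho>\<close>. The duality equation
    bounds all the resulting integrals by one constant, so the integral of the absolute value of
    \<open>v\<close> over this set is zero.\<close>
  have zero: "AE x in m. \<rho> x = \<infinity> \<longrightarrow> v x = 0"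
    if v [measurable]: "v \<in> borel_measurable borel" and K: "measurable_functional K"
      and dual: "dual_representation \<mu> K v" for v K
  proof -
    have S [measurable]: "{x. \<rho> x = \<infinity>} \<in> sets borel"
      using measurable_sets[OF \<rho>(1), of "{\<infinity>}"] by (simp add: vimage_def)
    let ?i = "\<lambda>x. indicator {x. \<rho> x = \<infinity>} x :: real"
    let ?I = "\<integral>x. \<bar>v x\<bar> * ?i x \<partial>m"
    let ?M = "c * measure P (space P) + c * measure Q (space Q)"
    have k: "integrable m (\<lambda>x. v x * (real k * sgn (v x) * ?i x)) \<and> \<bar>\<integral>x. v x * (real k * sgn (v x) * ?i x) \<partial>m\<bar> \<le> ?M" for k
    proof -
      let ?\<eta> = "\<lambda>x. real k * sgn (v x) * ?i x"
      have \<eta>: "?\<eta> \<in> borel_measurable borel" by measurable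
      have le: "ennreal \<bar>?\<eta> x\<bar> \<le> \<rho> x" for x by (auto simp: indicator_def)
      have b: "\<bar>\<integral>x. killed_potential_signed X K ?\<eta> x \<partial>completion L\<bar> \<le> c * measure L (space L)"
        if "finite_measure L" "sets L = sets borel" for L :: "'e measure"
        using killed_potential_signed_bound[of \<rho> c ?\<eta>, OF c le]
        by (intro completion_integral_bounded(2) measurable_killed_potential_signed K \<eta> that)
      have "\<bar>signed_integral \<mu> (killed_potential_signed X K ?\<eta>)\<bar> \<le> ?M"
        unfolding signed using b[OF P] b[OF Q] by linarith
      then show ?thesis using dual_representationD[OF dual \<eta> test[OF le]] by simp
    qed
    have eq: "v x * (real k * sgn (v x) * ?i x) = real k * (\<bar>v x\<bar> * ?i x)" for k x
      by (simp add: abs_sgn mult_ac)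
    have i: "integrable m (\<lambda>x. \<bar>v x\<bar> * ?i x)" using k[of 1] unfolding eq by simp
    have I0: "0 \<le> ?I" by (intro integral_nonneg_AE) auto
    have kI: "real k * ?I \<le> ?M" for k using k[of k] unfolding eq by simp
    have "?I \<le> 0"
    proof (rule ccontr)
      assume "\<not> ?I \<le> 0"
      then obtain k where "?M < real k * ?I" using reals_Archimedean3[of ?I] by auto
      with kI[of k] show False by simp
    qed
    from this I0 have "?I = 0" by (rule antisym)
    then have "AE x in m. \<bar>v x\<bar> * ?i x = 0"
      using i by (subst (asm) integral_nonneg_eq_0_iff_AE) auto
    then show ?thesis by eventually_elim (auto simp: indicator_def split: if_splits)
  qed
  have u0: "AE x in m. \<rho> x = \<infinity> \<longrightarrow> u x = 0" by (rule zero[OF u_meas B(2,3)])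
  have un0: "AE x in m. \<rho> x = \<infinity> \<longrightarrow> un n x = 0" for n by (rule zero[OF un_meas C(2,3)])
  let ?\<rho> = "\<lambda>x. enn2real (\<rho> x)"
  have \<rho>_le: "ennreal \<bar>enn2real (\<rho> x)\<bar> \<le> \<rho> x" for x by (cases "\<rho> x") auto
  have int_u: "integrable m (\<lambda>x. u x * ?\<rho> x)" using repB(1)[OF _ test[OF \<rho>_le]] by simp
  have int_un: "integrable m (\<lambda>x. un n x * ?\<rho> x)" for n using repC(1)[OF _ test[OF \<rho>_le]] by simp
  have "(\<integral>x. \<bar>un n x - u x\<bar> \<partial>density m \<rho>) \<le> err n" for n
  proof -
    \<comment> \<open>Test functions are real-valued, so \<open>\<rho>\<close> enters through
      \<open>enn2real\<close>. This differs from \<open>\<rho>\<close> only where both solutions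
      vanish almost everywhere.\<close>
    let ?\<eta> = "\<lambda>x. sgn (un n x - u x) * ?\<rho> x"
    have \<eta>: "?\<eta> \<in> borel_measurable borel" by measurable
    have le: "ennreal \<bar>?\<eta> x\<bar> \<le> \<rho> x" for x
      using \<rho>_le[of x] by (auto simp: abs_mult abs_sgn_eq)
    have "(\<integral>x. \<bar>un n x - u x\<bar> \<partial>density m \<rho>) = (\<integral>x. \<bar>un n x - u x\<bar> * ?\<rho> x \<partial>m)"
    proof (rule density_real_part(2))
      show "AE x in m. \<rho> x = \<infinity> \<longrightarrow> un n x - u x = 0" using u0 un0[of n] by eventually_elim auto
      show "integrable m (\<lambda>x. (un n x - u x) * ?\<rho> x)" using int_u int_un[of n] by (simp add: left_diff_distrib)
    qed measurable
    also have "\<dots> = (\<integral>x. un n x * ?\<eta> x - u x * ?\<eta> x \<partial>m)"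
      by (rule Bochner_Integration.integral_cong) (auto simp: abs_sgn algebra_simps)
    also have "\<dots> = (\<integral>x. un n x * ?\<eta> x \<partial>m) - (\<integral>x. u x * ?\<eta> x \<partial>m)"
      using repB(1)[OF \<eta> test[OF le]] repC(1)[OF \<eta> test[OF le], of n] by (intro Bochner_Integration.integral_diff) auto
    also have "\<dots> \<le> err n" using diff[OF \<eta> le, of n] by linarith
    finally show ?thesis .
  qed
  then have "(\<lambda>n. \<integral>x. \<bar>un n x - u x\<bar> \<partial>density m \<rho>) \<longlonglongrightarrow> 0"
    by (intro tendsto_sandwich[OF _ _ tendsto_const err]) (auto intro!: always_eventually integral_nonneg_AE)
  moreover have "integrable (density m \<rho>) u" by (rule density_real_part(1)[OF _ _ u0 int_u]) measurable
  moreover have "integrable (density m \<rho>) (un n)" for n by (rule density_real_part(1)[OF _ _ un0 int_un]) measurable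
  ultimately show ?thesis by blast
qed

end
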